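(* Let $(M,g)$ be an oriented Riemannian $4$-manifold such that $W_+$ vanishes nowhere. Then the following conditions are equivalent: (i) $g$ is locally a Kähler metric with respect to local complex structures that are compatible with the given orientation. (ii) The equations $(\det W_+)^2=\frac1{54}|W_+|^6$ and $|\nabla W_+|^2=\big|\nabla|W_+|\big|^2$ are satisfied. (iii) The equations $(\det W_+)^2=\frac1{54}|W_+|^6$ and $\delta W_++\nabla\log|W_+|\lrcorner W_+=0$ are satisfied.
   Context: Condition (i) means: every point of $M$ has an open neighbourhood $U$ carrying an endomorphism field $J$ of $TU$ with $J^2=-1$, $J^*=-J$, $\nabla J=0$ ($\nabla$ the Levi-Civita connection), such that $\frac12\Omega\wedge\Omega$, with $\Omega(X,Y)=g(JX,Y)$, is the volume form of the given orientation. $(X_k)$ denotes a local orthonormal frame; repeated indices are summed. $R(X,Y)Z=\nabla^2_{X,Y}Z-\nabla^2_{Y,X}Z$ with $\nabla^2_{X,Y}=\nabla_X\circ\nabla_Y-\nabla_{\nabla_XY}$. Skew-symmetric endomorphisms $A$ of $TM$ are identified with $2$-forms via $\Omega_A(X,Y)=g(AX,Y)$, with scalar product $\langle A,B\rangle=\frac14\mathrm{tr}(A^*\circ B)$. The Weyl tensor $W$ (the totally trace-free part of $R$) acts on them by $W(A)=W(AX_k,X_k)$; it preserves the rank-$3$ bundle $\Lambda^2_+$ of self-dual $2$-forms, and $W_+:\Lambda^2_+\to\Lambda^2_+$ is its restriction (extended by $0$ to anti-self-dual forms where needed). $\det(W_+)$ is the determinant of $W_+:\Lambda^2_+\to\Lambda^2_+$,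 $|W_+|^2=\mathrm{tr}(W_+\circ W_+)$, $|\nabla W_+|^2=\mathrm{tr}(\nabla_{X_k}W_+\circ\nabla_{X_k}W_+)$, and $|\nabla f|^2=g(\nabla f,\nabla f)$ for a function $f$. With $(g(Y)\otimes X)(Z)=g(Y,Z)X$: $W_+(X,Y)=\frac12W_+(g(Y)\otimes X-g(X)\otimes Y)$; $(X\lrcorner W_+)(Y)=W_+(X,Y)$; and $\delta W_+(X)=\frac12(\nabla_{X_k}W_+)(g(X_k)\otimes X-g(X)\otimes X_k)$, i.e. $\delta W_+(X)=(\nabla_{X_k}W_+)(X,X_k)$. *)

theory Defs
  imports "HOL-Analysis.Analysis"
begin

section \<open>Oriented Riemannian 4-manifolds\<close>

text \<open>Smoothness (\<open>C\<^sup>\<infinity>\<close>) on an open set, by iterated directional derivatives.\<close>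

primrec Ck_on :: "nat \<Rightarrow> 'a::real_normed_vector set \<Rightarrow> ('a \<Rightarrow> 'b::real_normed_vector) \<Rightarrow> bool" where
  "Ck_on 0 S f \<longleftrightarrow> continuous_on S f"
| "Ck_on (Suc k) S f \<longleftrightarrow> (\<forall>x\<in>S. f differentiable (at x)) \<and>
     (\<forall>v. Ck_on k S (\<lambda>x. frechet_derivative f (at x) v))"

definition smooth_on :: "'a::real_normed_vector set \<Rightarrow> ('a \<Rightarrow> 'b::real_normed_vector) \<Rightarrow> bool" where
  "smooth_on S f \<longleftrightarrow> (\<forall>k. Ck_on k S f)"

type_synonym 'a chart = "'a set \<times> ('a \<Rightarrow> real^4)"

definition chart_image :: "'a chart \<Rightarrow> (real^4) set" where
  "chart_image c = snd c ` fst c"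

definition transition :: "'a chart \<Rightarrow> 'a chart \<Rightarrow> real^4 \<Rightarrow> real^4" where
  "transition c c' = snd c' \<circ> inv_into (fst c) (snd c)"

text \<open>The orientation is the one for which all charts of the atlas are positively oriented;
  this is why the Jacobian determinants of the transition maps are required to be positive.\<close>

locale oriented_4manifold =
  fixes M :: "'a topology" and atlas :: "'a chart set"
  assumes Hausdorff: "Hausdorff_space M"
    and second_countable: "second_countable M"
    and chart_domain_open: "c \<in> atlas \<Longrightarrow> openin M (fst c)"
    and chart_image_open: "c \<in> atlas \<Longrightarrow> open (chart_image c)"
    and chart_homeomorphic: "c \<in> atlas \<Longrightarrow>
          homeomorphic_map (subtopology M (fst c)) (top_of_set (chart_image c)) (snd c)"
    and atlas_cover: "(\<Union>c\<in>atlas. fst c) = topspace M"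
    and transition_smooth: "\<lbrakk>c \<in> atlas; c' \<in> atlas\<rbrakk> \<Longrightarrow>
          smooth_on (snd c ` (fst c \<inter> fst c')) (transition c c')"
    and transition_orientation: "\<lbrakk>c \<in> atlas; c' \<in> atlas; x \<in> snd c ` (fst c \<inter> fst c')\<rbrakk> \<Longrightarrow>
          det (jacobian (transition c c') (at x)) > 0"

text \<open>Tensor fields are given by their components in each chart of the atlas, as functions of the
  chart coordinates, subject to the transformation law of the tensor type.  Here \<open>g c x\<close> is the
  Gram matrix of the metric in the coordinate frame of the chart \<open>c\<close>, at the point with
  coordinates \<open>x\<close>.\<close>

locale oriented_riemannian_4manifold = oriented_4manifold M atlas
  for M :: "'a topology" and atlas :: "'a chart set" +
  fixes g :: "'a chart \<Rightarrow> real^4 \<Rightarrow> real^4^4"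
  assumes metric_smooth: "c \<in> atlas \<Longrightarrow> smooth_on (chart_image c) (g c)"
    and metric_symmetric: "\<lbrakk>c \<in> atlas; x \<in> chart_image c\<rbrakk> \<Longrightarrow> transpose (g c x) = g c x"
    and metric_positive: "\<lbrakk>c \<in> atlas; x \<in> chart_image c; v \<noteq> 0\<rbrakk> \<Longrightarrow> v \<bullet> (g c x *v v) > 0"
    and metric_transform: "\<lbrakk>c \<in> atlas; c' \<in> atlas; x \<in> snd c ` (fst c \<inter> fst c')\<rbrakk> \<Longrightarrow>
          g c x = transpose (jacobian (transition c c') (at x)) ** g c' (transition c c' x)
                    ** jacobian (transition c c') (at x)"

definition endomorphism_field ::
    "'a chart set \<Rightarrow> 'a set \<Rightarrow> ('a chart \<Rightarrow> real^4 \<Rightarrow> real^4^4) \<Rightarrow> bool" where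
  "endomorphism_field atlas U J \<longleftrightarrow>
     (\<forall>c\<in>atlas. smooth_on (snd c ` (fst c \<inter> U)) (J c)) \<and>
     (\<forall>c\<in>atlas. \<forall>c'\<in>atlas. \<forall>x\<in>snd c ` (fst c \<inter> fst c' \<inter> U).
        jacobian (transition c c') (at x) ** J c x
          = J c' (transition c c' x) ** jacobian (transition c c') (at x))"


section \<open>Linear algebra on a tangent space\<close>

text \<open>The tangent space is \<open>\<real>\<^sup>4\<close> with the scalar product given by a positive definite symmetric
  matrix \<open>h\<close>, and with the standard orientation.\<close>

definition ip :: "real^4^4 \<Rightarrow> real^4 \<Rightarrow> real^4 \<Rightarrow> real" where
  "ip h v w = v \<bullet> (h *v w)"

text \<open>Some orthonormal frame; every use below is a sum over the frame, which does not depend on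
  the choice.\<close>

definition onframe :: "real^4^4 \<Rightarrow> 4 \<Rightarrow> real^4" where
  "onframe h = (SOME X. \<forall>i j. ip h (X i) (X j) = (if i = j then 1 else 0))"

text \<open>The vector dual to the linear form \<open>\<alpha>\<close>: \<open>ip h (sharp h \<alpha>) v = \<alpha> v\<close>.\<close>

definition sharp :: "real^4^4 \<Rightarrow> (real^4 \<Rightarrow> real) \<Rightarrow> real^4" where
  "sharp h \<alpha> = matrix_inv h *v (\<chi> i. \<alpha> (axis i 1))"

text \<open>The adjoint with respect to \<open>h\<close>: \<open>ip h (adj h A *v v) w = ip h v (A *v w)\<close>.\<close>

definition adj :: "real^4^4 \<Rightarrow> real^4^4 \<Rightarrow> real^4^4" where
  "adj h A = matrix_inv h ** transpose A ** h"

definition form_of :: "real^4^4 \<Rightarrow> real^4^4 \<Rightarrow> real^4 \<Rightarrow> real^4 \<Rightarrow> real" where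
  "form_of h A v w = ip h (A *v v) w"

definition vol :: "real^4^4 \<Rightarrow> real^4 \<Rightarrow> real^4 \<Rightarrow> real^4 \<Rightarrow> real^4 \<Rightarrow> real" where
  "vol h v1 v2 v3 v4 = sqrt (det h) * det (vector [v1, v2, v3, v4] :: real^4^4)"

text \<open>Wedge product of 2-forms, as the signed sum over all (2,2)-shuffles.\<close>

definition wedge :: "(real^4 \<Rightarrow> real^4 \<Rightarrow> real) \<Rightarrow> (real^4 \<Rightarrow> real^4 \<Rightarrow> real) \<Rightarrow>
    real^4 \<Rightarrow> real^4 \<Rightarrow> real^4 \<Rightarrow> real^4 \<Rightarrow> real" where
  "wedge \<alpha> \<beta> v1 v2 v3 v4 =
     \<alpha> v1 v2 * \<beta> v3 v4 - \<alpha> v1 v3 * \<beta> v2 v4 + \<alpha> v1 v4 * \<beta> v2 v3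
     + \<alpha> v2 v3 * \<beta> v1 v4 - \<alpha> v2 v4 * \<beta> v1 v3 + \<alpha> v3 v4 * \<beta> v1 v2"

text \<open>Hodge star on 2-forms, transported to endomorphisms: it kills symmetric endomorphisms, and
  for skew \<open>A\<close> the form of \<open>hodge h A\<close> is \<open>*\<Omega>\<^sub>A\<close>, with
  \<open>(*\<Omega>)(v,w) = (1/2) \<Sum> \<Omega>(X\<^sub>k,X\<^sub>l) vol(X\<^sub>k,X\<^sub>l,v,w)\<close>.\<close>

definition hodge :: "real^4^4 \<Rightarrow> real^4^4 \<Rightarrow> real^4^4" where
  "hodge h A = matrix (\<lambda>v. sharp h (\<lambda>w. 1/2 *
     (\<Sum>k\<in>UNIV. \<Sum>l\<in>UNIV. form_of h A (onframe h k) (onframe h l)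
        * vol h (onframe h k) (onframe h l) v w)))"

text \<open>The self-dual 2-forms, as skew-symmetric endomorphisms.\<close>

definition selfdual :: "real^4^4 \<Rightarrow> (real^4^4) set" where
  "selfdual h = {A. adj h A = - A \<and> hodge h A = A}"

text \<open>The endomorphism \<open>g(w) \<otimes> v : z \<mapsto> g(w,z) v\<close>.\<close>

definition tens :: "real^4^4 \<Rightarrow> real^4 \<Rightarrow> real^4 \<Rightarrow> real^4^4" where
  "tens h w v = matrix (\<lambda>z. ip h w z *\<^sub>R v)"

text \<open>Matrix, with respect to some basis, of an endomorphism of a 3-dimensional subspace \<open>S\<close>;
  used for its determinant and trace.\<close>

definition matrix_on :: "(real^4^4) set \<Rightarrow> (real^4^4 \<Rightarrow> real^4^4) \<Rightarrow> real^3^3" where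
  "matrix_on S F =
     (let b = (SOME b :: 3 \<Rightarrow> real^4^4. inj b \<and> independent (range b) \<and> span (range b) = S)
      in \<chi> i j. representation (range b) (F (b j)) (b i))"

definition det_on :: "(real^4^4) set \<Rightarrow> (real^4^4 \<Rightarrow> real^4^4) \<Rightarrow> real" where
  "det_on S F = det (matrix_on S F)"

definition trace_on :: "(real^4^4) set \<Rightarrow> (real^4^4 \<Rightarrow> real^4^4) \<Rightarrow> real" where
  "trace_on S F = trace (matrix_on S F)"


section \<open>Levi-Civita connection and curvature in a chart\<close>

text \<open>From here on \<open>G\<close> is the metric in a chart, as a function of the coordinates, and vector and
  endomorphism fields are functions of the coordinates as well.  Tensorial expressions are evaluated
  on tangent vectors (and endomorphisms) by extending them with constant components.\<close>

definition christoffel :: "(real^4 \<Rightarrow> real^4^4) \<Rightarrow> real^4 \<Rightarrow> 4 \<Rightarrow> 4 \<Rightarrow> 4 \<Rightarrow> real" where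
  "christoffel G x i j k = 1/2 * (\<Sum>l\<in>UNIV. matrix_inv (G x) $ i $ l *
     (frechet_derivative G (at x) (axis j 1) $ k $ l
      + frechet_derivative G (at x) (axis k 1) $ j $ l
      - frechet_derivative G (at x) (axis l 1) $ j $ k))"

definition nabla :: "(real^4 \<Rightarrow> real^4^4) \<Rightarrow> (real^4 \<Rightarrow> real^4) \<Rightarrow> (real^4 \<Rightarrow> real^4) \<Rightarrow>
    real^4 \<Rightarrow> real^4" where
  "nabla G X Y x = frechet_derivative Y (at x) (X x)
     + (\<chi> i. \<Sum>j\<in>UNIV. \<Sum>k\<in>UNIV. christoffel G x i j k * X x $ j * Y x $ k)"

text \<open>\<open>(\<nabla>\<^sub>X A)(Y) = \<nabla>\<^sub>X (A Y) - A (\<nabla>\<^sub>X Y)\<close>\<close>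

definition nabla_endo :: "(real^4 \<Rightarrow> real^4^4) \<Rightarrow> (real^4 \<Rightarrow> real^4) \<Rightarrow> (real^4 \<Rightarrow> real^4^4) \<Rightarrow>
    real^4 \<Rightarrow> real^4^4" where
  "nabla_endo G X A x =
     matrix (\<lambda>v. nabla G X (\<lambda>y. A y *v v) x - A x *v nabla G X (\<lambda>_. v) x)"

definition nabla2 :: "(real^4 \<Rightarrow> real^4^4) \<Rightarrow> (real^4 \<Rightarrow> real^4) \<Rightarrow> (real^4 \<Rightarrow> real^4) \<Rightarrow>
    (real^4 \<Rightarrow> real^4) \<Rightarrow> real^4 \<Rightarrow> real^4" where
  "nabla2 G X Y Z x = nabla G X (nabla G Y Z) x - nabla G (nabla G X Y) Z x"

definition riemann :: "(real^4 \<Rightarrow> real^4^4) \<Rightarrow> real^4 \<Rightarrow> real^4 \<Rightarrow> real^4 \<Rightarrow> real^4 \<Rightarrow> real^4" where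
  "riemann G x u v w =
     nabla2 G (\<lambda>_. u) (\<lambda>_. v) (\<lambda>_. w) x - nabla2 G (\<lambda>_. v) (\<lambda>_. u) (\<lambda>_. w) x"

definition ricci :: "(real^4 \<Rightarrow> real^4^4) \<Rightarrow> real^4 \<Rightarrow> real^4 \<Rightarrow> real^4 \<Rightarrow> real" where
  "ricci G x v w = trace (matrix (\<lambda>u. riemann G x u v w))"

definition scal :: "(real^4 \<Rightarrow> real^4^4) \<Rightarrow> real^4 \<Rightarrow> real" where
  "scal G x = (\<Sum>k\<in>UNIV. ricci G x (onframe (G x) k) (onframe (G x) k))"

text \<open>The Schouten tensor \<open>(Ric - s/(2(n-1)) g)/(n-2)\<close> for \<open>n = 4\<close>.\<close>

definition schouten :: "(real^4 \<Rightarrow> real^4^4) \<Rightarrow> real^4 \<Rightarrow> real^4 \<Rightarrow> real^4 \<Rightarrow> real" where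
  "schouten G x v w = 1/2 * (ricci G x v w - scal G x / 6 * ip (G x) v w)"

text \<open>The totally trace-free part of the curvature tensor.\<close>

definition weyl :: "(real^4 \<Rightarrow> real^4^4) \<Rightarrow> real^4 \<Rightarrow> real^4 \<Rightarrow> real^4 \<Rightarrow> real^4 \<Rightarrow> real^4" where
  "weyl G x u v w = riemann G x u v w
     - (schouten G x v w *\<^sub>R u - schouten G x u w *\<^sub>R v
        + ip (G x) v w *\<^sub>R sharp (G x) (schouten G x u)
        - ip (G x) u w *\<^sub>R sharp (G x) (schouten G x v))"

text \<open>\<open>W(A) = W(A X\<^sub>k, X\<^sub>k)\<close>; this kills symmetric endomorphisms.\<close>

definition weyl_op :: "(real^4 \<Rightarrow> real^4^4) \<Rightarrow> real^4 \<Rightarrow> real^4^4 \<Rightarrow> real^4^4" where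
  "weyl_op G x A =
     (\<Sum>k\<in>UNIV. matrix (weyl G x (A *v onframe (G x) k) (onframe (G x) k)))"

text \<open>\<open>W\<^sub>+\<close>, extended by zero to anti-self-dual forms and to symmetric endomorphisms.  The latter
  extension makes it a parallel extension to all endomorphisms, so that \<open>\<nabla>W\<^sub>+\<close> below may be
  computed with constant-component extensions of a self-dual form, although these
  need not be skew-symmetric at other points.\<close>

definition Wplus :: "(real^4 \<Rightarrow> real^4^4) \<Rightarrow> real^4 \<Rightarrow> real^4^4 \<Rightarrow> real^4^4" where
  "Wplus G x A = weyl_op G x ((1/2) *\<^sub>R (A + hodge (G x) A))"

text \<open>\<open>W\<^sub>+(v,w) = (1/2) W\<^sub>+(g(w) \<otimes> v - g(v) \<otimes> w)\<close>, so that \<open>v \<lrcorner> W\<^sub>+\<close> is \<open>Wplus2 G x v\<close>.\<close>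

definition Wplus2 :: "(real^4 \<Rightarrow> real^4^4) \<Rightarrow> real^4 \<Rightarrow> real^4 \<Rightarrow> real^4 \<Rightarrow> real^4^4" where
  "Wplus2 G x v w = (1/2) *\<^sub>R Wplus G x (tens (G x) w v - tens (G x) v w)"

text \<open>\<open>(\<nabla>\<^sub>v W\<^sub>+)(A) = \<nabla>\<^sub>v (W\<^sub>+(A)) - W\<^sub>+(\<nabla>\<^sub>v A)\<close>\<close>

definition nabla_Wplus :: "(real^4 \<Rightarrow> real^4^4) \<Rightarrow> real^4 \<Rightarrow> real^4 \<Rightarrow> real^4^4 \<Rightarrow> real^4^4" where
  "nabla_Wplus G x v A = nabla_endo G (\<lambda>_. v) (\<lambda>y. Wplus G y A) x
     - Wplus G x (nabla_endo G (\<lambda>_. v) (\<lambda>_. A) x)"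

definition delta_Wplus :: "(real^4 \<Rightarrow> real^4^4) \<Rightarrow> real^4 \<Rightarrow> real^4 \<Rightarrow> real^4^4" where
  "delta_Wplus G x v = (1/2) *\<^sub>R (\<Sum>k\<in>UNIV. nabla_Wplus G x (onframe (G x) k)
     (tens (G x) (onframe (G x) k) v - tens (G x) v (onframe (G x) k)))"

definition det_Wplus :: "(real^4 \<Rightarrow> real^4^4) \<Rightarrow> real^4 \<Rightarrow> real" where
  "det_Wplus G x = det_on (selfdual (G x)) (Wplus G x)"

definition norm_Wplus :: "(real^4 \<Rightarrow> real^4^4) \<Rightarrow> real^4 \<Rightarrow> real" where
  "norm_Wplus G x = sqrt (trace_on (selfdual (G x)) (Wplus G x \<circ> Wplus G x))"

text \<open>\<open>|\<nabla>W\<^sub>+|\<^sup>2\<close>\<close>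

definition norm_sq_nabla_Wplus :: "(real^4 \<Rightarrow> real^4^4) \<Rightarrow> real^4 \<Rightarrow> real" where
  "norm_sq_nabla_Wplus G x = (\<Sum>k\<in>UNIV. trace_on (selfdual (G x))
     (nabla_Wplus G x (onframe (G x) k) \<circ> nabla_Wplus G x (onframe (G x) k)))"

definition grad :: "(real^4 \<Rightarrow> real^4^4) \<Rightarrow> (real^4 \<Rightarrow> real) \<Rightarrow> real^4 \<Rightarrow> real^4" where
  "grad G f x = sharp (G x) (frechet_derivative f (at x))"


section \<open>Locally Kaehler metrics\<close>

definition locally_kaehler ::
    "'a topology \<Rightarrow> 'a chart set \<Rightarrow> ('a chart \<Rightarrow> real^4 \<Rightarrow> real^4^4) \<Rightarrow> bool" where
  "locally_kaehler M atlas g \<longleftrightarrow>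
     (\<forall>p\<in>topspace M. \<exists>U J. openin M U \<and> p \<in> U \<and> endomorphism_field atlas U J \<and>
        (\<forall>c\<in>atlas. \<forall>x\<in>snd c ` (fst c \<inter> U).
           J c x ** J c x = - mat 1 \<and>
           adj (g c x) (J c x) = - J c x \<and>
           (\<forall>v. nabla_endo (g c) (\<lambda>_. v) (J c) x = 0) \<and>
           (\<forall>v1 v2 v3 v4.
              1/2 * wedge (form_of (g c x) (J c x)) (form_of (g c x) (J c x)) v1 v2 v3 v4
                = vol (g c x) v1 v2 v3 v4)))"

end

theory Submission
  imports Defs
begin

text \<open>
  Locally there is an oriented orthonormal frame \<open>E\<close>, and it identifies the self-dual
  endomorphisms with \<open>\<real>\<^sup>3\<close>. In this identification \<open>W\<^sub>+\<close> becomes a field of trace-free symmetric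
  3-by-3 matrices \<open>w\<close> (\<open>Wplus_wmat\<close>), the Levi-Civita connection acts on \<open>\<real>\<^sup>3\<close> through a field of
  skew-symmetric matrices \<open>\<theta>\<close>, and \<open>\<nabla>\<^sub>vW\<^sub>+\<close> becomes \<open>\<partial>\<^sub>vw + [\<theta>\<^sub>v, w]\<close> (\<open>nabla_Wplus_frame\<close>). All three
  conditions turn into statements about such matrices.

  The equation \<open>det(w)\<^sup>2 = |w|\<^sup>6/54\<close> is the vanishing of the discriminant of the characteristic
  polynomial. Together with \<open>w \<noteq> 0\<close> it means that the eigenvalues are \<open>2s, -s, -s\<close> with \<open>s \<noteq> 0\<close>, or
  \<open>w = s (3 u\<otimes>u - 1)\<close> for a unit vector \<open>u\<close> (\<open>double_eigenvalue\<close>, \<open>rank_one_projection\<close>). Here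
  \<open>s = 3 det(w)/|w|\<^sup>2\<close>, and \<open>u\<close> can be chosen differentiably near any point, because \<open>u\<otimes>u\<close> is
  rational in \<open>w\<close>. The unit vector \<open>u\<close> is a self-dual form of norm one, that is, a compatible almost
  complex structure \<open>J\<close>, and \<open>\<nabla>J = 0\<close> means \<open>D u = 0\<close>, where \<open>D\<^sub>vu = \<partial>\<^sub>vu + \<theta>\<^sub>v u\<close>.

  Differentiating, \<open>\<nabla>W\<^sub>+ = ds (3 u\<otimes>u - 1) + 3s (u\<otimes>Du + Du\<otimes>u)\<close>, and \<open>u \<perp> Du\<close>. The two summands
  are orthogonal and the first one has the norm of \<open>\<nabla>|W\<^sub>+|\<close>, so the difference of the two sides of
  the second equation in (ii) is \<open>18 s\<^sup>2 |Du|\<^sup>2\<close>. In (iii) the term with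
  \<open>\<nabla>log|W\<^sub>+|\<close> cancels the terms with \<open>ds\<close>, and what remains is a contraction of \<open>u\<otimes>Du + Du\<otimes>u\<close>;
  its component orthogonal to \<open>u\<close> is \<open>Du\<close> composed with the invertible map \<open>J\<close>. Hence, once the
  double eigenvalue is known, each of the remaining equations in (ii) and (iii) is equivalent to
  \<open>Du = 0\<close> (\<open>condition_ii_degenerate\<close>, \<open>condition_iii_degenerate\<close>).

  It remains to see that a Kaehler metric has the double eigenvalue (\<open>weyl_sd_kaehler\<close>): the
  curvature endomorphisms commute with the parallel \<open>J\<close>, so by pair symmetry the self-dual block of
  the curvature operator is a multiple of the projection to \<open>J\<close>, and \<open>W\<^sub>+\<close> is its trace-free part. In
  the other direction the parallel \<open>J\<close> is found in one chart and carried to the other charts by the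
  Jacobians. That it stays parallel is the invariance of the Levi-Civita connection
  (\<open>gam_transform\<close>), and that it is smooth follows from the equation \<open>\<nabla>J = 0\<close> itself
  (\<open>parallel_smooth\<close>).
\<close>

section \<open>Directional derivatives\<close>

abbreviation dirD :: "('a::real_normed_vector \<Rightarrow> 'b::real_normed_vector) \<Rightarrow> 'a \<Rightarrow> 'a \<Rightarrow> 'b" where
  "dirD f x v \<equiv> frechet_derivative f (at x) v"

lemma dirD_eq: "(f has_derivative f') (at x) \<Longrightarrow> dirD f x v = f' v"
  by (metis frechet_derivative_at)

lemma has_derivative_dirD: "f differentiable (at x) \<Longrightarrow> (f has_derivative dirD f x) (at x)"
  by (simp add: frechet_derivative_works)

lemma has_derivative_cong_open:
  assumes "open S" "x \<in> S" "\<And>y. y \<in> S \<Longrightarrow> f y = g y"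
  shows "(f has_derivative f') (at x) \<longleftrightarrow> (g has_derivative f') (at x)"
  by (metis assms has_derivative_transform_within_open)

text \<open>A Frechet derivative is a choice from the set of all derivatives at the point, and this set,
  possibly empty, is the same for both functions.\<close>

lemma dirD_cong:
  assumes "open S" "x \<in> S" "\<And>y. y \<in> S \<Longrightarrow> f y = g y"
  shows "dirD f x v = dirD g x v"
  unfolding frechet_derivative_def using has_derivative_cong_open[OF assms] by simp

lemma differentiable_cong_open:
  assumes "open S" "x \<in> S" "\<And>y. y \<in> S \<Longrightarrow> f y = g y"
  shows "f differentiable (at x) \<longleftrightarrow> g differentiable (at x)"
  unfolding differentiable_def using has_derivative_cong_open[OF assms] by simp

lemma differentiable_transform:
  assumes "g differentiable (at x)" "open S" "x \<in> S" "\<And>y. y \<in> S \<Longrightarrow> f y = g y"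
  shows "f differentiable (at x)"
  using differentiable_cong_open[OF assms(2-4)] assms(1) by simp

lemma dirD_add: "f differentiable (at x) \<Longrightarrow> dirD f x (u + v) = dirD f x u + dirD f x v"
  by (simp add: linear_add linear_frechet_derivative)

lemma dirD_scaleR: "f differentiable (at x) \<Longrightarrow> dirD f x (c *\<^sub>R v) = c *\<^sub>R dirD f x v"
  by (simp add: linear_cmul linear_frechet_derivative)

lemma dirD_sum: "f differentiable (at x) \<Longrightarrow> dirD f x (sum u I) = (\<Sum>i\<in>I. dirD f x (u i))"
  by (simp add: linear_sum linear_frechet_derivative)

lemma dirD_bounded_linear:
  assumes "bounded_linear L" "f differentiable (at x)"
  shows "dirD (\<lambda>y. L (f y)) x v = L (dirD f x v)" "(\<lambda>y. L (f y)) differentiable (at x)"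
proof -
  have "((\<lambda>y. L (f y)) has_derivative (\<lambda>v. L (dirD f x v))) (at x)"
    by (rule bounded_linear.has_derivative[OF assms(1) has_derivative_dirD[OF assms(2)]])
  then show "dirD (\<lambda>y. L (f y)) x v = L (dirD f x v)" "(\<lambda>y. L (f y)) differentiable (at x)"
    by (auto simp: dirD_eq differentiable_def)
qed

lemma dirD_bounded_bilinear:
  assumes "bounded_bilinear B" "f differentiable (at x)" "g differentiable (at x)"
  shows "dirD (\<lambda>y. B (f y) (g y)) x v = B (f x) (dirD g x v) + B (dirD f x v) (g x)"
    "(\<lambda>y. B (f y) (g y)) differentiable (at x)"
proof -
  have "((\<lambda>y. B (f y) (g y)) has_derivative
      (\<lambda>v. B (f x) (dirD g x v) + B (dirD f x v) (g x))) (at x)"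
    by (rule bounded_bilinear.FDERIV[OF assms(1) has_derivative_dirD[OF assms(2)] has_derivative_dirD[OF assms(3)]])
  then show "dirD (\<lambda>y. B (f y) (g y)) x v = B (f x) (dirD g x v) + B (dirD f x v) (g x)"
    "(\<lambda>y. B (f y) (g y)) differentiable (at x)"
    by (auto simp: dirD_eq differentiable_def)
qed

lemma dirD_plus:
  assumes "f differentiable (at x)" "g differentiable (at x)"
  shows "dirD (\<lambda>y. f y + g y) x v = dirD f x v + dirD g x v"
  by (rule dirD_eq[OF has_derivative_add[OF assms[THEN has_derivative_dirD]]])

lemma dirD_minus:
  assumes "f differentiable (at x)" "g differentiable (at x)"
  shows "dirD (\<lambda>y. f y - g y) x v = dirD f x v - dirD g x v"
  by (rule dirD_eq[OF has_derivative_diff[OF assms[THEN has_derivative_dirD]]])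

lemma dirD_const [simp]: "dirD (\<lambda>y. c) x v = 0"
  by (rule dirD_eq) simp

lemma dirD_compose:
  assumes "f differentiable (at x)" "g differentiable (at (f x))"
  shows "dirD (\<lambda>y. g (f y)) x v = dirD g (f x) (dirD f x v)"
    "(\<lambda>y. g (f y)) differentiable (at x)"
proof -
  have "((\<lambda>y. g (f y)) has_derivative (\<lambda>v. dirD g (f x) (dirD f x v))) (at x)"
    by (rule has_derivative_compose[OF assms[THEN has_derivative_dirD]])
  then show "dirD (\<lambda>y. g (f y)) x v = dirD g (f x) (dirD f x v)"
    "(\<lambda>y. g (f y)) differentiable (at x)"
    by (auto simp: dirD_eq differentiable_def)
qed

subsection \<open>A calculus of smooth functions\<close>

lemma Ck_on_cong:
  assumes "open S" "\<And>x. x \<in> S \<Longrightarrow> f x = g x"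
  shows "Ck_on k S f \<longleftrightarrow> Ck_on k S g"
  using assms(2)
proof (induction k arbitrary: f g)
  case 0
  then show ?case by (simp cong: continuous_on_cong)
next
  case (Suc k)
  have "Ck_on k S (\<lambda>x. dirD f x v) \<longleftrightarrow> Ck_on k S (\<lambda>x. dirD g x v)" for v
    by (rule Suc.IH) (metis assms(1) dirD_cong Suc.prems)
  moreover have "f differentiable (at x) \<longleftrightarrow> g differentiable (at x)" if "x \<in> S" for x
    by (rule differentiable_cong_open[OF assms(1) that Suc.prems])
  ultimately show ?case by auto
qed

lemma Ck_on_transform:
  "Ck_on k S g \<Longrightarrow> open S \<Longrightarrow> (\<And>x. x \<in> S \<Longrightarrow> f x = g x) \<Longrightarrow> Ck_on k S f"
  using Ck_on_cong by blast

lemma Ck_on_subset: "Ck_on k S f \<Longrightarrow> T \<subseteq> S \<Longrightarrow> Ck_on k T f"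
  by (induction k arbitrary: f) (auto intro: continuous_on_subset)

lemma Ck_on_Suc_imp: "Ck_on (Suc k) S f \<Longrightarrow> Ck_on k S f"
proof (induction k arbitrary: f)
  case 0
  then show ?case
    by (auto intro!: continuous_at_imp_continuous_on differentiable_imp_continuous_within)
next
  case (Suc k)
  then show ?case by (metis Ck_on.simps(2))
qed

lemma Ck_on_const: "Ck_on k S (\<lambda>x. c)"
  by (induction k arbitrary: c) auto

lemma Ck_on_bounded_linear:
  assumes L: "bounded_linear L" and S: "open S"
  shows "Ck_on k S f \<Longrightarrow> Ck_on k S (\<lambda>x. L (f x))"
proof (induction k arbitrary: f)
  case 0
  then show ?case using L by (simp add: bounded_linear.continuous_on)
next
  case (Suc k)
  have "Ck_on k S (\<lambda>x. dirD (\<lambda>y. L (f y)) x v)" for v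
    by (rule Ck_on_transform[OF Suc.IH[of "\<lambda>x. dirD f x v"] S])
      (use Suc.prems dirD_bounded_linear(1)[OF L] in auto)
  then show ?case using Suc.prems dirD_bounded_linear(2)[OF L] by auto
qed

lemma Ck_on_add:
  assumes S: "open S"
  shows "Ck_on k S f \<Longrightarrow> Ck_on k S g \<Longrightarrow> Ck_on k S (\<lambda>x. f x + g x)"
proof (induction k arbitrary: f g)
  case 0
  then show ?case by (simp add: continuous_on_add)
next
  case (Suc k)
  have eq: "dirD (\<lambda>y. f y + g y) x v = dirD f x v + dirD g x v" if "x \<in> S" for x v
    using that Suc.prems by (intro dirD_plus) auto
  have "Ck_on k S (\<lambda>x. dirD (\<lambda>y. f y + g y) x v)" for v
    by (rule Ck_on_transform[OF Suc.IH[of "\<lambda>x. dirD f x v" "\<lambda>x. dirD g x v"] S])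
      (use Suc.prems eq in auto)
  then show ?case using Suc.prems by auto
qed

lemma Ck_on_bounded_bilinear:
  assumes B: "bounded_bilinear B" and S: "open S"
  shows "Ck_on k S f \<Longrightarrow> Ck_on k S g \<Longrightarrow> Ck_on k S (\<lambda>x. B (f x) (g x))"
proof (induction k arbitrary: f g)
  case 0
  then show ?case using B by (simp add: bounded_bilinear.continuous_on)
next
  case (Suc k)
  note Suc.prems[THEN Ck_on_Suc_imp]
  then have C: "Ck_on k S (\<lambda>x. B (f x) (dirD g x v) + B (dirD f x v) (g x))" for v
    using Suc.prems by (intro Ck_on_add[OF S] Suc.IH) auto
  have eq: "dirD (\<lambda>y. B (f y) (g y)) x v = B (f x) (dirD g x v) + B (dirD f x v) (g x)"
    if "x \<in> S" for x v
    using that Suc.prems by (intro dirD_bounded_bilinear(1)[OF B]) auto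
  have "Ck_on k S (\<lambda>x. dirD (\<lambda>y. B (f y) (g y)) x v)" for v
    by (rule Ck_on_transform[OF C S]) (rule eq)
  moreover have "(\<lambda>y. B (f y) (g y)) differentiable (at x)" if "x \<in> S" for x
    using that Suc.prems by (intro dirD_bounded_bilinear(2)[OF B]) auto
  ultimately show ?case by simp
qed

lemma Ck_on_inverse:
  fixes f :: "'a::real_normed_vector \<Rightarrow> real"
  assumes S: "open S" and nz: "\<And>x. x \<in> S \<Longrightarrow> f x \<noteq> 0"
  shows "Ck_on k S f \<Longrightarrow> Ck_on k S (\<lambda>x. inverse (f x))"
proof (induction k)
  case 0
  then show ?case using nz by (auto intro: continuous_on_inverse)
next
  case (Suc k)
  have D: "((\<lambda>x. inverse (f x)) has_derivative
        (\<lambda>v. - (inverse (f x) * dirD f x v * inverse (f x)))) (at x)" if "x \<in> S" for x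
    using Suc.prems that nz by (intro Deriv.has_derivative_inverse has_derivative_dirD) auto
  have "Ck_on k S (\<lambda>x. inverse (f x))" using Suc.IH Suc.prems Ck_on_Suc_imp by blast
  moreover have "Ck_on k S (\<lambda>x. dirD f x v)" for v using Suc.prems by simp
  ultimately have "Ck_on k S (\<lambda>x. - (inverse (f x) * dirD f x v * inverse (f x)))" for v
    by (intro Ck_on_bounded_linear[OF bounded_linear_minus[OF bounded_linear_ident] S]
        Ck_on_bounded_bilinear[OF bounded_bilinear_mult S])
  then have "Ck_on k S (\<lambda>x. dirD (\<lambda>x. inverse (f x)) x v)" for v
    by (rule Ck_on_transform[OF _ S]) (use dirD_eq[OF D] in auto)
  then show ?case using D by (auto simp: differentiable_def)
qed

lemma smooth_on_differentiable: "smooth_on S f \<Longrightarrow> x \<in> S \<Longrightarrow> f differentiable (at x)"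
  unfolding smooth_on_def by (metis Ck_on.simps(2))

lemma smooth_on_dirD: "smooth_on S f \<Longrightarrow> smooth_on S (\<lambda>x. dirD f x v)"
  unfolding smooth_on_def by (metis Ck_on.simps(2))

lemma smooth_on_cong:
  assumes "open S" "\<And>x. x \<in> S \<Longrightarrow> f x = g x"
  shows "smooth_on S f \<longleftrightarrow> smooth_on S g"
  unfolding smooth_on_def using Ck_on_cong[of S f g] assms by simp

lemma smooth_on_subset: "smooth_on S f \<Longrightarrow> T \<subseteq> S \<Longrightarrow> smooth_on T f"
  unfolding smooth_on_def using Ck_on_subset by blast

lemma smooth_on_const: "smooth_on S (\<lambda>x. c)"
  unfolding smooth_on_def using Ck_on_const by blast

lemma smooth_on_bounded_linear:
  "bounded_linear L \<Longrightarrow> open S \<Longrightarrow> smooth_on S f \<Longrightarrow> smooth_on S (\<lambda>x. L (f x))"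
  unfolding smooth_on_def using Ck_on_bounded_linear by blast

lemma smooth_on_add:
  "open S \<Longrightarrow> smooth_on S f \<Longrightarrow> smooth_on S g \<Longrightarrow> smooth_on S (\<lambda>x. f x + g x)"
  unfolding smooth_on_def using Ck_on_add by blast

lemma smooth_on_minus:
  "open S \<Longrightarrow> smooth_on S f \<Longrightarrow> smooth_on S g \<Longrightarrow> smooth_on S (\<lambda>x. f x - g x)"
  using smooth_on_add[of S f "\<lambda>x. - g x"]
    smooth_on_bounded_linear[OF bounded_linear_minus[OF bounded_linear_ident], of S g] by simp

lemma smooth_on_bounded_bilinear:
  "bounded_bilinear B \<Longrightarrow> open S \<Longrightarrow> smooth_on S f \<Longrightarrow> smooth_on S g
    \<Longrightarrow> smooth_on S (\<lambda>x. B (f x) (g x))"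
  unfolding smooth_on_def using Ck_on_bounded_bilinear by blast

lemmas smooth_on_mult = smooth_on_bounded_bilinear[OF bounded_bilinear_mult]

lemma smooth_on_divide:
  fixes f :: "'a::real_normed_vector \<Rightarrow> real"
  assumes "open S" "smooth_on S f" "smooth_on S g" "\<And>x. x \<in> S \<Longrightarrow> g x \<noteq> 0"
  shows "smooth_on S (\<lambda>x. f x / g x)"
  unfolding divide_inverse
  using assms smooth_on_mult[of S f "\<lambda>x. inverse (g x)"] Ck_on_inverse[of S g]
  unfolding smooth_on_def by blast

lemma smooth_on_sum:
  assumes "open S" "finite I" "\<And>i. i \<in> I \<Longrightarrow> smooth_on S (f i)"
  shows "smooth_on S (\<lambda>x. \<Sum>i\<in>I. f i x)"
  using assms(2,3) by (induction I) (simp_all add: smooth_on_const smooth_on_add[OF assms(1)])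

lemma smooth_on_prod:
  fixes f :: "'i \<Rightarrow> 'a::real_normed_vector \<Rightarrow> real"
  assumes "open S" "finite I" "\<And>i. i \<in> I \<Longrightarrow> smooth_on S (f i)"
  shows "smooth_on S (\<lambda>x. \<Prod>i\<in>I. f i x)"
  using assms(2,3) by (induction I) (simp_all add: smooth_on_const smooth_on_mult[OF assms(1)])

lemma bounded_linear_axis: "bounded_linear (axis i :: 'a::real_normed_vector \<Rightarrow> 'a^'n)"
proof (rule bounded_linear_intro[where K = 1])
  show "norm (axis i x :: 'a^'n) \<le> norm x * 1" for x :: 'a
    by (simp add: norm_vec_def L2_set_def axis_def if_distrib[of "\<lambda>y. (norm y)\<^sup>2"] sum.delta
        cong: if_cong)
qed (auto simp: axis_def vec_eq_iff)

lemma smooth_on_vec: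
  fixes f :: "'n::finite \<Rightarrow> 'a::real_normed_vector \<Rightarrow> 'b::real_normed_vector"
  assumes S: "open S" and f: "\<And>i. smooth_on S (f i)"
  shows "smooth_on S (\<lambda>x. \<chi> i. f i x)"
proof -
  have "(\<chi> i. f i x) = (\<Sum>i\<in>UNIV. axis i (f i x))" for x
    by (simp add: vec_eq_iff axis_def if_distrib sum.delta cong: if_cong)
  then show ?thesis
    by (auto intro!: smooth_on_sum smooth_on_bounded_linear[OF bounded_linear_axis] S f)
qed

lemma smooth_on_nth: "open S \<Longrightarrow> smooth_on S f \<Longrightarrow> smooth_on S (\<lambda>x. f x $ i)"
  by (rule smooth_on_bounded_linear[OF bounded_linear_vec_nth])

lemma bilinear_mat:
  "bounded_bilinear ((**) :: real^'n^'m \<Rightarrow> real^'p^'n \<Rightarrow> real^'p^'m)"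
  unfolding bilinear_conv_bounded_bilinear[symmetric] bilinear_def
  by (auto intro!: linearI simp: matrix_matrix_mult_def vec_eq_iff algebra_simps sum.distrib
      sum_distrib_left)

lemma bilinear_mat_vec:
  "bounded_bilinear ((*v) :: real^'n^'m \<Rightarrow> real^'n \<Rightarrow> real^'m)"
  unfolding bilinear_conv_bounded_bilinear[symmetric] bilinear_def
  by (auto intro!: linearI simp: matrix_vector_mult_def vec_eq_iff algebra_simps sum.distrib
      sum_distrib_left)

lemma bounded_linear_transpose: "bounded_linear (transpose :: real^'n^'m \<Rightarrow> real^'m^'n)"
  unfolding linear_conv_bounded_linear[symmetric]
  by (auto intro!: linearI simp: transpose_def vec_eq_iff)

lemma smooth_on_det:
  fixes f :: "'a::real_normed_vector \<Rightarrow> real^'n^'n"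
  assumes "open S" "smooth_on S f"
  shows "smooth_on S (\<lambda>x. det (f x))"
  unfolding det_def
  by (intro smooth_on_sum smooth_on_mult smooth_on_const smooth_on_prod smooth_on_nth assms) auto

lemma matrix_inv_unique:
  fixes A :: "real^'n^'n"
  assumes "A ** B = mat 1"
  shows "matrix_inv A = B"
proof -
  have BA: "B ** A = mat 1" using assms matrix_left_right_inverse by blast
  have "\<exists>C. A ** C = mat 1 \<and> C ** A = mat 1" using assms BA by blast
  then have "A ** matrix_inv A = mat 1 \<and> matrix_inv A ** A = mat 1"
    unfolding matrix_inv_def by (rule someI_ex)
  then have "matrix_inv A = matrix_inv A ** (A ** B)" using assms by simp
  also have "\<dots> = B" using \<open>A ** matrix_inv A = mat 1 \<and> matrix_inv A ** A = mat 1\<close>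
    by (simp add: matrix_mul_assoc)
  finally show ?thesis .
qed

lemma matrix_inv_mul:
  fixes A :: "real^'n^'n"
  assumes "det A \<noteq> 0"
  shows "A ** matrix_inv A = mat 1" "matrix_inv A ** A = mat 1"
proof -
  obtain B where "A ** B = mat 1" using assms invertible_det_nz invertible_def by metis
  then show "A ** matrix_inv A = mat 1" "matrix_inv A ** A = mat 1"
    using matrix_inv_unique matrix_left_right_inverse by metis+
qed

text \<open>By Cramer's rule the entries of the inverse are rational functions of the entries of the matrix;
  this is what makes the inverse of a smooth family smooth.\<close>

lemma matrix_inv_cramer:
  fixes A :: "real^'n^'n"
  assumes "det A \<noteq> 0"
  shows "matrix_inv A =
    (\<chi> k j. det (\<chi> i l. if l = k then (mat 1 :: real^'n^'n) $ i $ j else A $ i $ l) / det A)"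
    (is "_ = ?B")
proof (rule matrix_inv_unique)
  have "A *v (?B *v axis j 1) = axis j 1" for j
  proof -
    have "?B *v axis j 1 =
       (\<chi> k. det (\<chi> i l. if l = k then (axis j 1 :: real^'n) $ i else A $ i $ l) / det A)"
      by (simp only: matrix_vector_mult_basis)
        (simp add: column_def mat_def axis_def vec_eq_iff cong: if_cong)
    then show ?thesis using cramer[OF assms] by blast
  qed
  then have "(A ** ?B) *v axis j 1 = mat 1 *v axis j 1" for j
    by (simp add: matrix_vector_mul_assoc)
  then show "A ** ?B = mat 1"
    by (metis (no_types, lifting) matrix_vector_mult_basis column_def vec_eq_iff vec_lambda_beta)
qed

lemma smooth_on_matrix_inv:
  fixes f :: "'a::real_normed_vector \<Rightarrow> real^'n^'n"
  assumes "open S" "smooth_on S f" "\<And>x. x \<in> S \<Longrightarrow> det (f x) \<noteq> 0"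
  shows "smooth_on S (\<lambda>x. matrix_inv (f x))"
proof -
  have *: "smooth_on S (\<lambda>x. if P then c else f x $ i $ l)" for P c i l
    by (cases P) (simp_all add: smooth_on_const smooth_on_nth assms)
  have "smooth_on S (\<lambda>x. \<chi> k j. det (\<chi> i l. if l = k then (mat 1 :: real^'n^'n) $ i $ j
      else f x $ i $ l) / det (f x))"
    by (intro smooth_on_vec smooth_on_divide smooth_on_det assms *)
  then show ?thesis
    by (subst smooth_on_cong[OF assms(1) matrix_inv_cramer[OF assms(3)]])
qed

subsection \<open>Symmetry of second derivatives\<close>

lemma dirD_line:
  assumes "f differentiable (at (x + t *\<^sub>R u))"
  shows "((\<lambda>t. f (x + t *\<^sub>R u)) has_vector_derivative dirD f (x + t *\<^sub>R u) u) (at t)"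
proof -
  have "((\<lambda>t. f (x + t *\<^sub>R u)) has_derivative (\<lambda>s. dirD f (x + t *\<^sub>R u) (s *\<^sub>R u))) (at t)"
    by (rule has_derivative_compose[where f = "\<lambda>t. x + t *\<^sub>R u", OF _ has_derivative_dirD[OF assms]])
      (auto intro!: derivative_eq_intros)
  then show ?thesis
    by (simp add: has_vector_derivative_def dirD_scaleR[OF assms])
qed

text \<open>The second difference quotient of \<open>f\<close> in two directions is symmetric in them, and by two
  applications of the mean value theorem it is a value of the iterated derivative nearby.\<close>

lemma second_difference:
  fixes f :: "'a::real_normed_vector \<Rightarrow> real"
  assumes C: "Ck_on 2 S f" and h: "0 < h"
    and box: "\<And>s t. s \<in> {0..h} \<Longrightarrow> t \<in> {0..h} \<Longrightarrow> x + s *\<^sub>R u + t *\<^sub>R v \<in> S"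
  shows "\<exists>s\<in>{0..h}. \<exists>t\<in>{0..h}.
    f (x + h *\<^sub>R u + h *\<^sub>R v) - f (x + h *\<^sub>R u) - f (x + h *\<^sub>R v) + f x
      = h * h * dirD (\<lambda>y. dirD f y u) (x + s *\<^sub>R u + t *\<^sub>R v) v"
proof -
  have diff: "f differentiable (at y)" "(\<lambda>y. dirD f y w) differentiable (at y)" if "y \<in> S" for y w
    using C that by (simp_all add: numeral_2_eq_2)
  define \<phi> where "\<phi> s = f (x + h *\<^sub>R v + s *\<^sub>R u) - f (x + s *\<^sub>R u)" for s
  have in1: "x + h *\<^sub>R v + s *\<^sub>R u \<in> S" "x + s *\<^sub>R u \<in> S" if "s \<in> {0..h}" for s
    using box[OF that, of h] box[OF that, of 0] h by (simp_all add: algebra_simps)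
  have d1: "(\<phi> has_real_derivative (dirD f (x + h *\<^sub>R v + s *\<^sub>R u) u - dirD f (x + s *\<^sub>R u) u)) (at s)"
    if "s \<in> {0..h}" for s
    unfolding \<phi>_def
    using dirD_line[OF diff(1)[OF in1(1)[OF that]]] dirD_line[OF diff(1)[OF in1(2)[OF that]]]
    by (simp add: has_real_derivative_iff_has_vector_derivative has_vector_derivative_diff)
  obtain s where s: "0 < s" "s < h"
    and e1: "\<phi> h - \<phi> 0 = (h - 0) * (dirD f (x + h *\<^sub>R v + s *\<^sub>R u) u - dirD f (x + s *\<^sub>R u) u)"
    using MVT2[OF h, of \<phi> "\<lambda>s. dirD f (x + h *\<^sub>R v + s *\<^sub>R u) u - dirD f (x + s *\<^sub>R u) u"] d1
    by auto
  define \<psi> where "\<psi> t = dirD f (x + s *\<^sub>R u + t *\<^sub>R v) u" for t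
  have d2: "(\<psi> has_real_derivative (dirD (\<lambda>y. dirD f y u) (x + s *\<^sub>R u + t *\<^sub>R v) v)) (at t)"
    if "t \<in> {0..h}" for t
    unfolding \<psi>_def has_real_derivative_iff_has_vector_derivative
    using s that by (intro dirD_line[OF diff(2)] box) auto
  obtain t where t: "0 < t" "t < h"
    and e2: "\<psi> h - \<psi> 0 = (h - 0) * dirD (\<lambda>y. dirD f y u) (x + s *\<^sub>R u + t *\<^sub>R v) v"
    using MVT2[OF h, of \<psi> "\<lambda>t. dirD (\<lambda>y. dirD f y u) (x + s *\<^sub>R u + t *\<^sub>R v) v"] d2
    by auto
  have "\<phi> h - \<phi> 0 = h * (\<psi> h - \<psi> 0)"
    using e1 by (simp add: \<psi>_def algebra_simps)
  then show ?thesis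
    using s t e2 by (intro bexI[of _ s] bexI[of _ t]) (auto simp: \<phi>_def algebra_simps)
qed

text \<open>Both iterated derivatives are continuous, and by the previous lemma both take the value of the
  same difference quotient at points arbitrarily close to \<open>x\<close>.\<close>

lemma dirD_commute_real:
  fixes f :: "'a::real_normed_vector \<Rightarrow> real"
  assumes C: "Ck_on 2 S f" and S: "open S" "x \<in> S"
  shows "dirD (\<lambda>y. dirD f y u) x v = dirD (\<lambda>y. dirD f y v) x u"
proof (rule ccontr)
  define F where "F y = dirD (\<lambda>y. dirD f y u) y v" for y
  define G where "G y = dirD (\<lambda>y. dirD f y v) y u" for y
  assume "\<not> ?thesis"
  then have ne: "F x \<noteq> G x" by (simp add: F_def G_def)
  define e where "e = \<bar>F x - G x\<bar> / 2"
  have e: "e > 0" using ne by (simp add: e_def)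
  have "continuous_on S F" "continuous_on S G"
    using C by (simp_all add: numeral_2_eq_2 F_def[abs_def] G_def[abs_def])
  then have "isCont F x" "isCont G x" using S by (simp_all add: continuous_on_eq_continuous_at)
  then obtain d1 d2 where d: "d1 > 0" "d2 > 0"
    "\<And>y. dist y x < d1 \<Longrightarrow> dist (F y) (F x) < e" "\<And>y. dist y x < d2 \<Longrightarrow> dist (G y) (G x) < e"
    using e unfolding continuous_at_eps_delta by metis
  obtain d3 where d3: "d3 > 0" "ball x d3 \<subseteq> S" using S open_contains_ball by blast
  define d where "d = min d1 (min d2 d3)"
  define h where "h = d / (2 * (norm u + norm v + 1))"
  have pos: "norm u + norm v + 1 > 0" by (simp add: add_nonneg_pos)
  have dpos: "d > 0" using d d3 by (simp add: d_def)
  then have h: "h > 0" unfolding h_def using pos by (intro divide_pos_pos) auto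
  have near: "dist (x + s *\<^sub>R u + t *\<^sub>R v) x < d" if "s \<in> {0..h}" "t \<in> {0..h}" for s t
  proof -
    have "dist (x + s *\<^sub>R u + t *\<^sub>R v) x \<le> \<bar>s\<bar> * norm u + \<bar>t\<bar> * norm v"
      by (simp add: dist_norm) (metis add.assoc add_diff_cancel_left' norm_scaleR norm_triangle_ineq)
    also have "\<dots> \<le> h * norm u + h * norm v" using that by (intro add_mono mult_right_mono) auto
    also have "\<dots> \<le> h * (norm u + norm v + 1)" using h by (simp add: algebra_simps)
    also have "\<dots> = d / 2" using pos unfolding h_def by (simp add: divide_simps)
    finally show ?thesis using dpos by simp
  qed
  have near': "dist (x + s *\<^sub>R v + t *\<^sub>R u) x < d" if "s \<in> {0..h}" "t \<in> {0..h}" for s t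
    using near[OF that(2,1)] by (simp add: algebra_simps)
  have inS: "y \<in> S" if "dist y x < d" for y
    using that d3 by (auto simp: d_def dist_commute)
  obtain s t where st: "s \<in> {0..h}" "t \<in> {0..h}"
    "f (x + h *\<^sub>R u + h *\<^sub>R v) - f (x + h *\<^sub>R u) - f (x + h *\<^sub>R v) + f x
      = h * h * F (x + s *\<^sub>R u + t *\<^sub>R v)"
    using second_difference[OF C h, of x u v] inS near unfolding F_def by blast
  obtain s' t' where st': "s' \<in> {0..h}" "t' \<in> {0..h}"
    "f (x + h *\<^sub>R v + h *\<^sub>R u) - f (x + h *\<^sub>R v) - f (x + h *\<^sub>R u) + f x
      = h * h * G (x + s' *\<^sub>R v + t' *\<^sub>R u)"
    using second_difference[OF C h, of x v u] inS near' unfolding G_def by blast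
  have "x + h *\<^sub>R v + h *\<^sub>R u = x + h *\<^sub>R u + h *\<^sub>R v" by (simp add: algebra_simps)
  then have "h * h * F (x + s *\<^sub>R u + t *\<^sub>R v) = h * h * G (x + s' *\<^sub>R v + t' *\<^sub>R u)"
    using st(3) st'(3) by (simp only:)
  then have eq: "F (x + s *\<^sub>R u + t *\<^sub>R v) = G (x + s' *\<^sub>R v + t' *\<^sub>R u)" using h by simp
  have "\<bar>F (x + s *\<^sub>R u + t *\<^sub>R v) - F x\<bar> < e" "\<bar>G (x + s' *\<^sub>R v + t' *\<^sub>R u) - G x\<bar> < e"
    using d(3)[of "x + s *\<^sub>R u + t *\<^sub>R v"] d(4)[of "x + s' *\<^sub>R v + t' *\<^sub>R u"]
      near[OF st(1,2)] near'[OF st'(1,2)] by (auto simp: d_def dist_real_def)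
  then have "\<bar>F x - G x\<bar> < e + e" using eq by arith
  then show False by (simp add: e_def)
qed

lemma dirD_commute:
  fixes f :: "'a::real_normed_vector \<Rightarrow> 'b::euclidean_space"
  assumes f: "smooth_on S f" and S: "open S" "x \<in> S"
  shows "dirD (\<lambda>y. dirD f y u) x v = dirD (\<lambda>y. dirD f y v) x u"
proof (rule euclidean_eqI)
  fix b :: 'b assume "b \<in> Basis"
  note L = bounded_linear_inner_left[of b]
  have D: "dirD (\<lambda>y. dirD (\<lambda>y. f y \<bullet> b) y u) x v = dirD (\<lambda>y. dirD f y u) x v \<bullet> b" for u v
  proof -
    have "dirD (\<lambda>y. dirD (\<lambda>y. f y \<bullet> b) y u) x v = dirD (\<lambda>y. dirD f y u \<bullet> b) x v"
      using dirD_bounded_linear(1)[OF L] f by (intro dirD_cong[OF S]) (auto dest: smooth_on_differentiable)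
    also have "\<dots> = dirD (\<lambda>y. dirD f y u) x v \<bullet> b"
      using smooth_on_differentiable[OF smooth_on_dirD[OF f] S(2)]
      by (intro dirD_bounded_linear(1)[OF L])
    finally show ?thesis .
  qed
  have "Ck_on 2 S (\<lambda>y. f y \<bullet> b)"
    using smooth_on_bounded_linear[OF L S(1) f] by (simp add: smooth_on_def)
  from dirD_commute_real[OF this S, of u v]
  show "dirD (\<lambda>y. dirD f y u) x v \<bullet> b = dirD (\<lambda>y. dirD f y v) x u \<bullet> b"
    by (simp add: D)
qed

section \<open>Matrix algebra\<close>

lemma vector_4 [simp]:
  "(vector [x,y,z,w] :: ('a::zero)^4)$1 = x"
  "(vector [x,y,z,w] :: ('a::zero)^4)$2 = y"
  "(vector [x,y,z,w] :: ('a::zero)^4)$3 = z"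
  "(vector [x,y,z,w] :: ('a::zero)^4)$4 = w"
  unfolding vector_def by simp_all

lemma det_4:
  "det (A::'a::comm_ring_1^4^4) =
    A$1$1 * (A$2$2 * (A$3$3 * A$4$4 - A$3$4 * A$4$3) - A$2$3 * (A$3$2 * A$4$4 - A$3$4 * A$4$2)
              + A$2$4 * (A$3$2 * A$4$3 - A$3$3 * A$4$2))
    - A$1$2 * (A$2$1 * (A$3$3 * A$4$4 - A$3$4 * A$4$3) - A$2$3 * (A$3$1 * A$4$4 - A$3$4 * A$4$1)
              + A$2$4 * (A$3$1 * A$4$3 - A$3$3 * A$4$1))
    + A$1$3 * (A$2$1 * (A$3$2 * A$4$4 - A$3$4 * A$4$2) - A$2$2 * (A$3$1 * A$4$4 - A$3$4 * A$4$1)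
              + A$2$4 * (A$3$1 * A$4$2 - A$3$2 * A$4$1))
    - A$1$4 * (A$2$1 * (A$3$2 * A$4$3 - A$3$3 * A$4$2) - A$2$2 * (A$3$1 * A$4$3 - A$3$3 * A$4$1)
              + A$2$3 * (A$3$1 * A$4$2 - A$3$2 * A$4$1))"
proof -
  have f1: "finite {2::4, 3, 4}" "1 \<notin> {2::4, 3, 4}" by auto
  have f2: "finite {3::4, 4}" "2 \<notin> {3::4, 4}" by auto
  have f3: "finite {4::4}" "3 \<notin> {4::4}" by auto
  show ?thesis
    unfolding det_def UNIV_4
    unfolding sum_over_permutations_insert[OF f1]
    unfolding sum_over_permutations_insert[OF f2]
    unfolding sum_over_permutations_insert[OF f3]
    unfolding permutes_sing
    by (simp add: sign_swap_id permutation_swap_id permutation_compose sign_compose sign_id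
        swap_id_eq algebra_simps)
qed

lemma transpose_add: "transpose (A + B) = transpose A + transpose (B :: real^'n^'m)"
  by (simp add: transpose_def vec_eq_iff)

lemma transpose_diff: "transpose (A - B) = transpose A - transpose (B :: real^'n^'m)"
  by (simp add: transpose_def vec_eq_iff)

lemmas mat_distribs =
  bounded_bilinear.add_left[OF bilinear_mat]
  bounded_bilinear.add_right[OF bilinear_mat]
  bounded_bilinear.diff_left[OF bilinear_mat]
  bounded_bilinear.diff_right[OF bilinear_mat]
  bounded_bilinear.minus_left[OF bilinear_mat]
  bounded_bilinear.minus_right[OF bilinear_mat]
  bounded_bilinear.scaleR_left[OF bilinear_mat]
  bounded_bilinear.scaleR_right[OF bilinear_mat]
  bounded_bilinear.zero_left[OF bilinear_mat]
  bounded_bilinear.zero_right[OF bilinear_mat]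

lemmas mat_vec_distribs =
  bounded_bilinear.add_left[OF bilinear_mat_vec]
  bounded_bilinear.add_right[OF bilinear_mat_vec]
  bounded_bilinear.diff_left[OF bilinear_mat_vec]
  bounded_bilinear.diff_right[OF bilinear_mat_vec]
  bounded_bilinear.minus_left[OF bilinear_mat_vec]
  bounded_bilinear.minus_right[OF bilinear_mat_vec]
  bounded_bilinear.scaleR_left[OF bilinear_mat_vec]
  bounded_bilinear.scaleR_right[OF bilinear_mat_vec]

lemma matrix_eq_transform: "(\<And>v. A *v v = B *v v) \<Longrightarrow> A = (B :: real^'n^'m)"
  using matrix_eq by blast

lemma inner_matrix_vector: "(A *v v) \<bullet> w = v \<bullet> (transpose A *v w)" for A :: "real^'n^'m"
  by (metis dot_lmul_matrix inner_commute transpose_matrix_vector)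

lemma matrix_vector_axis: "(A *v axis j 1) $ i = A $ i $ j" for A :: "real^'n^'m"
  by (simp add: matrix_vector_mult_basis column_def)

lemma axis_nth_if: "axis i (x::real) $ j = (if j = i then x else 0)"
  by (simp add: axis_def)

lemma matrix_vector_axis_expand: "A *v v = (\<Sum>j\<in>UNIV. v $ j *\<^sub>R (A *v axis j 1))" for A :: "real^'n^'m"
  by (simp add: vec_eq_iff matrix_vector_axis) (simp add: matrix_vector_mult_def mult.commute)

section \<open>Oriented orthonormal frames\<close>

text \<open>The columns of \<open>E\<close> are an orthonormal basis for \<open>h\<close>.\<close>

definition frame :: "real^4^4 \<Rightarrow> real^4^4 \<Rightarrow> bool" where
  "frame h E \<longleftrightarrow> transpose E ** h ** E = mat 1"

text \<open>The endomorphism with the matrix \<open>a\<close> in the basis of columns of \<open>E\<close>.\<close>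

definition in_frame :: "real^4^4 \<Rightarrow> real^4^4 \<Rightarrow> real^4^4" where
  "in_frame E a = E ** a ** matrix_inv E"

definition ax :: "4 \<Rightarrow> real^4" where "ax k = axis k 1"

text \<open>This formula makes the inverse of a differentiable family of frames differentiable.\<close>

lemma frame_inv_eq:
  assumes "frame h E"
  shows "matrix_inv E = transpose E ** h"
proof (rule matrix_inv_unique)
  show "E ** (transpose E ** h) = mat 1"
    using assms matrix_left_right_inverse unfolding frame_def by blast
qed

lemma frame_inv:
  assumes "frame h E"
  shows "E ** matrix_inv E = mat 1" "matrix_inv E ** E = mat 1"
    "transpose (matrix_inv E) ** transpose E = mat 1" "transpose E ** transpose (matrix_inv E) = mat 1"
    "det E \<noteq> 0"
proof -
  have 1: "E ** (transpose E ** h) = mat 1"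
    using assms matrix_left_right_inverse unfolding frame_def by blast
  show 3: "E ** matrix_inv E = mat 1" "matrix_inv E ** E = mat 1"
    using 1 assms by (simp_all add: frame_def frame_inv_eq)
  show "transpose (matrix_inv E) ** transpose E = mat 1" "transpose E ** transpose (matrix_inv E) = mat 1"
    using 3 by (metis matrix_transpose_mul transpose_mat)+
  have "det E * det (matrix_inv E) = 1" using 3(1) by (metis det_I det_mul)
  then show "det E \<noteq> 0" by auto
qed

lemma frame_metric:
  assumes "frame h E"
  shows "h = transpose (matrix_inv E) ** matrix_inv E" "matrix_inv h = E ** transpose E"
    "transpose h = h" "det h * (det E)\<^sup>2 = 1"
proof -
  note inv = frame_inv[OF assms]
  show h: "h = transpose (matrix_inv E) ** matrix_inv E"
    by (metis frame_inv_eq[OF assms] inv(3) matrix_mul_assoc matrix_mul_lid)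
  have "h ** (E ** transpose E) = transpose (matrix_inv E) ** (matrix_inv E ** E) ** transpose E"
    by (subst h) (simp add: matrix_mul_assoc)
  also have "\<dots> = mat 1" by (simp add: inv)
  finally show "matrix_inv h = E ** transpose E" by (rule matrix_inv_unique)
  show "transpose h = h" by (subst (1 2) h) (simp add: matrix_transpose_mul)
  have "det (transpose E ** h ** E) = 1" using assms by (simp add: frame_def)
  then show "det h * (det E)\<^sup>2 = 1" by (simp add: det_mul power2_eq_square mult_ac)
qed

lemma in_frame_inverse:
  assumes "frame h E"
  shows "matrix_inv E ** in_frame E a ** E = a" "in_frame E (matrix_inv E ** A ** E) = A"
proof -
  note inv = frame_inv[OF assms]
  have "matrix_inv E ** in_frame E a ** E = (matrix_inv E ** E) ** a ** (matrix_inv E ** E)"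
    by (simp add: in_frame_def matrix_mul_assoc)
  then show "matrix_inv E ** in_frame E a ** E = a" by (simp add: inv)
  have "in_frame E (matrix_inv E ** A ** E) = (E ** matrix_inv E) ** A ** (E ** matrix_inv E)"
    by (simp add: in_frame_def matrix_mul_assoc)
  then show "in_frame E (matrix_inv E ** A ** E) = A" by (simp add: inv)
qed

lemma in_frame_linear:
  "in_frame E (a + b) = in_frame E a + in_frame E b"
  "in_frame E (a - b) = in_frame E a - in_frame E b"
  "in_frame E (- a) = - in_frame E a"
  "in_frame E (c *\<^sub>R a) = c *\<^sub>R in_frame E a"
  "in_frame E 0 = 0"
  by (simp_all add: in_frame_def mat_distribs)

lemma in_frame_sum: "in_frame E (\<Sum>i\<in>I. f i) = (\<Sum>i\<in>I. in_frame E (f i))"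
  by (rule linear_sum) (auto intro!: linearI simp: in_frame_linear)

lemma in_frame_mul:
  assumes "frame h E"
  shows "in_frame E a ** in_frame E b = in_frame E (a ** b)"
    "in_frame E a *v (E *v v) = E *v (a *v v)" "in_frame E (mat 1) = mat 1"
proof -
  note inv = frame_inv[OF assms]
  have "in_frame E a ** in_frame E b = E ** a ** (matrix_inv E ** E) ** b ** matrix_inv E"
    by (simp add: in_frame_def matrix_mul_assoc)
  then show "in_frame E a ** in_frame E b = in_frame E (a ** b)"
    by (simp add: inv in_frame_def matrix_mul_assoc)
  have "in_frame E a *v (E *v v) = (E ** a ** (matrix_inv E ** E)) *v v"
    by (simp add: in_frame_def matrix_mul_assoc matrix_vector_mul_assoc)
  then show "in_frame E a *v (E *v v) = E *v (a *v v)"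
    by (simp add: inv matrix_vector_mul_assoc)
  show "in_frame E (mat 1) = mat 1" by (simp add: in_frame_def inv)
qed

lemma in_frame_inject: "frame h E \<Longrightarrow> in_frame E a = in_frame E b \<longleftrightarrow> a = b"
  by (metis in_frame_inverse(1))

lemma frame_vector: "frame h E \<Longrightarrow> E *v (matrix_inv E *v v) = v"
  by (simp add: frame_inv matrix_vector_mul_assoc)

lemma ip_frame: "frame h E \<Longrightarrow> ip h (E *v v) (E *v w) = v \<bullet> w"
  by (simp add: ip_def inner_matrix_vector matrix_vector_mul_assoc matrix_mul_assoc frame_def
      del: transpose_matrix_vector)

lemma ip_sym: "transpose h = h \<Longrightarrow> ip h v w = ip h w v"
  by (metis inner_commute inner_matrix_vector ip_def)

lemma adj_in_frame:
  assumes "frame h E"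
  shows "adj h (in_frame E a) = in_frame E (transpose a)"
proof -
  note inv = frame_inv[OF assms] and met = frame_metric[OF assms]
  have "adj h (in_frame E a) = E ** (transpose E ** transpose (matrix_inv E)) ** transpose a
      ** (transpose E ** transpose (matrix_inv E)) ** matrix_inv E"
    unfolding adj_def met(2) by (subst met(1)) (simp add: in_frame_def matrix_transpose_mul matrix_mul_assoc)
  then show ?thesis by (simp add: inv in_frame_def)
qed

lemma tens_in_frame:
  assumes "frame h E"
  shows "tens h (E *v w) (E *v v) = in_frame E (\<chi> i j. v $ i * w $ j)"
proof (rule matrix_eq_transform)
  fix z :: "real^4"
  obtain y where z: "z = E *v y" by (metis frame_vector[OF assms])
  have "linear (\<lambda>z. ip h (E *v w) z *\<^sub>R (E *v v))"
    by (auto intro!: linearI simp: ip_def mat_vec_distribs inner_add_right scaleR_left_distrib)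
  then have "tens h (E *v w) (E *v v) *v z = ip h (E *v w) z *\<^sub>R (E *v v)"
    unfolding tens_def by simp
  also have "\<dots> = E *v ((w \<bullet> y) *\<^sub>R v)"
    by (simp add: z ip_frame[OF assms] mat_vec_distribs)
  also have "(w \<bullet> y) *\<^sub>R v = (\<chi> i j. v $ i * w $ j) *v y"
    by (simp add: matrix_vector_mult_def inner_vec_def vec_eq_iff sum_distrib_left sum_distrib_right mult_ac)
  finally show "tens h (E *v w) (E *v v) *v z = in_frame E (\<chi> i j. v $ i * w $ j) *v z"
    by (simp add: z in_frame_mul[OF assms])
qed

lemma sharp_frame:
  assumes "frame h E" "linear \<alpha>"
  shows "sharp h \<alpha> = E *v (\<chi> i. \<alpha> (E *v ax i))"
proof -
  have "\<alpha> (E *v ax i) = (\<Sum>j\<in>UNIV. E $ j $ i * \<alpha> (axis j 1))" for i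
  proof -
    have "E *v ax i = (\<Sum>j\<in>UNIV. E $ j $ i *\<^sub>R axis j 1)"
      by (simp add: ax_def vec_eq_iff matrix_vector_axis axis_nth_if if_distrib sum.delta cong: if_cong)
    then show ?thesis by (simp add: linear_sum[OF assms(2)] linear_cmul[OF assms(2)])
  qed
  then have "(\<chi> i. \<alpha> (E *v ax i)) = transpose E *v (\<chi> i. \<alpha> (axis i 1))"
    by (simp add: matrix_vector_mult_def transpose_def vec_eq_iff del: transpose_matrix_vector)
  then show ?thesis
    by (simp add: sharp_def frame_metric(2)[OF assms(1)] matrix_vector_mul_assoc del: transpose_matrix_vector)
qed

lemma onframe_frame:
  assumes "frame h E"
  shows "frame h (\<chi> i k. onframe h k $ i)" "onframe h k = (\<chi> i k. onframe h k $ i) *v ax k"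
proof -
  let ?F = "\<chi> i k. onframe h k $ i"
  have "\<forall>i j. ip h (E *v ax i) (E *v ax j) = (if i = j then 1 else 0)"
    by (simp add: ip_frame[OF assms] ax_def inner_axis_axis)
  then have "\<exists>X :: 4 \<Rightarrow> real^4. \<forall>i j. ip h (X i) (X j) = (if i = j then 1 else 0)"
    by (rule exI[of _ "\<lambda>k. E *v ax k"])
  then have "\<forall>i j. ip h (onframe h i) (onframe h j) = (if i = j then 1 else 0)"
    unfolding onframe_def by (rule someI_ex)
  then have on: "ip h (onframe h i) (onframe h j) = (if i = j then 1 else 0)" for i j
    by blast
  show F: "onframe h k = ?F *v ax k" for k
    by (simp add: vec_eq_iff ax_def matrix_vector_axis)
  have "(transpose ?F ** h ** ?F) $ i $ j = ax i \<bullet> ((transpose ?F ** h ** ?F) *v ax j)" for i j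
    by (simp add: ax_def inner_axis' matrix_vector_axis)
  also have "\<dots> i j = ip h (?F *v ax i) (?F *v ax j)" for i j
    by (simp add: ip_def inner_matrix_vector matrix_vector_mul_assoc matrix_mul_assoc
        del: transpose_matrix_vector)
  also have "\<dots> i j = ip h (onframe h i) (onframe h j)" for i j by (simp only: F[symmetric])
  finally have "(transpose ?F ** h ** ?F) $ i $ j = ip h (onframe h i) (onframe h j)" for i j .
  then show "frame h ?F" by (simp add: frame_def vec_eq_iff mat_def on)
qed

lemma bilinear_mult: "linear f \<Longrightarrow> linear g \<Longrightarrow> bilinear (\<lambda>p q. f p * g q :: real)"
  by (auto simp: bilinear_def linear_iff algebra_simps)

lemma bilinear_sum_maps: "(\<And>l. bilinear (B l)) \<Longrightarrow> bilinear (\<lambda>p q. \<Sum>l\<in>I. B l p q)"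
  by (auto simp: bilinear_def intro: linear_compose_sum)

text \<open>Traces of bilinear maps do not depend on the orthonormal frame, because two such frames
  differ by an orthogonal matrix.\<close>

lemma sum_onframe:
  assumes E: "frame h E" and B: "bilinear B"
  shows "(\<Sum>k\<in>UNIV. B (onframe h k) (onframe h k)) = (\<Sum>k\<in>UNIV. B (E *v ax k) (E *v ax k))"
proof -
  define F :: "real^4^4" where "F = (\<chi> i k. onframe h k $ i)"
  have F: "frame h F" "\<And>k. onframe h k = F *v ax k"
    unfolding F_def by (rule onframe_frame[OF E])+
  define U where "U = matrix_inv E ** F"
  have "transpose U ** U = transpose F ** (transpose (matrix_inv E) ** matrix_inv E) ** F"
    by (simp add: U_def matrix_transpose_mul matrix_mul_assoc)
  also have "\<dots> = mat 1" using F(1) by (simp add: frame_metric(1)[OF E, symmetric] frame_def)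
  finally have "U ** transpose U = mat 1" by (simp add: matrix_left_right_inverse)
  then have "(U ** transpose U) $ i $ j = mat 1 $ i $ j" for i j by simp
  then have UU: "(\<Sum>k\<in>UNIV. U $ i $ k * U $ j $ k) = (if i = j then 1 else 0)" for i j
    by (simp add: matrix_matrix_mult_def transpose_def mat_def)
  have FU: "F *v ax k = (\<Sum>i\<in>UNIV. U $ i $ k *\<^sub>R (E *v ax i))" for k
  proof -
    have "F *v ax k = E *v (U *v ax k)"
      by (simp add: U_def matrix_vector_mul_assoc[symmetric] frame_vector[OF E])
    also have "\<dots> = (\<Sum>i\<in>UNIV. U $ i $ k *\<^sub>R (E *v ax i))"
      by (subst matrix_vector_axis_expand) (simp add: ax_def matrix_vector_axis)
    finally show ?thesis .
  qed
  have l: "linear (\<lambda>x. B x y)" "linear (B x)" for x y using B by (auto simp: bilinear_def)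
  have "(\<Sum>k\<in>UNIV. B (F *v ax k) (F *v ax k))
      = (\<Sum>k\<in>UNIV. \<Sum>i\<in>UNIV. \<Sum>j\<in>UNIV. (U $ i $ k * U $ j $ k) *\<^sub>R B (E *v ax i) (E *v ax j))"
    unfolding FU
    by (simp add: linear_sum[OF l(1)] linear_sum[OF l(2)] linear_cmul[OF l(1)] linear_cmul[OF l(2)]
        scaleR_sum_right) (rule sum.cong[OF refl], subst sum.swap, simp add: mult.commute)
  also have "\<dots> = (\<Sum>i\<in>UNIV. \<Sum>j\<in>UNIV. \<Sum>k\<in>UNIV. (U $ i $ k * U $ j $ k) *\<^sub>R B (E *v ax i) (E *v ax j))"
    by (subst sum.swap) (intro sum.cong refl sum.swap)
  also have "\<dots> = (\<Sum>i\<in>UNIV. B (E *v ax i) (E *v ax i))"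
    by (simp add: scaleR_left.sum[symmetric] UU if_distrib[of "\<lambda>c. c *\<^sub>R _"] sum.delta cong: if_cong)
  finally show ?thesis by (simp add: F)
qed

section \<open>Self-dual endomorphisms\<close>

text \<open>The Hodge star of the standard \<open>\<real>\<^sup>4\<close> in components. It only sees the skew-symmetric part of \<open>a\<close>.\<close>

definition star :: "real^4^4 \<Rightarrow> real^4^4" where
  "star a = vector [
     vector [0, (a$3$4 - a$4$3)/2, (a$4$2 - a$2$4)/2, (a$2$3 - a$3$2)/2],
     vector [(a$4$3 - a$3$4)/2, 0, (a$1$4 - a$4$1)/2, (a$3$1 - a$1$3)/2],
     vector [(a$2$4 - a$4$2)/2, (a$4$1 - a$1$4)/2, 0, (a$1$2 - a$2$1)/2],
     vector [(a$3$2 - a$2$3)/2, (a$1$3 - a$3$1)/2, (a$2$1 - a$1$2)/2, 0]]"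

text \<open>\<open>sdm u = u\<^sub>1 I + u\<^sub>2 J + u\<^sub>3 K\<close> for three anticommuting complex structures \<open>I\<close>, \<open>J\<close>, \<open>K\<close> that form an
  orthonormal basis of the self-dual endomorphisms of the standard \<open>\<real>\<^sup>4\<close>; \<open>sdc\<close> gives the
  components of the self-dual part with respect to this basis.\<close>

definition sdm :: "real^3 \<Rightarrow> real^4^4" where
  "sdm u = vector [
     vector [0, u$1, u$2, u$3],
     vector [- u$1, 0, u$3, - u$2],
     vector [- u$2, - u$3, 0, u$1],
     vector [- u$3, u$2, - u$1, 0]]"

definition sdc :: "real^4^4 \<Rightarrow> real^3" where
  "sdc a = vector [(a$1$2 - a$2$1 + a$3$4 - a$4$3)/4, (a$1$3 - a$3$1 + a$4$2 - a$2$4)/4,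
     (a$1$4 - a$4$1 + a$2$3 - a$3$2)/4]"

lemma sdm_linear:
  "sdm (u + v) = sdm u + sdm v" "sdm (u - v) = sdm u - sdm v" "sdm (- u) = - sdm u"
  "sdm (c *\<^sub>R u) = c *\<^sub>R sdm u" "sdm 0 = 0"
  by (simp_all add: sdm_def vec_eq_iff forall_4)

lemma sdc_linear:
  "sdc (u + v) = sdc u + sdc v" "sdc (u - v) = sdc u - sdc v" "sdc (- u) = - sdc u"
  "sdc (c *\<^sub>R u) = c *\<^sub>R sdc u" "sdc 0 = 0"
  by (simp_all add: sdc_def vec_eq_iff forall_3 field_simps)

lemma bounded_linear_sdm: "bounded_linear sdm"
  unfolding linear_conv_bounded_linear[symmetric] by (auto intro!: linearI simp: sdm_linear)

lemma bounded_linear_sdc: "bounded_linear sdc"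
  unfolding linear_conv_bounded_linear[symmetric] by (auto intro!: linearI simp: sdc_linear)

lemma sdc_sdm [simp]: "sdc (sdm u) = u"
  by (simp add: sdc_def sdm_def vec_eq_iff forall_3)

lemma sdm_inject [simp]: "sdm u = sdm v \<longleftrightarrow> u = v"
  by (metis sdc_sdm)

lemma sdm_eq_0_iff [simp]: "sdm u = 0 \<longleftrightarrow> u = 0"
  by (metis sdm_linear(5) sdm_inject)

lemma transpose_sdm: "transpose (sdm u) = - sdm u"
  by (simp add: transpose_def sdm_def vec_eq_iff forall_4)

lemma sdm_square: "sdm u ** sdm u = - ((u \<bullet> u) *\<^sub>R mat 1)"
  by (simp add: sdm_def vec_eq_iff forall_4 matrix_matrix_mult_def sum_4 mat_def inner_vec_def sum_3
      algebra_simps)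

text \<open>Averaging \<open>a\<close> with its Hodge dual leaves half the symmetric part and the self-dual part.\<close>

lemma add_star: "(1/2) *\<^sub>R (a + star a) = (1/4) *\<^sub>R (a + transpose a) + sdm (sdc a)"
  by (simp add: star_def sdm_def sdc_def transpose_def vec_eq_iff forall_4 field_simps)

lemma selfdual_standard: "transpose a = - a \<and> star a = a \<longleftrightarrow> a \<in> range sdm"
proof
  assume a: "transpose a = - a \<and> star a = a"
  then have "a = sdm (sdc a)" using add_star[of a] by (simp add: scaleR_2[symmetric])
  then show "a \<in> range sdm" by blast
next
  assume "a \<in> range sdm"
  then show "transpose a = - a \<and> star a = a"
    by (auto simp: transpose_sdm) (simp add: star_def sdm_def vec_eq_iff forall_4)
qed

lemma vol_frame:
  assumes E: "frame h E" "det E > 0"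
  shows "vol h (E *v a) (E *v b) (E *v c) (E *v d) = det (vector [a, b, c, d] :: real^4^4)"
proof -
  have "(vector [E *v a, E *v b, E *v c, E *v d] :: real^4^4) = vector [a, b, c, d] ** transpose E"
    by (simp add: vec_eq_iff forall_4 matrix_matrix_mult_def matrix_vector_mult_def transpose_def sum_4 mult.commute)
  moreover have "sqrt (det h) * det E = 1"
  proof -
    have "det h > 0" using frame_metric(4)[OF E(1)] E(2)
      by (metis zero_less_mult_pos2 zero_less_one zero_less_power)
    then have "sqrt (det h) * det E = sqrt (det h * (det E)\<^sup>2)" using E(2) by (simp add: real_sqrt_mult)
    then show ?thesis by (simp add: frame_metric(4)[OF E(1)])
  qed
  ultimately show ?thesis by (simp add: vol_def det_mul mult_ac)
qed

lemma form_frame: "frame h E \<Longrightarrow> form_of h (in_frame E a) (E *v v) (E *v w) = (a *v v) \<bullet> w"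
  by (simp add: form_of_def in_frame_mul ip_frame)

lemma vol_linear:
  "linear (\<lambda>a. vol h a b c d)" "linear (\<lambda>b. vol h a b c d)"
  "linear (\<lambda>c. vol h a b c d)" "linear (\<lambda>d. vol h a b c d)"
  unfolding vol_def det_4 by (auto intro!: linearI simp: algebra_simps)

lemma form_of_linear:
  "linear (\<lambda>v. form_of h A v w)" "linear (\<lambda>w. form_of h A v w)"
  unfolding form_of_def ip_def
  by (auto intro!: linearI simp: inner_add_left inner_add_right mat_vec_distribs)

text \<open>The definition sums over a chosen frame and is bilinear in it, so the sums may be taken over the
  columns of \<open>E\<close> instead; there the star has constant coefficients.\<close>

lemma hodge_in_frame:
  assumes E: "frame h E" "det E > 0"
  shows "hodge h (in_frame E a) = in_frame E (star a)"
proof -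
  let ?A = "in_frame E a"
  have frame_riem: "(\<Sum>k\<in>UNIV. \<Sum>l\<in>UNIV. form_of h ?A (onframe h k) (onframe h l) * vol h (onframe h k) (onframe h l) v w)
      = (\<Sum>k\<in>UNIV. \<Sum>l\<in>UNIV. a $ l $ k * vol h (E *v ax k) (E *v ax l) v w)" for v w
  proof -
    have "(\<Sum>l\<in>UNIV. form_of h ?A (onframe h k) (onframe h l) * vol h (onframe h k) (onframe h l) v w)
       = (\<Sum>l\<in>UNIV. form_of h ?A (onframe h k) (E *v ax l) * vol h (onframe h k) (E *v ax l) v w)" for k
      using sum_onframe[OF E(1), of "\<lambda>p q. form_of h ?A (onframe h k) p * vol h (onframe h k) q v w"]
        bilinear_mult[OF form_of_linear(2) vol_linear(2)] by blast
    then have "(\<Sum>k\<in>UNIV. \<Sum>l\<in>UNIV. form_of h ?A (onframe h k) (onframe h l) * vol h (onframe h k) (onframe h l) v w)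
      = (\<Sum>k\<in>UNIV. \<Sum>l\<in>UNIV. form_of h ?A (onframe h k) (E *v ax l) * vol h (onframe h k) (E *v ax l) v w)"
      by simp
    also have "\<dots> = (\<Sum>k\<in>UNIV. \<Sum>l\<in>UNIV. form_of h ?A (E *v ax k) (E *v ax l) * vol h (E *v ax k) (E *v ax l) v w)"
      using sum_onframe[OF E(1), of "\<lambda>p q. \<Sum>l\<in>UNIV. form_of h ?A p (E *v ax l) * vol h q (E *v ax l) v w"]
        bilinear_sum_maps[of "\<lambda>l p q. form_of h ?A p (E *v ax l) * vol h q (E *v ax l) v w",
          OF bilinear_mult[OF form_of_linear(1) vol_linear(1)]] by blast
    finally show ?thesis
      by (simp add: form_frame[OF E(1)] ax_def inner_axis matrix_vector_axis)
  qed
  define f where "f v = sharp h (\<lambda>w. 1/2 *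
     (\<Sum>k\<in>UNIV. \<Sum>l\<in>UNIV. a $ l $ k * vol h (E *v ax k) (E *v ax l) v w))" for v
  have "f (E *v u) = E *v (star a *v u)" for u
  proof -
    have "linear (\<lambda>w. 1/2 * (\<Sum>k\<in>UNIV. \<Sum>l\<in>UNIV. a $ l $ k * vol h (E *v ax k) (E *v ax l) (E *v u) w))"
      by (rule linearI) (simp_all add: linear_add[OF vol_linear(4)] linear_cmul[OF vol_linear(4)]
          distrib_left sum.distrib add_divide_distrib sum_distrib_left mult_ac sum_divide_distrib)
    then have "f (E *v u) = E *v (\<chi> i. 1/2 * (\<Sum>k\<in>UNIV. \<Sum>l\<in>UNIV. a $ l $ k * det (vector [ax k, ax l, u, ax i] :: real^4^4)))"
      by (simp add: f_def sharp_frame[OF E(1)] vol_frame[OF E])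
    also have "(\<chi> i. 1/2 * (\<Sum>k\<in>UNIV. \<Sum>l\<in>UNIV. a $ l $ k * det (vector [ax k, ax l, u, ax i] :: real^4^4))) = star a *v u"
      by (simp add: vec_eq_iff forall_4 sum_4 det_4 ax_def axis_nth_if star_def matrix_vector_mult_def)
        (simp add: field_simps)
    finally show ?thesis .
  qed
  then have "f v = in_frame E (star a) *v v" for v
    by (metis frame_vector[OF E(1)] in_frame_mul(2)[OF E(1)])
  then have "matrix f = in_frame E (star a)"
    by (metis ext matrix_of_matrix_vector_mul)
  then show ?thesis unfolding hodge_def frame_riem f_def[abs_def] .
qed

lemma selfdual_frame:
  assumes E: "frame h E" "det E > 0"
  shows "selfdual h = range (\<lambda>u. in_frame E (sdm u))"
proof -
  have "in_frame E a \<in> selfdual h \<longleftrightarrow> a \<in> range sdm" for a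
    by (simp add: selfdual_def adj_in_frame[OF E(1)] hodge_in_frame[OF E] in_frame_linear(3)[symmetric]
        in_frame_inject[OF E(1)] selfdual_standard[symmetric])
  moreover have "A \<in> range (\<lambda>u. in_frame E (sdm u))
      \<longleftrightarrow> matrix_inv E ** A ** E \<in> range sdm" for A
    by (metis (no_types, lifting) in_frame_inverse[OF E(1)] image_iff)
  ultimately show ?thesis
    by (metis (no_types, lifting) in_frame_inverse(2)[OF E(1)] set_eqI)
qed

text \<open>The basis chosen in \<open>matrix_on\<close> is the image under \<open>\<phi>\<close> of the columns of an invertible matrix \<open>P\<close>.
  Hence traces and determinants on \<open>S\<close> can be computed from \<open>m\<close>.\<close>

lemma matrix_on_similar:
  fixes \<phi> :: "real^3 \<Rightarrow> real^4^4"
  assumes lin: "linear \<phi>" and inj: "inj \<phi>" and S: "S = range \<phi>"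
    and F: "\<And>u. F (\<phi> u) = \<phi> (m *v u)"
  obtains P where "det P \<noteq> 0" "m ** P = P ** matrix_on S F"
proof -
  define b where "b = (SOME b :: 3 \<Rightarrow> real^4^4. inj b \<and> independent (range b) \<and> span (range b) = S)"
  have ex: "inj (\<lambda>i. \<phi> (axis i 1)) \<and> independent (range (\<lambda>i::3. \<phi> (axis i 1))) \<and> span (range (\<lambda>i::3. \<phi> (axis i 1))) = S"
  proof -
    have B: "range (\<lambda>i::3. axis i (1::real)) = Basis" by (auto simp: Basis_vec_def)
    have r: "range (\<lambda>i::3. \<phi> (axis i 1)) = \<phi> ` Basis" by (simp add: B[symmetric] image_image)
    have "inj (\<lambda>i. \<phi> (axis i 1))"
      using inj by (intro injI) (simp add: inj_eq axis_eq_axis)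
    moreover have "independent (\<phi> ` Basis)"
      by (rule linear_independent_injective_image[OF lin independent_Basis])
        (rule inj_on_subset[OF inj subset_UNIV])
    moreover have "span (\<phi> ` Basis) = S"
      by (simp add: linear_span_image[OF lin] S)
    ultimately show ?thesis by (simp add: r)
  qed
  have "\<exists>b :: 3 \<Rightarrow> real^4^4. inj b \<and> independent (range b) \<and> span (range b) = S"
    by (rule exI[of _ "\<lambda>i. \<phi> (axis i 1)"]) (rule ex)
  then have "inj b \<and> independent (range b) \<and> span (range b) = S"
    unfolding b_def by (rule someI_ex)
  then have b: "inj b" "independent (range b)" "span (range b) = S" by auto
  have "\<forall>i. \<exists>p. b i = \<phi> p"
    using b(3) S by (metis rangeE rangeI span_base)
  then obtain p where p: "\<And>i. b i = \<phi> (p i)" by metis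
  define P :: "real^3^3" where "P = (\<chi> i j. p j $ i)"
  define N where "N = matrix_on S F"
  have Pc: "P *v c = (\<Sum>j\<in>UNIV. c $ j *\<^sub>R p j)" for c
    by (simp add: P_def vec_eq_iff matrix_vector_mult_def mult.commute)
  have phiP: "\<phi> (P *v c) = (\<Sum>j\<in>UNIV. c $ j *\<^sub>R b j)" for c
    by (simp add: Pc linear_sum[OF lin] linear_cmul[OF lin] p)
  have "c = 0" if "P *v c = 0" for c
  proof -
    have "(\<Sum>j\<in>UNIV. c $ j *\<^sub>R b j) = 0" using phiP[of c] that by (simp add: linear_0[OF lin])
    then have "(\<Sum>w\<in>range b. c $ (inv b w) *\<^sub>R w) = 0"
      using b(1) by (simp add: sum.reindex inv_f_f)
    then have "c $ (inv b w) = 0" if "w \<in> range b" for w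
      using independentD[OF b(2) _ order_refl, of "\<lambda>w. c $ inv b w" w] that by simp
    from this[OF rangeI] show ?thesis by (simp add: vec_eq_iff inv_f_f[OF b(1)])
  qed
  then have "\<exists>Q. Q ** P = mat 1" using matrix_left_invertible_ker by blast
  then have 1: "det P \<noteq> 0" by (metis det_I det_mul mult_zero_right zero_neq_one)
  have "\<phi> ((m ** P) *v axis j 1) = \<phi> ((P ** N) *v axis j 1)" for j
  proof -
    have "\<phi> ((m ** P) *v axis j 1) = F (\<phi> (P *v axis j 1))"
      by (simp add: F matrix_vector_mul_assoc)
    also have "\<phi> (P *v axis j 1) = b j"
      by (simp add: phiP axis_nth_if if_distrib[of "\<lambda>c. c *\<^sub>R _"] sum.delta cong: if_cong)
    also have "F (b j) = (\<Sum>w\<in>range b. representation (range b) (F (b j)) w *\<^sub>R w)"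
      using b(2,3) S F p by (intro sum_representation_eq[symmetric]) auto
    also have "\<dots> = (\<Sum>i\<in>UNIV. representation (range b) (F (b j)) (b i) *\<^sub>R b i)"
      using b(1) by (simp add: sum.reindex)
    also have "\<dots> = \<phi> (P *v (N *v axis j 1))"
      by (simp add: phiP N_def matrix_on_def b_def[symmetric] matrix_vector_axis Let_def)
    finally show ?thesis by (simp add: matrix_vector_mul_assoc)
  qed
  then have "(m ** P) *v axis j 1 = (P ** N) *v axis j 1" for j using inj by (simp add: inj_eq)
  then have "m ** P = P ** N"
    by (simp add: vec_eq_iff matrix_vector_axis[symmetric] del: matrix_vector_mul_assoc)
  then show ?thesis using 1 that by (simp add: N_def)
qed

lemma on_selfdual:
  assumes E: "frame h E" "det E > 0" and F: "\<And>u. F (in_frame E (sdm u)) = in_frame E (sdm (m *v u))"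
  shows "det_on (selfdual h) F = det m" "trace_on (selfdual h) F = trace m"
proof -
  have lin: "linear (\<lambda>u. in_frame E (sdm u))"
    by (auto intro!: linearI simp: sdm_linear in_frame_linear)
  have inj: "inj (\<lambda>u. in_frame E (sdm u))" using in_frame_inject[OF E(1)] by (auto simp: inj_def)
  obtain P where P: "det P \<noteq> 0" "m ** P = P ** matrix_on (selfdual h) F"
    using matrix_on_similar[OF lin inj selfdual_frame[OF E], of F m] F by blast
  have N: "matrix_on (selfdual h) F = matrix_inv P ** (m ** P)"
    by (simp add: P(2) matrix_mul_assoc matrix_inv_mul[OF P(1)])
  show "det_on (selfdual h) F = det m"
    using P(1) arg_cong[OF P(2), of det] by (simp add: det_on_def det_mul)
  show "trace_on (selfdual h) F = trace m"
    unfolding trace_on_def N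
    by (subst trace_mul_sym) (simp add: matrix_mul_assoc[symmetric] matrix_inv_mul[OF P(1)])
qed

section \<open>The Levi-Civita connection in a chart\<close>

locale chart_metric =
  fixes S :: "(real^4) set" and G :: "real^4 \<Rightarrow> real^4^4"
  assumes open_S: "open S" and smooth_G: "smooth_on S G"
    and sym_G: "x \<in> S \<Longrightarrow> transpose (G x) = G x"
    and pos_G: "x \<in> S \<Longrightarrow> v \<noteq> 0 \<Longrightarrow> v \<bullet> (G x *v v) > 0"

lemma differentiable_vec:
  fixes f :: "'n::finite \<Rightarrow> 'a::real_normed_vector \<Rightarrow> 'b::real_normed_vector"
  assumes f: "\<And>i. f i differentiable (at x)"
  shows "(\<lambda>x. \<chi> i. f i x) differentiable (at x)"
proof -
  have "(\<chi> i. f i x) = (\<Sum>i\<in>UNIV. axis i (f i x))" for x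
    by (simp add: vec_eq_iff axis_def if_distrib sum.delta cong: if_cong)
  then show ?thesis
    using dirD_bounded_linear(2)[OF bounded_linear_axis f] by (auto intro!: differentiable_sum)
qed

lemma differentiable_nth: "f differentiable (at x) \<Longrightarrow> (\<lambda>x. f x $ i) differentiable (at x)"
  by (rule dirD_bounded_linear(2)[OF bounded_linear_vec_nth])

lemma differentiable_mat:
  fixes f :: "'a::real_normed_vector \<Rightarrow> real^'n^'m" and g :: "'a \<Rightarrow> real^'p^'n"
  shows "f differentiable (at x) \<Longrightarrow> g differentiable (at x) \<Longrightarrow> (\<lambda>x. f x ** g x) differentiable (at x)"
  by (rule dirD_bounded_bilinear(2)[OF bilinear_mat])

lemma differentiable_mat_vec:
  fixes f :: "'a::real_normed_vector \<Rightarrow> real^'n^'m" and g :: "'a \<Rightarrow> real^'n"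
  shows "f differentiable (at x) \<Longrightarrow> g differentiable (at x) \<Longrightarrow> (\<lambda>x. f x *v g x) differentiable (at x)"
  by (rule dirD_bounded_bilinear(2)[OF bilinear_mat_vec])

lemma differentiable_transpose:
  fixes f :: "'a::real_normed_vector \<Rightarrow> real^'n^'m"
  shows "f differentiable (at x) \<Longrightarrow> (\<lambda>x. transpose (f x)) differentiable (at x)"
  by (rule dirD_bounded_linear(2)[OF bounded_linear_transpose])

lemma differentiable_det:
  fixes f :: "'a::real_normed_vector \<Rightarrow> real^4^4"
  assumes "f differentiable (at x)"
  shows "(\<lambda>x. det (f x)) differentiable (at x)"
  unfolding det_4 by (intro differentiable_add differentiable_diff differentiable_mult differentiable_nth assms)

lemmas dirD_matrix_mul = dirD_bounded_bilinear(1)[OF bilinear_mat]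
lemmas dirD_matrix_vector_mul = dirD_bounded_bilinear(1)[OF bilinear_mat_vec]
lemmas dirD_transpose = dirD_bounded_linear(1)[OF bounded_linear_transpose]
lemma differentiable_sqrt:
  fixes f :: "'a::real_normed_vector \<Rightarrow> real"
  assumes "f differentiable (at x)" "f x > 0"
  shows "(\<lambda>x. sqrt (f x)) differentiable (at x)"
proof -
  have "sqrt differentiable (at (f x))"
    using DERIV_real_sqrt[OF assms(2)] real_differentiable_def by blast
  then show ?thesis by (rule dirD_compose(2)[OF assms(1)])
qed

context chart_metric
begin

lemma G_differentiable: "x \<in> S \<Longrightarrow> G differentiable (at x)"
  by (rule smooth_on_differentiable[OF smooth_G])

lemma differentiable_ip:
  assumes "x \<in> S" "f differentiable (at x)" "g differentiable (at x)"
  shows "(\<lambda>x. ip (G x) (f x) (g x)) differentiable (at x)"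
  unfolding ip_def
  by (intro dirD_bounded_bilinear(2)[OF bounded_bilinear_inner] differentiable_mat_vec assms G_differentiable)

lemma ip_linear_simps:
  "ip h (v + w) u = ip h v u + ip h w u" "ip h u (v + w) = ip h u v + ip h u w"
  "ip h (v - w) u = ip h v u - ip h w u" "ip h u (v - w) = ip h u v - ip h u w"
  "ip h (c *\<^sub>R v) u = c * ip h v u" "ip h u (c *\<^sub>R v) = c * ip h u v"
  "ip h (\<Sum>i\<in>I. f i) u = (\<Sum>i\<in>I. ip h (f i) u)" "ip h u (\<Sum>i\<in>I. f i) = (\<Sum>i\<in>I. ip h u (f i))"
  by (simp_all add: ip_def mat_vec_distribs inner_add_left inner_add_right inner_diff_left
      inner_diff_right inner_sum_left inner_sum_right linear_sum[OF matrix_vector_mul_linear])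

text \<open>Gram-Schmidt, applied to the coordinate fields. The vanishing of the components outside of
  \<open>K\<close> guarantees that the next coordinate field is independent of the fields already treated: after
  the projection its own component is still \<open>1\<close>.\<close>

lemma gram_schmidt:
  assumes "finite K"
  shows "\<exists>X :: 4 \<Rightarrow> real^4 \<Rightarrow> real^4. \<forall>k\<in>K. \<forall>x\<in>S. X k differentiable (at x)
     \<and> (\<forall>l\<in>K. ip (G x) (X k x) (X l x) = (if k = l then 1 else 0)) \<and> (\<forall>i. i \<notin> K \<longrightarrow> X k x $ i = 0)"
  using assms
proof (induction K)
  case empty
  then show ?case by simp
next
  case (insert k K)
  from insert.IH obtain X :: "4 \<Rightarrow> real^4 \<Rightarrow> real^4" where
    IH: "\<forall>k\<in>K. \<forall>x\<in>S. X k differentiable (at x)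
     \<and> (\<forall>l\<in>K. ip (G x) (X k x) (X l x) = (if k = l then 1 else 0)) \<and> (\<forall>i. i \<notin> K \<longrightarrow> X k x $ i = 0)"
    by blast
  then have X: "\<And>l x. l \<in> K \<Longrightarrow> x \<in> S \<Longrightarrow> X l differentiable (at x)"
    "\<And>l m x. l \<in> K \<Longrightarrow> m \<in> K \<Longrightarrow> x \<in> S \<Longrightarrow> ip (G x) (X l x) (X m x) = (if l = m then 1 else 0)"
    "\<And>l i x. l \<in> K \<Longrightarrow> i \<notin> K \<Longrightarrow> x \<in> S \<Longrightarrow> X l x $ i = 0" by blast+
  \<comment> \<open>The coordinate field minus its orthogonal projection to the span of the fields treated before.\<close>
  define u where "u x = axis k 1 - (\<Sum>l\<in>K. ip (G x) (axis k 1) (X l x) *\<^sub>R X l x)" for x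
  define Y where "Y x = inverse (sqrt (ip (G x) (u x) (u x))) *\<^sub>R u x" for x
  have uk: "u x $ k = 1" if "x \<in> S" for x
    using X(3) insert.hyps that by (simp add: u_def)
  have pos: "ip (G x) (u x) (u x) > 0" if "x \<in> S" for x
  proof -
    have "u x \<noteq> 0" using uk[OF that] by auto
    then show ?thesis using pos_G[OF that] by (simp add: ip_def)
  qed
  have du: "u differentiable (at x)" if "x \<in> S" for x
    unfolding u_def[abs_def] using that insert.hyps
    by (auto intro!: differentiable_diff differentiable_sum differentiable_scaleR differentiable_ip X)
  have dY: "Y differentiable (at x)" if "x \<in> S" for x
    unfolding Y_def[abs_def] using pos[OF that]
    by (intro differentiable_scaleR differentiable_inverse differentiable_sqrt differentiable_ip du that) auto
  have orth: "ip (G x) (u x) (X m x) = 0" if "x \<in> S" "m \<in> K" for x m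
  proof -
    have "ip (G x) (u x) (X m x) = ip (G x) (axis k 1) (X m x)
        - (\<Sum>l\<in>K. ip (G x) (axis k 1) (X l x) * ip (G x) (X l x) (X m x))"
      by (simp add: u_def ip_linear_simps)
    also have "(\<Sum>l\<in>K. ip (G x) (axis k 1) (X l x) * ip (G x) (X l x) (X m x))
        = (\<Sum>l\<in>K. if l = m then ip (G x) (axis k 1) (X l x) else 0)"
      by (rule sum.cong) (use X(2) that in auto)
    also have "\<dots> = ip (G x) (axis k 1) (X m x)"
      using insert.hyps(1) that(2) by simp
    finally show ?thesis by simp
  qed
  have "ip (G x) (Y x) (Y x) = 1" if "x \<in> S" for x
    using pos[OF that] by (simp add: Y_def ip_linear_simps field_simps)
  moreover have "ip (G x) (Y x) (X m x) = 0" "ip (G x) (X m x) (Y x) = 0" if "x \<in> S" "m \<in> K" for x m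
    using orth[OF that] ip_sym[OF sym_G[OF that(1)]] by (simp_all add: Y_def ip_linear_simps)
  moreover have "Y x $ i = 0" if "x \<in> S" "i \<notin> insert k K" for x i
    using X(3) that by (simp add: Y_def u_def axis_nth_if)
  ultimately show ?case
    using X dY insert.hyps
    by (intro exI[of _ "X(k := Y)"]) auto
qed

text \<open>If the Gram-Schmidt frame is negatively oriented at \<open>x0\<close>, a reflection (the matrix \<open>D\<close>) corrects
  it; by continuity the orientation stays positive near \<open>x0\<close>.\<close>

lemma local_frame:
  assumes x0: "x0 \<in> S"
  obtains V E where "open V" "x0 \<in> V" "V \<subseteq> S"
    "\<And>x. x \<in> V \<Longrightarrow> frame (G x) (E x)" "\<And>x. x \<in> V \<Longrightarrow> det (E x) > 0"
    "\<And>x. x \<in> V \<Longrightarrow> E differentiable (at x)"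
proof -
  obtain X :: "4 \<Rightarrow> real^4 \<Rightarrow> real^4" where X: "\<And>k x. x \<in> S \<Longrightarrow> X k differentiable (at x)"
    "\<And>k l x. x \<in> S \<Longrightarrow> ip (G x) (X k x) (X l x) = (if k = l then 1 else 0)"
    using gram_schmidt[of UNIV] by (metis UNIV_I finite)
  define E0 where "E0 x = (\<chi> i k. X k x $ i)" for x
  have frame0: "frame (G x) (E0 x)" if "x \<in> S" for x
  proof -
    have cols: "E0 x *v ax k = X k x" for k
      by (simp add: E0_def ax_def vec_eq_iff matrix_vector_axis)
    have "(transpose (E0 x) ** G x ** E0 x) $ i $ j = ax i \<bullet> ((transpose (E0 x) ** G x ** E0 x) *v ax j)" for i j
      by (simp add: ax_def inner_axis' matrix_vector_axis)
    also have "\<dots> i j = ip (G x) (E0 x *v ax i) (E0 x *v ax j)" for i j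
      by (simp add: ip_def inner_matrix_vector matrix_vector_mul_assoc matrix_mul_assoc
          del: transpose_matrix_vector)
    finally show ?thesis by (simp add: frame_def vec_eq_iff mat_def cols X(2)[OF that])
  qed
  have diff0: "E0 differentiable (at x)" if "x \<in> S" for x
    unfolding E0_def[abs_def] by (intro differentiable_vec differentiable_nth X that)
  define D :: "real^4^4" where "D = (if det (E0 x0) > 0 then mat 1 else
     vector [vector [-1, 0, 0, 0], vector [0, 1, 0, 0], vector [0, 0, 1, 0], vector [0, 0, 0, 1]])"
  define E where "E x = E0 x ** D" for x
  have D: "transpose D ** D = mat 1"
    by (simp add: D_def vec_eq_iff forall_4 matrix_matrix_mult_def transpose_def mat_def sum_4)
  have frame: "frame (G x) (E x)" if "x \<in> S" for x
  proof -
    have "transpose (E x) ** G x ** E x = transpose D ** (transpose (E0 x) ** G x ** E0 x) ** D"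
      by (simp add: E_def matrix_transpose_mul matrix_mul_assoc)
    also have "\<dots> = mat 1" using frame0[OF that] D by (simp add: frame_def)
    finally show ?thesis by (simp add: frame_def)
  qed
  have diff: "E differentiable (at x)" if "x \<in> S" for x
    unfolding E_def[abs_def] by (intro differentiable_mat diff0 that) simp
  have "det (E x0) > 0"
    using frame_inv(5)[OF frame0[OF x0]] by (auto simp: E_def det_mul D_def) (simp add: det_4)
  moreover have "continuous_on S (\<lambda>x. det (E x))"
    by (auto intro!: continuous_at_imp_continuous_on differentiable_imp_continuous_within
        differentiable_det diff)
  then have "open (S \<inter> (\<lambda>x. det (E x)) -` {0<..})"
    using open_S continuous_on_open_vimage[OF open_S] by (metis Int_commute open_greaterThan)
  ultimately show ?thesis
    using frame diff x0 by (intro that[of "S \<inter> (\<lambda>x. det (E x)) -` {0<..}" E]) auto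
qed

lemma det_G: assumes "x \<in> S" shows "det (G x) \<noteq> 0"
proof -
  obtain V E where "x \<in> V" "\<And>x. x \<in> V \<Longrightarrow> frame (G x) (E x)" using local_frame[OF assms] by metis
  then show ?thesis using frame_metric(4) by (metis mult_zero_left zero_neq_one)
qed

end

subsection \<open>Christoffel matrices\<close>

text \<open>The connection matrix of the coordinate frame, \<open>\<nabla>\<^sub>vY = dY(v) + gam v Y\<close>. The curvature then is the
  matrix-valued form \<open>riem\<close>, given by the structure equation.\<close>

definition gam :: "(real^4 \<Rightarrow> real^4^4) \<Rightarrow> real^4 \<Rightarrow> real^4 \<Rightarrow> real^4^4" where
  "gam G x v = (\<chi> i k. \<Sum>j\<in>UNIV. christoffel G x i j k * v $ j)"

definition riem :: "(real^4 \<Rightarrow> real^4^4) \<Rightarrow> real^4 \<Rightarrow> real^4 \<Rightarrow> real^4 \<Rightarrow> real^4^4" where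
  "riem G x u v = dirD (\<lambda>y. gam G y v) x u - dirD (\<lambda>y. gam G y u) x v
     + gam G x u ** gam G x v - gam G x v ** gam G x u"

lemma gam_linear:
  "gam G x (u + v) = gam G x u + gam G x v" "gam G x (c *\<^sub>R u) = c *\<^sub>R gam G x u"
  by (simp_all add: gam_def vec_eq_iff algebra_simps sum.distrib sum_distrib_left)

lemma nabla_gam: "nabla G X Y x = dirD Y x (X x) + gam G x (X x) *v Y x"
  by (simp add: nabla_def gam_def vec_eq_iff matrix_vector_mult_def sum_distrib_right)
    (rule allI, rule sum.swap)

lemma nabla_const: "nabla G (\<lambda>_. v) (\<lambda>_. w) = (\<lambda>x. gam G x v *v w)"
  by (rule ext) (simp add: nabla_gam)

context chart_metric
begin

lemma dirD_G_symmetric: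
  assumes "x \<in> S"
  shows "dirD G x v $ i $ j = dirD G x v $ j $ i"
proof -
  have "transpose (dirD G x v) = dirD (\<lambda>y. transpose (G y)) x v"
    by (rule dirD_transpose[symmetric, OF G_differentiable[OF assms]])
  also have "\<dots> = dirD G x v" by (rule dirD_cong[OF open_S assms sym_G])
  finally show ?thesis by (metis (no_types, lifting) transpose_def vec_lambda_beta)
qed

lemma gam_symmetric:
  assumes "x \<in> S"
  shows "gam G x u *v v = gam G x v *v u"
proof -
  have "christoffel G x i j k = christoffel G x i k j" for i j k
    unfolding christoffel_def by (simp add: dirD_G_symmetric[OF assms, of _ j k] add.commute)
  then have "(gam G x u *v v) $ i = (\<Sum>j\<in>UNIV. \<Sum>k\<in>UNIV. christoffel G x i j k * v $ j * u $ k)" for i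
    by (simp add: gam_def matrix_vector_mult_def sum_distrib_right sum_distrib_left mult_ac)
  also have "\<dots> i = (gam G x v *v u) $ i" for i
    by (simp add: gam_def matrix_vector_mult_def sum_distrib_right sum_distrib_left mult_ac) (rule sum.swap)
  finally show ?thesis by (simp add: vec_eq_iff)
qed

text \<open>The Koszul formula with the free index lowered.\<close>

lemma G_christoffel:
  assumes "x \<in> S"
  shows "(\<Sum>i\<in>UNIV. G x $ l $ i * christoffel G x i j k)
    = 1/2 * (dirD G x (axis j 1) $ k $ l + dirD G x (axis k 1) $ j $ l - dirD G x (axis l 1) $ j $ k)"
proof -
  define L where "L l = 1/2 * (dirD G x (axis j 1) $ k $ l + dirD G x (axis k 1) $ j $ l - dirD G x (axis l 1) $ j $ k)" for l
  have "christoffel G x i j k = (matrix_inv (G x) *v (\<chi> l. L l)) $ i" for i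
    unfolding christoffel_def L_def by (simp add: matrix_vector_mult_def sum_distrib_left mult_ac)
  then have "(\<Sum>i\<in>UNIV. G x $ l $ i * christoffel G x i j k) = (G x *v (matrix_inv (G x) *v (\<chi> l. L l))) $ l"
    by (simp add: matrix_vector_mult_def)
  also have "\<dots> = L l"
    by (simp add: matrix_vector_mul_assoc matrix_inv_mul[OF det_G[OF assms]])
  finally show ?thesis by (simp add: L_def)
qed

text \<open>In the sum of \<open>G ** gam G x v\<close> and its transpose all derivatives of the metric cancel in pairs,
  except those in the direction \<open>v\<close>.\<close>

lemma metric_compatible:
  assumes "x \<in> S"
  shows "dirD G x v = transpose (gam G x v) ** G x + G x ** gam G x v"
proof -
  have Gg: "(G x ** gam G x v) $ l $ k = (\<Sum>j\<in>UNIV. v $ j * (1/2 * (dirD G x (axis j 1) $ k $ l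
      + dirD G x (axis k 1) $ j $ l - dirD G x (axis l 1) $ j $ k)))" for l k
  proof -
    have "(G x ** gam G x v) $ l $ k = (\<Sum>i\<in>UNIV. \<Sum>j\<in>UNIV. v $ j * (G x $ l $ i * christoffel G x i j k))"
      by (simp add: matrix_matrix_mult_def gam_def sum_distrib_left mult_ac)
    also have "\<dots> = (\<Sum>j\<in>UNIV. v $ j * (\<Sum>i\<in>UNIV. G x $ l $ i * christoffel G x i j k))"
      by (subst sum.swap) (simp add: sum_distrib_left)
    finally show ?thesis by (simp add: G_christoffel[OF assms])
  qed
  have "transpose (gam G x v) ** G x = transpose (G x ** gam G x v)"
    by (simp add: matrix_transpose_mul sym_G[OF assms])
  then have "(transpose (gam G x v) ** G x + G x ** gam G x v) $ l $ k
      = (\<Sum>j\<in>UNIV. v $ j * dirD G x (axis j 1) $ l $ k)" for l k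
    unfolding vector_add_component Gg
    by (simp add: transpose_def Gg sum.distrib[symmetric] dirD_G_symmetric[OF assms, of _ k l]
        dirD_G_symmetric[OF assms, of "axis l 1"] dirD_G_symmetric[OF assms, of "axis k 1"])
      (rule sum.cong[OF refl], simp add: field_simps)
  also have "\<dots> l k = dirD G x v $ l $ k" for l k
  proof -
    have "dirD G x v = dirD G x (\<Sum>j\<in>UNIV. v $ j *\<^sub>R axis j 1)"
      using basis_expansion[of v] by (simp add: scalar_mult_eq_scaleR)
    also have "\<dots> = (\<Sum>j\<in>UNIV. v $ j *\<^sub>R dirD G x (axis j 1))"
      by (simp add: dirD_sum[OF G_differentiable[OF assms]] dirD_scaleR[OF G_differentiable[OF assms]])
    finally show ?thesis by simp
  qed
  finally show ?thesis by (simp add: vec_eq_iff)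
qed

text \<open>The difference \<open>d\<close> of two such connections is symmetric in its two arguments, while
  \<open>g(d(u,v),w)\<close> is skew-symmetric in \<open>v\<close> and \<open>w\<close>; a trilinear form with both symmetries vanishes.\<close>

lemma levi_civita_unique:
  assumes x: "x \<in> S" and sym: "\<And>u v. T u *v v = T v *v u"
    and met: "\<And>v. dirD G x v = transpose (T v) ** G x + G x ** T v"
  shows "T v = gam G x v"
proof -
  define d where "d u v = T u *v v - gam G x u *v v" for u v
  have ds: "d u v = d v u" for u v using sym gam_symmetric[OF x] by (simp add: d_def)
  have sk: "ip (G x) (d u v) w + ip (G x) v (d u w) = 0" for u v w
  proof -
    have mm: "v \<bullet> (dirD G x u *v w) = ip (G x) (A *v v) w + ip (G x) v (A *v w)"
      if "dirD G x u = transpose A ** G x + G x ** A" for A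
      unfolding that by (simp add: ip_def inner_matrix_vector mat_vec_distribs inner_add_right
          matrix_vector_mul_assoc del: transpose_matrix_vector)
    show ?thesis
      using mm[OF met] mm[OF metric_compatible[OF x]] by (simp add: d_def ip_linear_simps)
  qed
  have sy: "ip (G x) v w = ip (G x) w v" for v w by (rule ip_sym[OF sym_G[OF x]])
  have "ip (G x) (d u v) w = 0" for u v w
    using sk[of u v w] sk[of v w u] sk[of w u v] ds sy by (smt (verit, best))
  then have "d u v = 0" for u v using pos_G[OF x, of "d u v"] by (metis ip_def less_irrefl)
  then show ?thesis by (intro matrix_eq_transform) (simp add: d_def)
qed

lemma smooth_gam: "smooth_on S (\<lambda>x. gam G x v)"
  unfolding gam_def christoffel_def
  by (intro smooth_on_vec smooth_on_sum smooth_on_mult smooth_on_const smooth_on_add smooth_on_minus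
      smooth_on_nth smooth_on_dirD smooth_on_matrix_inv smooth_G open_S det_G) auto

lemma gam_differentiable: "x \<in> S \<Longrightarrow> (\<lambda>y. gam G y v) differentiable (at x)"
  by (rule smooth_on_differentiable[OF smooth_gam])

lemma nabla_endo_gam:
  assumes "A differentiable (at x)"
  shows "nabla_endo G (\<lambda>_. v) A x = dirD A x v + gam G x v ** A x - A x ** gam G x v"
proof -
  have "nabla G (\<lambda>_. v) (\<lambda>y. A y *v w) x - A x *v nabla G (\<lambda>_. v) (\<lambda>_. w) x
      = (dirD A x v + gam G x v ** A x - A x ** gam G x v) *v w" for w
    by (simp add: nabla_gam dirD_matrix_vector_mul[OF assms] mat_vec_distribs
        matrix_vector_mul_assoc)
  then show ?thesis unfolding nabla_endo_def by simp
qed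

lemma riemann_riem:
  assumes "x \<in> S"
  shows "riemann G x u v w = riem G x u v *v w"
proof -
  have n2: "nabla2 G (\<lambda>_. u) (\<lambda>_. v) (\<lambda>_. w) x
      = dirD (\<lambda>y. gam G y v) x u *v w + gam G x u *v (gam G x v *v w) - gam G x (gam G x u *v v) *v w" for u v
    by (simp add: nabla2_def nabla_const nabla_gam dirD_matrix_vector_mul[OF gam_differentiable[OF assms]])
  show ?thesis
    by (simp add: riemann_def n2 gam_symmetric[OF assms, of u v] riem_def mat_vec_distribs
        matrix_vector_mul_assoc)
qed

lemma dirD_gam_linear:
  assumes "x \<in> S"
  shows "dirD (\<lambda>y. gam G y (v + w)) x u = dirD (\<lambda>y. gam G y v) x u + dirD (\<lambda>y. gam G y w) x u"
    "dirD (\<lambda>y. gam G y (c *\<^sub>R v)) x u = c *\<^sub>R dirD (\<lambda>y. gam G y v) x u"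
  unfolding gam_linear
  by (auto intro!: dirD_plus dirD_bounded_linear(1)[OF bounded_linear_scaleR_right] gam_differentiable assms)

lemma riem_linear:
  assumes "x \<in> S"
  shows "riem G x (u + u') v = riem G x u v + riem G x u' v"
    "riem G x (c *\<^sub>R u) v = c *\<^sub>R riem G x u v"
    "riem G x u (v + v') = riem G x u v + riem G x u v'"
    "riem G x u (c *\<^sub>R v) = c *\<^sub>R riem G x u v"
  using gam_differentiable[OF assms]
  by (simp_all add: riem_def dirD_gam_linear[OF assms, unfolded gam_linear] gam_linear mat_distribs dirD_add dirD_scaleR
      algebra_simps)

lemma riem_antisymmetric: "riem G x u v = - riem G x v u"
  by (simp add: riem_def)

text \<open>Vanishing torsion makes both \<open>gam G x v *v w\<close> and its derivatives symmetric in \<open>v\<close> and \<open>w\<close>; all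
  terms of the cyclic sum cancel in pairs.\<close>

lemma riem_bianchi:
  assumes "x \<in> S"
  shows "riem G x u v *v w + riem G x v w *v u + riem G x w u *v v = 0"
proof -
  have "dirD (\<lambda>y. gam G y v) x u *v w = dirD (\<lambda>y. gam G y w) x u *v v" for u v w
  proof -
    have "dirD (\<lambda>y. gam G y v *v w) x u = dirD (\<lambda>y. gam G y w *v v) x u"
      by (rule dirD_cong[OF open_S assms gam_symmetric])
    then show ?thesis by (simp add: dirD_matrix_vector_mul[OF gam_differentiable[OF assms]])
  qed
  note this[of u v w] this[of v w u] this[of w u v]
  then show ?thesis
    by (simp add: riem_def mat_vec_distribs matrix_vector_mul_assoc[symmetric]
        gam_symmetric[OF assms, of u v] gam_symmetric[OF assms, of v w] gam_symmetric[OF assms, of w u])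
qed

lemma smooth_riem: "smooth_on S (\<lambda>x. riem G x u v)"
  unfolding riem_def
  by (intro smooth_on_add smooth_on_minus smooth_on_dirD smooth_gam open_S
      smooth_on_bounded_bilinear[OF bilinear_mat])

text \<open>Differentiating the metric compatibility once more and antisymmetrizing.\<close>

lemma riem_skew:
  assumes x: "x \<in> S"
  shows "transpose (riem G x u v) ** G x + G x ** riem G x u v = 0"
proof -
  note g = gam_differentiable[OF x] and G = G_differentiable[OF x]
  have dd: "dirD (\<lambda>y. dirD G y v) x u =
      transpose (dirD (\<lambda>y. gam G y v) x u) ** G x + transpose (gam G x v) ** dirD G x u
      + (dirD G x u ** gam G x v + G x ** dirD (\<lambda>y. gam G y v) x u)" for u v
  proof -
    have "dirD (\<lambda>y. dirD G y v) x u
        = dirD (\<lambda>y. transpose (gam G y v) ** G y + G y ** gam G y v) x u"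
      by (rule dirD_cong[OF open_S x metric_compatible])
    then show ?thesis
      by (simp add: dirD_plus dirD_matrix_mul dirD_transpose g G differentiable_mat
          differentiable_transpose add_ac)
  qed
  have "dirD (\<lambda>y. dirD G y v) x u = dirD (\<lambda>y. dirD G y u) x v"
    by (rule dirD_commute[OF smooth_G open_S x])
  then show ?thesis
    unfolding dd metric_compatible[OF x]
    by (simp add: riem_def transpose_add transpose_diff matrix_transpose_mul mat_distribs
        matrix_mul_assoc algebra_simps)
qed

end

section \<open>Algebraic curvature tensors in dimension four\<close>

text \<open>Here \<open>r i j\<close> plays the role of the endomorphism \<open>R(e\<^sub>i,e\<^sub>j)\<close> in an orthonormal frame, so that
  \<open>r i j $ l $ k\<close> is \<open>g(R(e\<^sub>i,e\<^sub>j)e\<^sub>k,e\<^sub>l)\<close>. The functions \<open>ricci_of\<close>, \<open>scal_of\<close>, \<open>schouten_of\<close> and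
  \<open>weyl_of\<close> are the frame versions of the corresponding tensors.\<close>

definition algebraic_curvature :: "(4 \<Rightarrow> 4 \<Rightarrow> real^4^4) \<Rightarrow> bool" where
  "algebraic_curvature r \<longleftrightarrow> (\<forall>i j. r i j = - r j i) \<and> (\<forall>i j. transpose (r i j) = - r i j) \<and>
     (\<forall>i j k l. r i j $ l $ k + r j k $ l $ i + r k i $ l $ j = 0)"

definition ricci_of :: "(4 \<Rightarrow> 4 \<Rightarrow> real^4^4) \<Rightarrow> 4 \<Rightarrow> 4 \<Rightarrow> real" where
  "ricci_of r j k = (\<Sum>i\<in>UNIV. r i j $ i $ k)"

definition scal_of :: "(4 \<Rightarrow> 4 \<Rightarrow> real^4^4) \<Rightarrow> real" where
  "scal_of r = (\<Sum>k\<in>UNIV. ricci_of r k k)"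

definition schouten_of :: "(4 \<Rightarrow> 4 \<Rightarrow> real^4^4) \<Rightarrow> 4 \<Rightarrow> 4 \<Rightarrow> real" where
  "schouten_of r j k = 1/2 * (ricci_of r j k - (if j = k then scal_of r / 6 else 0))"

definition weyl_of :: "(4 \<Rightarrow> 4 \<Rightarrow> real^4^4) \<Rightarrow> 4 \<Rightarrow> 4 \<Rightarrow> real^4^4" where
  "weyl_of r i j = (\<chi> l k. r i j $ l $ k - ((if l = i then schouten_of r j k else 0) - (if l = j then schouten_of r i k else 0)
     + (if j = k then schouten_of r i l else 0) - (if i = k then schouten_of r j l else 0)))"

text \<open>\<open>w\<close> as an operator on endomorphisms, \<open>a \<mapsto> \<Sum> w(a e\<^sub>k, e\<^sub>k)\<close>.\<close>

definition curv_op :: "(4 \<Rightarrow> 4 \<Rightarrow> real^4^4) \<Rightarrow> real^4^4 \<Rightarrow> real^4^4" where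
  "curv_op w a = (\<Sum>k\<in>UNIV. \<Sum>l\<in>UNIV. a $ l $ k *\<^sub>R w l k)"

text \<open>The block of \<open>F\<close> from self-dual to self-dual endomorphisms, in the basis \<open>I\<close>, \<open>J\<close>, \<open>K\<close>.\<close>

definition sd_matrix :: "(real^4^4 \<Rightarrow> real^4^4) \<Rightarrow> real^3^3" where
  "sd_matrix F = (\<chi> a b. sdc (F (sdm (axis b 1))) $ a)"

abbreviation "weyl_sd r \<equiv> sd_matrix (curv_op (weyl_of r))"

text \<open>An alternating sum of the Bianchi identities obtained by omitting one of the four indices from the
  cyclic sum.\<close>

lemma algebraic_curvature_pair_symmetric:
  assumes "algebraic_curvature r"
  shows "r i j $ l $ k = r k l $ j $ i"
proof -
  have a1: "r a b $ c $ d = - r b a $ c $ d" for a b c d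
  proof -
    have "r a b = - r b a" using assms unfolding algebraic_curvature_def by blast
    then have "r a b $ c $ d = (- r b a) $ c $ d" by (rule arg_cong)
    then show ?thesis by simp
  qed
  have a2: "r a b $ c $ d = - r a b $ d $ c" for a b c d
  proof -
    have "transpose (r a b) = - r a b" using assms unfolding algebraic_curvature_def by blast
    then have "transpose (r a b) $ d $ c = (- r a b) $ d $ c" by (rule arg_cong)
    then show ?thesis by (simp add: transpose_def)
  qed
  have b: "r i j $ l $ k + r j k $ l $ i + r k i $ l $ j = 0" for i j k l
    using assms unfolding algebraic_curvature_def by blast
  have "r j k $ l $ i = r i l $ k $ j" for i j k l
    using b[of i j k l] b[of j k l i] b[of k l i j] b[of l i j k]
      a2[of j k i l] a2[of k l i j] a2[of j l k i] a1[of l j i k] a2[of l i j k] a2[of i j k l]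
      a1[of k i l j] a2[of i k j l] a1[of i l k j]
    by linarith
  then show ?thesis .
qed

text \<open>These rewrite rules express all components by twenty independent ones. Linear identities between
  curvature components thereby become identities between linear forms in independent unknowns.\<close>

lemma algebraic_curvature_normalize:
  assumes "algebraic_curvature r"
  shows "r i i = 0" "r 2 1 = - r 1 2" "r 3 1 = - r 1 3" "r 4 1 = - r 1 4" "r 3 2 = - r 2 3"
    "r 4 2 = - r 2 4" "r 4 3 = - r 3 4"
    "r i j $ k $ k = 0" "r i j $ 2 $ 1 = - r i j $ 1 $ 2" "r i j $ 3 $ 1 = - r i j $ 1 $ 3"
    "r i j $ 4 $ 1 = - r i j $ 1 $ 4" "r i j $ 3 $ 2 = - r i j $ 2 $ 3"
    "r i j $ 4 $ 2 = - r i j $ 2 $ 4" "r i j $ 4 $ 3 = - r i j $ 3 $ 4"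
    "r 1 3 $ 1 $ 2 = r 1 2 $ 1 $ 3" "r 1 4 $ 1 $ 2 = r 1 2 $ 1 $ 4" "r 2 3 $ 1 $ 2 = r 1 2 $ 2 $ 3"
    "r 2 4 $ 1 $ 2 = r 1 2 $ 2 $ 4" "r 3 4 $ 1 $ 2 = r 1 2 $ 3 $ 4"
    "r 1 4 $ 1 $ 3 = r 1 3 $ 1 $ 4" "r 2 3 $ 1 $ 3 = r 1 3 $ 2 $ 3"
    "r 2 4 $ 1 $ 3 = r 1 3 $ 2 $ 4" "r 3 4 $ 1 $ 3 = r 1 3 $ 3 $ 4"
    "r 2 3 $ 1 $ 4 = r 1 4 $ 2 $ 3" "r 2 4 $ 1 $ 4 = r 1 4 $ 2 $ 4" "r 3 4 $ 1 $ 4 = r 1 4 $ 3 $ 4"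
    "r 2 4 $ 2 $ 3 = r 2 3 $ 2 $ 4" "r 3 4 $ 2 $ 3 = r 2 3 $ 3 $ 4" "r 3 4 $ 2 $ 4 = r 2 4 $ 3 $ 4"
    "r 1 4 $ 2 $ 3 = r 1 3 $ 2 $ 4 - r 1 2 $ 3 $ 4"
proof -
  have a1: "r a b = - r b a" for a b
    using assms unfolding algebraic_curvature_def by blast
  have a2: "r a b $ c $ d = - r a b $ d $ c" for a b c d
  proof -
    have "transpose (r a b) = - r a b" using assms unfolding algebraic_curvature_def by blast
    then have "transpose (r a b) $ d $ c = (- r a b) $ d $ c" by (rule arg_cong)
    then show ?thesis by (simp add: transpose_def)
  qed
  show "r i i = 0"
  proof -
    have "r i i $ a $ b = (- r i i) $ a $ b" for a b by (rule arg_cong[OF a1])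
    then show ?thesis by (simp add: vec_eq_iff)
  qed
  show "r 2 1 = - r 1 2" "r 3 1 = - r 1 3" "r 4 1 = - r 1 4" "r 3 2 = - r 2 3"
    "r 4 2 = - r 2 4" "r 4 3 = - r 3 4" by (rule a1)+
  show "r i j $ k $ k = 0" using a2[of i j k k] by simp
  show "r i j $ 2 $ 1 = - r i j $ 1 $ 2" "r i j $ 3 $ 1 = - r i j $ 1 $ 3"
    "r i j $ 4 $ 1 = - r i j $ 1 $ 4" "r i j $ 3 $ 2 = - r i j $ 2 $ 3"
    "r i j $ 4 $ 2 = - r i j $ 2 $ 4" "r i j $ 4 $ 3 = - r i j $ 3 $ 4" by (rule a2)+
  have p: "r i j $ k $ l = r k l $ i $ j" for i j k l
    using algebraic_curvature_pair_symmetric[OF assms, of i j k l] a1[of l k] a2[of k l i j] by simp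
  show "r 1 3 $ 1 $ 2 = r 1 2 $ 1 $ 3" "r 1 4 $ 1 $ 2 = r 1 2 $ 1 $ 4" "r 2 3 $ 1 $ 2 = r 1 2 $ 2 $ 3"
    "r 2 4 $ 1 $ 2 = r 1 2 $ 2 $ 4" "r 3 4 $ 1 $ 2 = r 1 2 $ 3 $ 4"
    "r 1 4 $ 1 $ 3 = r 1 3 $ 1 $ 4" "r 2 3 $ 1 $ 3 = r 1 3 $ 2 $ 3"
    "r 2 4 $ 1 $ 3 = r 1 3 $ 2 $ 4" "r 3 4 $ 1 $ 3 = r 1 3 $ 3 $ 4"
    "r 2 3 $ 1 $ 4 = r 1 4 $ 2 $ 3" "r 2 4 $ 1 $ 4 = r 1 4 $ 2 $ 4" "r 3 4 $ 1 $ 4 = r 1 4 $ 3 $ 4"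
    "r 2 4 $ 2 $ 3 = r 2 3 $ 2 $ 4" "r 3 4 $ 2 $ 3 = r 2 3 $ 3 $ 4" "r 3 4 $ 2 $ 4 = r 2 4 $ 3 $ 4"
    by (rule p)+
  have "r 1 2 $ 4 $ 3 + r 2 3 $ 4 $ 1 + r 3 1 $ 4 $ 2 = 0" using assms unfolding algebraic_curvature_def by blast
  then show "r 1 4 $ 2 $ 3 = r 1 3 $ 2 $ 4 - r 1 2 $ 3 $ 4"
    using a1[of 3 1] a2[of 1 2 4 3] a2[of 2 3 4 1] a2[of 1 3 4 2] p[of 2 3 1 4] by simp
qed

lemma curv_op_linear:
  "curv_op w (a + b) = curv_op w a + curv_op w b" "curv_op w (c *\<^sub>R a) = c *\<^sub>R curv_op w a"
  by (simp_all add: curv_op_def scaleR_left_distrib sum.distrib scaleR_sum_right)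

lemma curv_op_symmetric:
  assumes "\<And>i j. w i j = - w j i"
  shows "curv_op w (a + transpose a) = 0"
proof -
  have "curv_op w (transpose a) = (\<Sum>l\<in>UNIV. \<Sum>k\<in>UNIV. a $ k $ l *\<^sub>R w l k)"
    unfolding curv_op_def by (subst sum.swap) (simp add: transpose_def)
  also have "\<dots> = - curv_op w a"
    unfolding curv_op_def by (subst (2) assms) (simp add: sum_negf)
  finally show ?thesis by (simp add: curv_op_linear)
qed

lemma weyl_of_antisymmetric: "algebraic_curvature r \<Longrightarrow> weyl_of r i j = - weyl_of r j i"
proof -
  assume "algebraic_curvature r"
  then have "r i j = - r j i" unfolding algebraic_curvature_def by blast
  then show ?thesis by (simp add: weyl_of_def vec_eq_iff)
qed

text \<open>The Weyl operator maps self-dual endomorphisms to self-dual ones: the part of the curvature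
  operator exchanging self-dual and anti-self-dual forms is the trace-free Ricci tensor, which the
  Schouten term removes.\<close>

lemma weyl_of_selfdual:
  assumes "algebraic_curvature r"
  shows "curv_op (weyl_of r) (sdm c) = sdm (weyl_sd r *v c)"
  by (simp add: curv_op_def sd_matrix_def weyl_of_def schouten_of_def scal_of_def ricci_of_def sum_4 sum_3 vec_eq_iff forall_4
      sdm_def sdc_def axis_nth_if matrix_vector_mult_def algebraic_curvature_normalize[OF assms])
    (simp add: field_simps)

lemma weyl_sd_symmetric:
  assumes "algebraic_curvature r"
  shows "transpose (weyl_sd r) = weyl_sd r"
  by (simp add: curv_op_def sd_matrix_def weyl_of_def schouten_of_def scal_of_def ricci_of_def sum_4 sum_3 vec_eq_iff forall_3
      sdm_def sdc_def axis_nth_if transpose_def algebraic_curvature_normalize[OF assms])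
    (simp add: field_simps)

text \<open>By the Bianchi identity the self-dual block of the curvature has trace \<open>s/2\<close>, where \<open>s\<close> is the
  scalar curvature, and the Schouten term subtracts \<open>s/6\<close> from each of the three diagonal entries.\<close>

lemma weyl_sd_tracefree:
  assumes "algebraic_curvature r"
  shows "trace (weyl_sd r) = 0"
  by (simp add: curv_op_def sd_matrix_def weyl_of_def schouten_of_def scal_of_def ricci_of_def sum_4 sum_3
      sdm_def sdc_def axis_nth_if trace_def algebraic_curvature_normalize[OF assms])
    (simp add: field_simps)

lemma weyl_sd_curvature:
  assumes "algebraic_curvature r"
  shows "weyl_sd r = sd_matrix (curv_op r) - (scal_of r / 6) *\<^sub>R mat 1"
  by (simp add: curv_op_def sd_matrix_def weyl_of_def schouten_of_def scal_of_def ricci_of_def sum_4 sum_3 vec_eq_iff forall_3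
      sdm_def sdc_def axis_nth_if mat_def algebraic_curvature_normalize[OF assms])
    (simp add: field_simps)

definition outer :: "real^3 \<Rightarrow> real^3 \<Rightarrow> real^3^3" where
  "outer u v = (\<chi> i j. u $ i * v $ j)"

abbreviation proj3 :: "real^3 \<Rightarrow> real^3^3" where
  "proj3 u \<equiv> outer u u"

text \<open>If the curvature commutes with a unit self-dual \<open>J\<close>, then the self-dual part of each of its
  values is a multiple of \<open>J\<close>; by pair symmetry the self-dual curvature operator is a multiple of
  the projection to \<open>J\<close>.\<close>

lemma weyl_sd_kaehler:
  assumes r: "algebraic_curvature r" and u: "u \<bullet> u = 1" and comm: "\<And>i j. r i j ** sdm u = sdm u ** r i j"
  obtains s where "weyl_sd r = s *\<^sub>R (3 *\<^sub>R proj3 u - mat 1)"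
proof -
  define \<rho> where "\<rho> = sd_matrix (curv_op r)"
  have uu: "u$1 * u$1 + u$2 * u$2 + u$3 * u$3 = 1" using u by (simp add: inner_vec_def sum_3)
  have par: "sdc (r i j) $ a * u $ b = sdc (r i j) $ b * u $ a" for i j a b
  proof -
    have e: "(r i j ** sdm u) $ p $ q = (sdm u ** r i j) $ p $ q" for p q by (simp add: comm)
    have "sdc (r i j) $ 1 * u $ 2 = sdc (r i j) $ 2 * u $ 1 \<and> sdc (r i j) $ 1 * u $ 3 = sdc (r i j) $ 3 * u $ 1
       \<and> sdc (r i j) $ 2 * u $ 3 = sdc (r i j) $ 3 * u $ 2"
      using e[of 1 2] e[of 1 3] e[of 1 4] e[of 2 3] e[of 2 4] e[of 3 4]
      by (simp add: matrix_matrix_mult_def sum_4 sdm_def sdc_def algebraic_curvature_normalize[OF r] field_simps)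
    then have "\<forall>a b. sdc (r i j) $ a * u $ b = sdc (r i j) $ b * u $ a"
      by (simp add: forall_3)
    then show ?thesis by blast
  qed
  have rho: "\<rho> $ a $ b = (\<Sum>k\<in>UNIV. \<Sum>l\<in>UNIV. sdm (axis b 1) $ l $ k * sdc (r l k) $ a)" for a b
    unfolding \<rho>_def sd_matrix_def curv_op_def
    by (simp add: linear_sum[OF bounded_linear.linear[OF bounded_linear_sdc]] sdc_linear)
  have rp: "\<rho> $ a $ b * u $ c = \<rho> $ c $ b * u $ a" for a b c
    unfolding rho by (simp add: sum_distrib_right mult.assoc par[of _ _ a c])
  have sy: "\<rho> $ a $ b = \<rho> $ b $ a" for a b
  proof -
    have "transpose \<rho> = \<rho>"
      using weyl_sd_symmetric[OF r] by (simp add: weyl_sd_curvature[OF r] transpose_diff transpose_scalar \<rho>_def)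
    then show ?thesis by (metis (no_types, lifting) transpose_def vec_lambda_beta)
  qed
  define l where "l = (\<Sum>a\<in>UNIV. \<Sum>b\<in>UNIV. u $ a * \<rho> $ a $ b * u $ b)"
  have "\<rho> $ a $ b = l * (u $ a * u $ b)" for a b
  proof -
    have "\<rho> $ a $ b = (\<Sum>c\<in>UNIV. \<rho> $ a $ b * u $ c * u $ c)"
      using uu by (simp add: sum_3 mult.assoc distrib_left[symmetric])
    also have "\<dots> = u $ a * (\<Sum>c\<in>UNIV. \<rho> $ b $ c * u $ c)"
      unfolding rp[of a b] by (simp add: sum_distrib_left mult_ac sy[of _ b])
    also have "(\<Sum>c\<in>UNIV. \<rho> $ b $ c * u $ c) = (\<Sum>c\<in>UNIV. \<Sum>d\<in>UNIV. (\<rho> $ b $ c * u $ d) * (u $ d * u $ c))"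
    proof (rule sum.cong[OF refl])
      fix c
      have "(\<Sum>d\<in>UNIV. (\<rho> $ b $ c * u $ d) * (u $ d * u $ c))
          = \<rho> $ b $ c * u $ c * (u$1 * u$1 + u$2 * u$2 + u$3 * u$3)"
        by (simp add: sum_3 algebra_simps)
      then show "\<rho> $ b $ c * u $ c = (\<Sum>d\<in>UNIV. (\<rho> $ b $ c * u $ d) * (u $ d * u $ c))"
        by (simp only: uu mult_1_right)
    qed
    also have "\<dots> = (\<Sum>c\<in>UNIV. \<Sum>d\<in>UNIV. u $ b * (u $ d * \<rho> $ d $ c * u $ c))"
      by (intro sum.cong refl, subst rp) (simp add: mult_ac)
    also have "\<dots> = u $ b * l"
      unfolding l_def by (subst sum.swap) (simp add: sum_distrib_left)
    finally show ?thesis by (simp add: mult_ac)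
  qed
  then have rl: "\<rho> = l *\<^sub>R proj3 u" by (simp add: vec_eq_iff outer_def)
  have "trace (weyl_sd r) = l * (u$1 * u$1 + u$2 * u$2 + u$3 * u$3) - scal_of r / 2"
    unfolding weyl_sd_curvature[OF r] \<rho>_def[symmetric] rl
    by (simp add: trace_def outer_def mat_def sum_3 algebra_simps)
  then have "scal_of r = 2 * l" using weyl_sd_tracefree[OF r] uu by simp
  then have "weyl_sd r = (l/3) *\<^sub>R (3 *\<^sub>R proj3 u - mat 1)"
    unfolding weyl_sd_curvature[OF r] \<rho>_def[symmetric] rl by (simp add: scaleR_diff_right)
  then show ?thesis by (rule that)
qed

section \<open>The self-dual Weyl operator in a frame\<close>

text \<open>The curvature endomorphisms \<open>R(X\<^sub>i,X\<^sub>j)\<close> of the frame \<open>E\<close>, as matrices in this frame.\<close>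

definition frame_riem :: "(real^4 \<Rightarrow> real^4^4) \<Rightarrow> real^4 \<Rightarrow> real^4^4 \<Rightarrow> 4 \<Rightarrow> 4 \<Rightarrow> real^4^4" where
  "frame_riem G x E i j = matrix_inv E ** riem G x (E *v ax i) (E *v ax j) ** E"

lemma ax_expand: "v = (\<Sum>i\<in>UNIV. v $ i *\<^sub>R ax i)"
  using basis_expansion[of v] by (simp add: scalar_mult_eq_scaleR ax_def)

lemma frame_vector': "frame h E \<Longrightarrow> matrix_inv E *v (E *v v) = v"
  by (simp add: frame_inv matrix_vector_mul_assoc)

lemma frame_expand: "E *v v = (\<Sum>i\<in>UNIV. v $ i *\<^sub>R (E *v ax i))"
  unfolding ax_def by (rule matrix_vector_axis_expand)

context chart_metric
begin

context
  fixes x :: "real^4" and E :: "real^4^4"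
  assumes x: "x \<in> S" and E: "frame (G x) E"
begin

abbreviation "r \<equiv> frame_riem G x E"

lemma riem_frame: "riem G x (E *v u) (E *v v) = in_frame E (\<Sum>i\<in>UNIV. \<Sum>j\<in>UNIV. (u $ i * v $ j) *\<^sub>R r i j)"
proof -
  have l1: "linear (\<lambda>u. riem G x u v)" and l2: "linear (\<lambda>v. riem G x u v)" for u v
    by (auto intro!: linearI simp: riem_linear[OF x])
  have "riem G x (E *v u) (E *v v) = (\<Sum>i\<in>UNIV. \<Sum>j\<in>UNIV. (u $ i * v $ j) *\<^sub>R riem G x (E *v ax i) (E *v ax j))"
    by (subst frame_expand[of E u], subst frame_expand[of E v])
      (simp add: linear_sum[OF l1] linear_sum[OF l2] riem_linear[OF x] scaleR_sum_right,
       subst sum.swap, simp add: mult.commute)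
  then show ?thesis
    by (simp add: in_frame_sum in_frame_linear frame_riem_def in_frame_inverse[OF E])
qed

lemma riem_frame_ax: "riem G x (E *v ax i) (E *v ax j) = in_frame E (r i j)"
  by (simp add: frame_riem_def in_frame_inverse[OF E])

lemma algebraic_curvature_frame: "algebraic_curvature r"
proof -
  have 1: "r i j = - r j i" for i j
    unfolding frame_riem_def by (subst riem_antisymmetric) (simp add: mat_distribs)
  have 2: "transpose (r i j) = - r i j" for i j
  proof -
    let ?R = "riem G x (E *v ax i) (E *v ax j)"
    have "transpose E ** (transpose ?R ** G x + G x ** ?R) ** E = 0"
      by (simp add: riem_skew[OF x] mat_distribs)
    then have "transpose E ** transpose ?R ** (G x ** E) + (transpose E ** G x) ** ?R ** E = 0"
      by (simp add: mat_distribs matrix_mul_assoc)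
    moreover have "G x ** E = transpose (matrix_inv E)"
      by (simp add: frame_inv_eq[OF E] matrix_transpose_mul frame_metric(3)[OF E])
    ultimately have "transpose E ** transpose ?R ** transpose (matrix_inv E) + matrix_inv E ** ?R ** E = 0"
      by (simp add: frame_inv_eq[OF E])
    then show ?thesis by (simp add: frame_riem_def matrix_transpose_mul matrix_mul_assoc eq_neg_iff_add_eq_0)
  qed
  have 3: "r i j $ l $ k + r j k $ l $ i + r k i $ l $ j = 0" for i j k l
  proof -
    have c: "r i j $ l $ k = (matrix_inv E *v (riem G x (E *v ax i) (E *v ax j) *v (E *v ax k))) $ l" for i j k l
      by (simp add: frame_riem_def matrix_vector_mul_assoc ax_def matrix_vector_axis matrix_mul_assoc)
    show ?thesis
      unfolding c vector_add_component[symmetric] mat_vec_distribs(2)[symmetric]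
      by (simp add: riem_bianchi[OF x])
  qed
  show ?thesis unfolding algebraic_curvature_def using 1 2 3 by blast
qed

lemma ricci_frame: "ricci G x (E *v v) (E *v w) = (\<Sum>j\<in>UNIV. \<Sum>k\<in>UNIV. v $ j * w $ k * ricci_of r j k)"
proof -
  let ?L = "\<lambda>u. riem G x u (E *v v) *v (E *v w)"
  have L: "linear ?L" by (auto intro!: linearI simp: riem_linear[OF x] mat_vec_distribs)
  have "ricci G x (E *v v) (E *v w) = trace (matrix ?L)"
    by (simp add: ricci_def riemann_riem[OF x])
  also have "\<dots> = trace (matrix_inv E ** (matrix ?L ** E))"
    by (subst trace_mul_sym) (simp add: matrix_mul_assoc[symmetric] frame_inv[OF E])
  also have "\<dots> = (\<Sum>i\<in>UNIV. (matrix_inv E *v ?L (E *v ax i)) $ i)"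
  proof -
    have "(matrix_inv E ** (matrix ?L ** E)) $ i $ i = (matrix_inv E *v (matrix ?L *v (E *v ax i))) $ i" for i
      by (simp add: matrix_vector_mul_assoc ax_def matrix_vector_axis matrix_mul_assoc)
    then show ?thesis using L by (simp add: trace_def matrix_works linear_matrix_vector_mul_eq)
  qed
  also have "\<dots> = (\<Sum>i\<in>UNIV. ((\<Sum>j\<in>UNIV. v $ j *\<^sub>R r i j) *v w) $ i)"
  proof -
    have "riem G x (E *v ax i) (E *v v) = in_frame E (\<Sum>j\<in>UNIV. v $ j *\<^sub>R r i j)" for i
      unfolding riem_frame
      using forall_4[of "\<lambda>i. in_frame E (\<Sum>ia\<in>UNIV. \<Sum>j\<in>UNIV. (ax i $ ia * v $ j) *\<^sub>R r ia j)
         = in_frame E (\<Sum>j\<in>UNIV. v $ j *\<^sub>R r i j)"]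
      by (simp add: ax_def axis_nth_if sum_4)
    then show ?thesis
      by (simp add: in_frame_mul(2)[OF E] frame_vector'[OF E])
  qed
  also have "\<dots> = (\<Sum>j\<in>UNIV. \<Sum>k\<in>UNIV. v $ j * w $ k * ricci_of r j k)"
    by (simp add: matrix_vector_mult_def ricci_of_def sum_4 algebra_simps)
  finally show ?thesis .
qed

lemma ricci_frame_eq:
  "ricci G x v w = (\<Sum>j\<in>UNIV. \<Sum>k\<in>UNIV. (matrix_inv E *v v) $ j * (matrix_inv E *v w) $ k * ricci_of r j k)"
  by (metis ricci_frame frame_vector[OF E])

lemma scal_frame: "scal G x = scal_of r"
proof -
  have "bilinear (ricci G x)"
    unfolding ricci_frame_eq[abs_def] bilinear_def
    by (auto intro!: linearI simp: mat_vec_distribs algebra_simps sum.distrib sum_distrib_left)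
  then have "scal G x = (\<Sum>k\<in>UNIV. ricci G x (E *v ax k) (E *v ax k))"
    unfolding scal_def by (rule sum_onframe[OF E])
  then show ?thesis
    by (simp add: ricci_frame scal_of_def ax_def axis_nth_if sum_4)
qed

lemma schouten_frame: "schouten G x (E *v v) (E *v w) = (\<Sum>j\<in>UNIV. \<Sum>k\<in>UNIV. v $ j * w $ k * schouten_of r j k)"
  unfolding schouten_def ricci_frame scal_frame ip_frame[OF E] schouten_of_def inner_vec_def
  by (simp add: sum_4 field_simps)

lemma sharp_schouten_frame:
  "sharp (G x) (schouten G x (E *v u)) = E *v (\<chi> l. \<Sum>i\<in>UNIV. u $ i * schouten_of r i l)"
proof -
  have "linear (schouten G x (E *v u))"
    unfolding schouten_def[abs_def] ricci_frame_eq ip_def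
    by (rule linearI) (simp_all add: mat_vec_distribs algebra_simps sum.distrib sum_distrib_left inner_add_right)
  then show ?thesis
    by (simp add: sharp_frame[OF E] schouten_frame ax_def axis_nth_if,
        intro arg_cong[where f = "\<lambda>v. E *v v"], simp add: vec_eq_iff forall_4 sum_4)
qed

lemma weyl_frame:
  "weyl G x (E *v u) (E *v v) (E *v w) = E *v ((\<Sum>i\<in>UNIV. \<Sum>j\<in>UNIV. (u $ i * v $ j) *\<^sub>R weyl_of r i j) *v w)"
proof -
  let ?P = "\<lambda>v w. \<Sum>j\<in>UNIV. \<Sum>k\<in>UNIV. v $ j * w $ k * schouten_of r j k"
  have "weyl G x (E *v u) (E *v v) (E *v w)
     = E *v ((\<Sum>i\<in>UNIV. \<Sum>j\<in>UNIV. (u $ i * v $ j) *\<^sub>R r i j) *v w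
         - (?P v w *\<^sub>R u - ?P u w *\<^sub>R v + (v \<bullet> w) *\<^sub>R (\<chi> l. \<Sum>i\<in>UNIV. u $ i * schouten_of r i l)
            - (u \<bullet> w) *\<^sub>R (\<chi> l. \<Sum>i\<in>UNIV. v $ i * schouten_of r i l)))"
    unfolding weyl_def riemann_riem[OF x] riem_frame in_frame_mul[OF E] schouten_frame sharp_schouten_frame
      ip_frame[OF E] by (simp add: mat_vec_distribs)
  also have "(\<Sum>i\<in>UNIV. \<Sum>j\<in>UNIV. (u $ i * v $ j) *\<^sub>R r i j) *v w
         - (?P v w *\<^sub>R u - ?P u w *\<^sub>R v + (v \<bullet> w) *\<^sub>R (\<chi> l. \<Sum>i\<in>UNIV. u $ i * schouten_of r i l)
            - (u \<bullet> w) *\<^sub>R (\<chi> l. \<Sum>i\<in>UNIV. v $ i * schouten_of r i l))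
      = (\<Sum>i\<in>UNIV. \<Sum>j\<in>UNIV. (u $ i * v $ j) *\<^sub>R weyl_of r i j) *v w"
  proof -
    show ?thesis
      by (simp add: vec_eq_iff forall_4 matrix_vector_mult_def sum_4 weyl_of_def inner_vec_def)
        (simp add: algebra_simps)
  qed
  finally show ?thesis .
qed

lemma weyl_matrix_frame:
  "matrix (weyl G x p q) = in_frame E (\<Sum>i\<in>UNIV. \<Sum>j\<in>UNIV. ((matrix_inv E *v p) $ i * (matrix_inv E *v q) $ j) *\<^sub>R weyl_of r i j)"
    (is "_ = in_frame E ?W")
proof -
  have "weyl G x p q z = in_frame E ?W *v z" for z
    using weyl_frame[of "matrix_inv E *v p" "matrix_inv E *v q" "matrix_inv E *v z"]
      in_frame_mul(2)[OF E, of ?W "matrix_inv E *v z"] by (simp add: frame_vector[OF E])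
  then have "weyl G x p q = (\<lambda>z. in_frame E ?W *v z)" by blast
  then show ?thesis by simp
qed

lemma weyl_op_frame: "weyl_op G x (in_frame E a) = in_frame E (curv_op (weyl_of r) a)"
proof -
  have "bilinear (\<lambda>p q. matrix (weyl G x (in_frame E a *v p) q))"
    unfolding weyl_matrix_frame bilinear_def
    by (auto intro!: linearI simp: mat_vec_distribs algebra_simps in_frame_linear[symmetric]
        sum.distrib scaleR_sum_right scaleR_left_distrib)
  then have "weyl_op G x (in_frame E a) = (\<Sum>k\<in>UNIV. matrix (weyl G x (in_frame E a *v (E *v ax k)) (E *v ax k)))"
    unfolding weyl_op_def by (rule sum_onframe[OF E])
  also have "\<dots> = (\<Sum>k\<in>UNIV. in_frame E (\<Sum>l\<in>UNIV. a $ l $ k *\<^sub>R weyl_of r l k))"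
    by (simp add: weyl_matrix_frame in_frame_mul(2)[OF E] frame_vector'[OF E])
     (simp add: ax_def matrix_vector_axis axis_nth_if sum_4)
  finally show ?thesis by (simp add: curv_op_def in_frame_sum)
qed

text \<open>The average of \<open>a\<close> and its Hodge dual is the sum of a symmetric endomorphism, which the Weyl
  operator kills, and the self-dual part of \<open>a\<close>.\<close>

lemma Wplus_frame:
  assumes "det E > 0"
  shows "Wplus G x (in_frame E a) = in_frame E (sdm (weyl_sd r *v sdc a))"
proof -
  have "Wplus G x (in_frame E a) = weyl_op G x (in_frame E ((1/2) *\<^sub>R (a + star a)))"
    by (simp add: Wplus_def hodge_in_frame[OF E assms] in_frame_linear)
  also have "\<dots> = in_frame E (curv_op (weyl_of r) ((1/4) *\<^sub>R (a + transpose a) + sdm (sdc a)))"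
    by (simp only: weyl_op_frame add_star)
  also have "\<dots> = in_frame E (sdm (weyl_sd r *v sdc a))"
    using curv_op_symmetric[of "weyl_of r" a, OF weyl_of_antisymmetric[OF algebraic_curvature_frame]]
    by (simp only: curv_op_linear(1)[of _ "(1/4) *\<^sub>R _"] curv_op_linear(2) scaleR_zero_right add_0_left
        weyl_of_selfdual[OF algebraic_curvature_frame])
  finally show ?thesis .
qed

end

end

section \<open>Covariant derivatives in a moving frame\<close>

text \<open>The change of frame of a connection: \<open>\<omega>\<close> is the matrix of the connection \<open>\<Gamma>\<close> in the frame
  \<open>E\<close>, and the covariant derivative of \<open>A = E a E\<^sup>-\<^sup>1\<close> is that of \<open>a\<close> with respect to \<open>\<omega>\<close>.\<close>

lemma gauge:
  fixes A E a :: "real^4 \<Rightarrow> real^4^4"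
  assumes V: "open V" "x \<in> V" and AE: "\<And>y. y \<in> V \<Longrightarrow> A y ** E y = E y ** a y"
    and diff: "A differentiable (at x)" "E differentiable (at x)" "a differentiable (at x)"
    and conn: "E x ** \<omega> = dirD E x v + \<Gamma> ** E x"
  shows "(dirD A x v + \<Gamma> ** A x - A x ** \<Gamma>) ** E x = E x ** (dirD a x v + \<omega> ** a x - a x ** \<omega>)"
proof -
  have "dirD (\<lambda>y. A y ** E y) x v = dirD (\<lambda>y. E y ** a y) x v"
    by (rule dirD_cong[OF V AE])
  then have 1: "A x ** dirD E x v + dirD A x v ** E x = E x ** dirD a x v + dirD E x v ** a x"
    by (simp add: dirD_matrix_mul diff)
  have 2: "A x ** E x = E x ** a x" using AE V(2) .
  have "E x ** (dirD a x v + \<omega> ** a x - a x ** \<omega>)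
     = E x ** dirD a x v + (E x ** \<omega>) ** a x - (E x ** a x) ** \<omega>"
    by (simp add: mat_distribs matrix_mul_assoc)
  also have "(E x ** a x) ** \<omega> = A x ** (E x ** \<omega>)"
    by (simp add: 2[symmetric] matrix_mul_assoc)
  also have "E x ** dirD a x v + (E x ** \<omega>) ** a x - A x ** (E x ** \<omega>)
     = (E x ** dirD a x v + dirD E x v ** a x) - A x ** dirD E x v + \<Gamma> ** (E x ** a x) - A x ** \<Gamma> ** E x"
    unfolding conn by (simp add: mat_distribs matrix_mul_assoc algebra_simps)
  also have "\<dots> = (dirD A x v + \<Gamma> ** A x - A x ** \<Gamma>) ** E x"
    unfolding 1[symmetric] 2[symmetric] by (simp add: mat_distribs matrix_mul_assoc algebra_simps)
  finally show ?thesis by simp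
qed

text \<open>The action of the Lie algebra of skew-symmetric 4-by-4 matrices on the self-dual ones by commutators,
  as an infinitesimal rotation of \<open>\<real>\<^sup>3\<close>. Only the self-dual part of the matrix acts.\<close>

definition sd_rotation :: "real^4^4 \<Rightarrow> real^3^3" where
  "sd_rotation \<omega> = (let c = sdc \<omega> in vector [
     vector [0, 2 * c$3, - 2 * c$2], vector [- 2 * c$3, 0, 2 * c$1], vector [2 * c$2, - 2 * c$1, 0]])"

lemma sd_rotation_linear: "sd_rotation (a + b) = sd_rotation a + sd_rotation b" "sd_rotation (c *\<^sub>R a) = c *\<^sub>R sd_rotation a"
  by (simp_all add: sd_rotation_def Let_def sdc_linear vec_eq_iff forall_3)

lemma sd_rotation_skew: "transpose (sd_rotation \<omega>) = - sd_rotation \<omega>"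
  by (simp add: sd_rotation_def Let_def transpose_def vec_eq_iff forall_3)

lemma skew_entries:
  fixes \<omega> :: "real^4^4"
  assumes "transpose \<omega> = - \<omega>"
  shows "\<omega> $ i $ i = 0" "\<omega> $ 2 $ 1 = - \<omega> $ 1 $ 2" "\<omega> $ 3 $ 1 = - \<omega> $ 1 $ 3"
    "\<omega> $ 4 $ 1 = - \<omega> $ 1 $ 4" "\<omega> $ 3 $ 2 = - \<omega> $ 2 $ 3"
    "\<omega> $ 4 $ 2 = - \<omega> $ 2 $ 4" "\<omega> $ 4 $ 3 = - \<omega> $ 3 $ 4"
proof -
  have a: "\<omega> $ d $ c = - \<omega> $ c $ d" for c d
  proof -
    have "transpose \<omega> $ c $ d = (- \<omega>) $ c $ d" by (simp only: assms)
    then show ?thesis by (simp add: transpose_def)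
  qed
  show "\<omega> $ i $ i = 0" using a[of i i] by simp
  show "\<omega> $ 2 $ 1 = - \<omega> $ 1 $ 2" "\<omega> $ 3 $ 1 = - \<omega> $ 1 $ 3"
    "\<omega> $ 4 $ 1 = - \<omega> $ 1 $ 4" "\<omega> $ 3 $ 2 = - \<omega> $ 2 $ 3"
    "\<omega> $ 4 $ 2 = - \<omega> $ 2 $ 4" "\<omega> $ 4 $ 3 = - \<omega> $ 3 $ 4" by (rule a)+
qed

lemma commutator_sdc:
  assumes "transpose \<omega> = - \<omega>"
  shows "sdc (\<omega> ** a - a ** \<omega>) = sd_rotation \<omega> *v sdc a"
  by (simp add: sdc_def sd_rotation_def Let_def vec_eq_iff forall_3 matrix_matrix_mult_def matrix_vector_mult_def
      sum_4 sum_3 skew_entries[OF assms])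
    (simp add: field_simps)

lemma commutator_sdm:
  assumes "transpose \<omega> = - \<omega>"
  shows "\<omega> ** sdm u - sdm u ** \<omega> = sdm (sd_rotation \<omega> *v u)"
  by (simp add: sdc_def sdm_def sd_rotation_def Let_def vec_eq_iff forall_4 matrix_matrix_mult_def
      matrix_vector_mult_def sum_4 sum_3 skew_entries[OF assms])
    (simp add: field_simps)

lemma differentiable_sdc: "f differentiable (at x) \<Longrightarrow> (\<lambda>x. sdc (f x)) differentiable (at x)"
  by (rule dirD_bounded_linear(2)[OF bounded_linear_sdc])

lemma differentiable_sdm: "f differentiable (at x) \<Longrightarrow> (\<lambda>x. sdm (f x)) differentiable (at x)"
  by (rule dirD_bounded_linear(2)[OF bounded_linear_sdm])

lemma differentiable_if_const:
  "(P \<Longrightarrow> f differentiable (at x)) \<Longrightarrow> (\<not> P \<Longrightarrow> g differentiable (at x))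
    \<Longrightarrow> (\<lambda>x. if P then f x else g x) differentiable (at x)"
  by (cases P) simp_all

lemma differentiable_weyl_sd:
  fixes r :: "real^4 \<Rightarrow> 4 \<Rightarrow> 4 \<Rightarrow> real^4^4"
  assumes "\<And>i j. (\<lambda>x. r x i j) differentiable (at x)"
  shows "(\<lambda>x. weyl_sd (r x)) differentiable (at x)"
  unfolding sd_matrix_def curv_op_def weyl_of_def schouten_of_def scal_of_def ricci_of_def
  by (intro differentiable_vec differentiable_nth differentiable_sdc differentiable_sum finite ballI
      differentiable_scaleR differentiable_const differentiable_diff differentiable_add differentiable_mult
      differentiable_if_const assms)
    (simp_all add: differentiable_nth differentiable_sum assms)

locale framed_chart = chart_metric S G for S G +
  fixes V :: "(real^4) set" and E :: "real^4 \<Rightarrow> real^4^4"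
  assumes open_V: "open V" and V_S: "V \<subseteq> S"
    and frame_E: "x \<in> V \<Longrightarrow> frame (G x) (E x)" and det_E: "x \<in> V \<Longrightarrow> det (E x) > 0"
    and diff_E: "x \<in> V \<Longrightarrow> E differentiable (at x)"
begin

text \<open>\<open>W\<^sub>+\<close>, the Levi-Civita connection, and (by \<open>nabla_Wplus_frame\<close>) the covariant derivative of \<open>W\<^sub>+\<close>
  in the frame \<open>E\<close>.\<close>

definition wmat :: "real^4 \<Rightarrow> real^3^3" where
  "wmat x = weyl_sd (frame_riem G x (E x))"

definition conn :: "real^4 \<Rightarrow> real^4 \<Rightarrow> real^4^4" where
  "conn x v = matrix_inv (E x) ** (dirD E x v + gam G x v ** E x)"

definition nabla_wmat :: "real^4 \<Rightarrow> real^4 \<Rightarrow> real^3^3" where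
  "nabla_wmat x v = dirD wmat x v + sd_rotation (conn x v) ** wmat x - wmat x ** sd_rotation (conn x v)"

lemma V_in_S: "x \<in> V \<Longrightarrow> x \<in> S" using V_S by blast

lemma diff_E_inv: assumes "x \<in> V" shows "(\<lambda>y. matrix_inv (E y)) differentiable (at x)"
proof -
  have "(\<lambda>y. transpose (E y) ** G y) differentiable (at x)"
    by (intro differentiable_mat differentiable_transpose diff_E G_differentiable V_in_S assms)
  then show ?thesis by (rule differentiable_transform[OF _ open_V assms frame_inv_eq[OF frame_E]])
qed

lemma diff_frame_riem:
  assumes "x \<in> V" shows "(\<lambda>y. frame_riem G y (E y) i j) differentiable (at x)"
proof -
  have l1: "linear (\<lambda>u. riem G y u v)" and l2: "linear (\<lambda>v. riem G y u v)" if "y \<in> V" for y u v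
    by (auto intro!: linearI simp: riem_linear[OF V_in_S[OF that]])
  have "riem G y p q = (\<Sum>k\<in>UNIV. \<Sum>l\<in>UNIV. p $ k *\<^sub>R q $ l *\<^sub>R riem G y (ax k) (ax l))"
    if "y \<in> V" for y p q
  proof -
    have "riem G y p q = riem G y (\<Sum>k\<in>UNIV. p $ k *\<^sub>R ax k) (\<Sum>l\<in>UNIV. q $ l *\<^sub>R ax l)"
      by (simp only: ax_expand[symmetric])
    also have "\<dots> = (\<Sum>k\<in>UNIV. \<Sum>l\<in>UNIV. p $ k *\<^sub>R q $ l *\<^sub>R riem G y (ax k) (ax l))"
      by (simp only: linear_sum[OF l1[OF that]] linear_sum[OF l2[OF that]] riem_linear[OF V_in_S[OF that]]
          scaleR_sum_right)
        (subst sum.swap, simp add: mult.commute)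
    finally show ?thesis .
  qed
  then have eq: "frame_riem G y (E y) i j = matrix_inv (E y) **
      (\<Sum>k\<in>UNIV. \<Sum>l\<in>UNIV. (E y *v ax i) $ k *\<^sub>R (E y *v ax j) $ l *\<^sub>R riem G y (ax k) (ax l)) ** E y"
    if "y \<in> V" for y using that by (simp add: frame_riem_def)
  have "(\<lambda>y. matrix_inv (E y) **
      (\<Sum>k\<in>UNIV. \<Sum>l\<in>UNIV. (E y *v ax i) $ k *\<^sub>R (E y *v ax j) $ l *\<^sub>R riem G y (ax k) (ax l)) ** E y)
      differentiable (at x)"
    by (intro differentiable_mat differentiable_sum differentiable_scaleR differentiable_nth finite
        differentiable_mat_vec differentiable_const diff_E diff_E_inv ballI assms
        smooth_on_differentiable[OF smooth_riem] V_in_S)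
  then show ?thesis by (rule differentiable_transform[OF _ open_V assms eq])
qed

lemma diff_wmat: "x \<in> V \<Longrightarrow> wmat differentiable (at x)"
  unfolding wmat_def[abs_def] by (intro differentiable_weyl_sd diff_frame_riem)

lemma wmat_symmetric: "x \<in> V \<Longrightarrow> transpose (wmat x) = wmat x"
  unfolding wmat_def by (intro weyl_sd_symmetric algebraic_curvature_frame V_in_S frame_E)

lemma wmat_tracefree: "x \<in> V \<Longrightarrow> trace (wmat x) = 0"
  unfolding wmat_def by (intro weyl_sd_tracefree algebraic_curvature_frame V_in_S frame_E)

lemma Wplus_wmat: "x \<in> V \<Longrightarrow> Wplus G x (in_frame (E x) a) = in_frame (E x) (sdm (wmat x *v sdc a))"
  unfolding wmat_def by (intro Wplus_frame V_in_S frame_E det_E)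

lemma conn_eq: "x \<in> V \<Longrightarrow> E x ** conn x v = dirD E x v + gam G x v ** E x"
  by (simp add: conn_def matrix_mul_assoc frame_inv[OF frame_E])

lemma conn_linear:
  assumes "x \<in> V"
  shows "conn x (u + v) = conn x u + conn x v" "conn x (c *\<^sub>R v) = c *\<^sub>R conn x v"
  using diff_E[OF assms]
  by (simp_all add: conn_def dirD_add dirD_scaleR gam_linear mat_distribs algebra_simps)

text \<open>The derivative of \<open>E\<^sup>T G E = 1\<close>, rewritten with the compatibility of connection and metric.\<close>

lemma conn_skew:
  assumes x: "x \<in> V"
  shows "transpose (conn x v) = - conn x v"
proof -
  note dE = diff_E[OF x] and dG = G_differentiable[OF V_in_S[OF x]]
  have "dirD (\<lambda>y. transpose (E y) ** G y ** E y) x v = dirD (\<lambda>y. mat 1) x v"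
    by (rule dirD_cong[OF open_V x]) (use frame_E in \<open>simp add: frame_def\<close>)
  then have "transpose (E x) ** G x ** dirD E x v
      + (transpose (E x) ** dirD G x v + transpose (dirD E x v) ** G x) ** E x = 0"
    by (simp add: dirD_matrix_mul dirD_transpose dE dG differentiable_mat differentiable_transpose)
  then have "transpose (E x) ** G x ** (dirD E x v + gam G x v ** E x)
      + transpose (transpose (E x) ** G x ** (dirD E x v + gam G x v ** E x)) = 0"
    unfolding metric_compatible[OF V_in_S[OF x]]
    by (simp add: transpose_add matrix_transpose_mul sym_G[OF V_in_S[OF x]] mat_distribs
        matrix_mul_assoc algebra_simps)
  then show ?thesis
    by (simp add: conn_def frame_inv_eq[OF frame_E[OF x]] eq_neg_iff_add_eq_0 add.commute)
qed

lemma nabla_wmat_linear: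
  assumes "x \<in> V"
  shows "nabla_wmat x (u + v) = nabla_wmat x u + nabla_wmat x v" "nabla_wmat x (c *\<^sub>R v) = c *\<^sub>R nabla_wmat x v"
  using diff_wmat[OF assms]
  by (simp_all add: nabla_wmat_def dirD_add dirD_scaleR conn_linear[OF assms] sd_rotation_linear mat_distribs algebra_simps)

text \<open>The instance of \<open>gauge\<close> for the Levi-Civita connection and the orthonormal frame.\<close>

lemma nabla_endo_frame:
  assumes x: "x \<in> V" and a: "a differentiable (at x)"
    and A: "\<And>y. y \<in> V \<Longrightarrow> A y = in_frame (E y) (a y)"
  shows "A differentiable (at x)"
    "nabla_endo G (\<lambda>_. v) A x = in_frame (E x) (dirD a x v + conn x v ** a x - a x ** conn x v)"
proof -
  have "(\<lambda>y. in_frame (E y) (a y)) differentiable (at x)"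
    unfolding in_frame_def by (intro differentiable_mat diff_E diff_E_inv a x)
  then show dA: "A differentiable (at x)"
    by (rule differentiable_transform[OF _ open_V x A])
  have AE: "A y ** E y = E y ** a y" if "y \<in> V" for y
    by (simp add: A[OF that] in_frame_def matrix_mul_assoc[symmetric] frame_inv[OF frame_E[OF that]])
  let ?N = "nabla_endo G (\<lambda>_. v) A x" and ?n = "dirD a x v + conn x v ** a x - a x ** conn x v"
  have "?N ** E x = E x ** ?n"
    unfolding nabla_endo_gam[OF dA]
    by (rule gauge[OF open_V x AE dA diff_E[OF x] a conn_eq[OF x]])
  then have "?N ** (E x ** matrix_inv (E x)) = in_frame (E x) ?n"
    by (simp add: in_frame_def matrix_mul_assoc)
  then show "?N = in_frame (E x) ?n" by (simp add: frame_inv[OF frame_E[OF x]])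
qed

lemma nabla_endo_selfdual:
  assumes x: "x \<in> V" and u: "u differentiable (at x)"
    and J: "\<And>y. y \<in> V \<Longrightarrow> J y = in_frame (E y) (sdm (u y))"
  shows "nabla_endo G (\<lambda>_. v) J x = in_frame (E x) (sdm (dirD u x v + sd_rotation (conn x v) *v u x))"
  using nabla_endo_frame(2)[OF x differentiable_sdm[OF u] J, of v]
  by (simp add: dirD_bounded_linear(1)[OF bounded_linear_sdm u] add_diff_eq[symmetric]
      commutator_sdm[OF conn_skew[OF x]] sdm_linear)

text \<open>The covariant derivative is evaluated on the field \<open>A\<close> with constant components in the coordinates,
  whose matrix \<open>b\<close> in the frame is not constant. By the Leibniz rule the derivatives of \<open>b\<close> cancel.\<close>

lemma nabla_Wplus_frame:
  assumes x: "x \<in> V"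
  shows "nabla_Wplus G x v (in_frame (E x) a) = in_frame (E x) (sdm (nabla_wmat x v *v sdc a))"
proof -
  define A where "A = in_frame (E x) a"
  define b where "b y = matrix_inv (E y) ** A ** E y" for y
  have Ab: "A = in_frame (E y) (b y)" if "y \<in> V" for y
    by (simp add: b_def in_frame_inverse[OF frame_E[OF that]])
  have bx: "b x = a" by (simp add: b_def A_def in_frame_inverse[OF frame_E[OF x]])
  have db: "b differentiable (at x)"
    unfolding b_def[abs_def] by (intro differentiable_mat diff_E diff_E_inv differentiable_const x)
  have W: "Wplus G y A = in_frame (E y) (sdm (wmat y *v sdc (b y)))" if "y \<in> V" for y
    by (subst Ab[OF that]) (rule Wplus_wmat[OF that])
  have dws: "(\<lambda>y. wmat y *v sdc (b y)) differentiable (at x)"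
    by (intro differentiable_mat_vec diff_wmat differentiable_sdc db x)
  have dd: "dirD (\<lambda>y. wmat y *v sdc (b y)) x v = wmat x *v sdc (dirD b x v) + dirD wmat x v *v sdc a"
    by (simp add: dirD_matrix_vector_mul[OF diff_wmat[OF x] differentiable_sdc[OF db]]
        dirD_bounded_linear(1)[OF bounded_linear_sdc db] bx)
  have "Wplus G x (nabla_endo G (\<lambda>_. v) (\<lambda>_. A) x)
      = in_frame (E x) (sdm (wmat x *v sdc (dirD b x v + conn x v ** a - a ** conn x v)))"
    by (simp add: nabla_endo_frame(2)[OF x db Ab] Wplus_wmat[OF x] bx)
  also have "sdc (dirD b x v + conn x v ** a - a ** conn x v) = sdc (dirD b x v) + sd_rotation (conn x v) *v sdc a"
    by (simp add: add_diff_eq[symmetric] sdc_linear(1) commutator_sdc[OF conn_skew[OF x]])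
  finally have 1: "Wplus G x (nabla_endo G (\<lambda>_. v) (\<lambda>_. A) x)
      = in_frame (E x) (sdm (wmat x *v (sdc (dirD b x v) + sd_rotation (conn x v) *v sdc a)))" .
  have 2: "nabla_endo G (\<lambda>_. v) (\<lambda>y. Wplus G y A) x = in_frame (E x)
      (sdm (dirD (\<lambda>y. wmat y *v sdc (b y)) x v + sd_rotation (conn x v) *v (wmat x *v sdc (b x))))"
    by (rule nabla_endo_selfdual[OF x dws W])
  show ?thesis
    unfolding nabla_Wplus_def A_def[symmetric] 1 2 dd
    by (simp add: in_frame_linear(2)[symmetric] sdm_linear(2)[symmetric] bx nabla_wmat_def
        mat_vec_distribs matrix_vector_mul_assoc algebra_simps)
qed

lemma det_Wplus_frame: "x \<in> V \<Longrightarrow> det_Wplus G x = det (wmat x)"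
  unfolding det_Wplus_def by (rule on_selfdual[OF frame_E det_E]) (simp_all add: Wplus_wmat)

lemma norm_Wplus_frame: "x \<in> V \<Longrightarrow> norm_Wplus G x = sqrt (trace (wmat x ** wmat x))"
  unfolding norm_Wplus_def
  by (subst on_selfdual(2)[OF frame_E det_E, of x _ "wmat x ** wmat x"])
    (simp_all add: Wplus_wmat matrix_vector_mul_assoc)

lemma norm_sq_nabla_Wplus_frame:
  assumes x: "x \<in> V"
  shows "norm_sq_nabla_Wplus G x = (\<Sum>k\<in>UNIV. trace (nabla_wmat x (E x *v ax k) ** nabla_wmat x (E x *v ax k)))"
proof -
  have t: "trace_on (selfdual (G x)) (nabla_Wplus G x p \<circ> nabla_Wplus G x q) = trace (nabla_wmat x p ** nabla_wmat x q)" for p q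
    by (rule on_selfdual(2)[OF frame_E[OF x] det_E[OF x]])
      (simp add: nabla_Wplus_frame[OF x] matrix_vector_mul_assoc)
  have "bilinear (\<lambda>p q. trace (nabla_wmat x p ** nabla_wmat x q))"
    unfolding bilinear_def
    by (auto intro!: linearI simp: nabla_wmat_linear[OF x] mat_distribs trace_add)
      (simp_all add: trace_def sum_distrib_left)
  then show ?thesis
    unfolding norm_sq_nabla_Wplus_def t by (rule sum_onframe[OF frame_E[OF x]])
qed

lemma norm_sq_grad_frame:
  assumes x: "x \<in> V" and f: "f differentiable (at x)"
  shows "ip (G x) (grad G f x) (grad G f x) = (\<Sum>k\<in>UNIV. (dirD f x (E x *v ax k))\<^sup>2)"
    "grad G f x = E x *v (\<chi> k. dirD f x (E x *v ax k))"
proof -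
  show g: "grad G f x = E x *v (\<chi> k. dirD f x (E x *v ax k))"
    unfolding grad_def by (rule sharp_frame[OF frame_E[OF x] linear_frechet_derivative[OF f]])
  show "ip (G x) (grad G f x) (grad G f x) = (\<Sum>k\<in>UNIV. (dirD f x (E x *v ax k))\<^sup>2)"
    unfolding g ip_frame[OF frame_E[OF x]] by (simp add: inner_vec_def power2_eq_square)
qed

text \<open>The self-dual components of \<open>g(w) \<otimes> v - g(v) \<otimes> w\<close>, which occurs in \<open>\<delta>W\<^sub>+\<close> and in the contraction
  of \<open>W\<^sub>+\<close> with a vector.\<close>

lemma sdc_wedge:
  "sdc ((\<chi> i j. v $ i * w $ j) - (\<chi> i j. w $ i * v $ j)) = (\<chi> b. (1/2) * (v \<bullet> (sdm (axis b 1) *v w)))"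
  by (simp add: sdc_def sdm_def vec_eq_iff forall_3 axis_nth_if inner_vec_def sum_4 matrix_vector_mult_def)

text \<open>The factor \<open>1/4\<close> is the product of the \<open>1/2\<close> in the definition of
  \<open>\<delta>W\<^sub>+\<close> and the \<open>1/2\<close> in the previous lemma.\<close>

lemma delta_Wplus_frame:
  assumes x: "x \<in> V"
  shows "delta_Wplus G x (E x *v v) = in_frame (E x) (sdm
    ((1/4) *\<^sub>R (\<Sum>k\<in>UNIV. nabla_wmat x (E x *v ax k) *v (\<chi> b. v \<bullet> (sdm (axis b 1) *v ax k)))))"
proof -
  let ?w = "E x *v v"
  let ?B = "\<lambda>p q. nabla_Wplus G x p (tens (G x) q ?w - tens (G x) ?w q)"
  define D where "D q = (\<chi> i j. v $ i * q $ j) - (\<chi> i j. q $ i * v $ j)" for q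
  have D: "D (p + q) = D p + D q" "D (c *\<^sub>R q) = c *\<^sub>R D q" for p q c
    by (simp_all add: D_def vec_eq_iff algebra_simps)
  have B: "?B p (E x *v q) = in_frame (E x) (sdm (nabla_wmat x p *v sdc (D q)))" for p q
    by (simp add: tens_in_frame[OF frame_E[OF x]] in_frame_linear(2)[symmetric] nabla_Wplus_frame[OF x] D_def)
  have "?B p q = in_frame (E x) (sdm (nabla_wmat x p *v sdc (D (matrix_inv (E x) *v q))))" for p q
    using B[of p "matrix_inv (E x) *v q"] by (simp add: frame_vector[OF frame_E[OF x]])
  then have "bilinear ?B"
    unfolding bilinear_def
    by (auto intro!: linearI simp: nabla_wmat_linear[OF x] mat_vec_distribs sdc_linear sdm_linear D in_frame_linear)
  then have "(\<Sum>k\<in>UNIV. ?B (onframe (G x) k) (onframe (G x) k)) = (\<Sum>k\<in>UNIV. ?B (E x *v ax k) (E x *v ax k))"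
    by (rule sum_onframe[OF frame_E[OF x]])
  then have "delta_Wplus G x ?w
      = (1/2) *\<^sub>R (\<Sum>k\<in>UNIV. in_frame (E x) (sdm (nabla_wmat x (E x *v ax k) *v sdc (D (ax k)))))"
    unfolding delta_Wplus_def B by simp
  also have "\<dots> = in_frame (E x) (sdm ((1/2) *\<^sub>R (\<Sum>k\<in>UNIV. nabla_wmat x (E x *v ax k) *v sdc (D (ax k)))))"
    by (simp add: in_frame_sum[symmetric] linear_sum[OF bounded_linear.linear[OF bounded_linear_sdm], symmetric]
        sdm_linear in_frame_linear)
  finally have "delta_Wplus G x ?w
      = in_frame (E x) (sdm ((1/2) *\<^sub>R (\<Sum>k\<in>UNIV. nabla_wmat x (E x *v ax k) *v sdc (D (ax k)))))" .
  moreover have "sdc (D q) = (1/2) *\<^sub>R (\<chi> b. v \<bullet> (sdm (axis b 1) *v q))" for q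
    unfolding D_def sdc_wedge by (simp add: vec_eq_iff)
  ultimately show ?thesis
    by (simp add: mat_vec_distribs scaleR_sum_right[symmetric])
qed

lemma Wplus2_frame:
  assumes x: "x \<in> V"
  shows "Wplus2 G x (E x *v c) (E x *v v) = in_frame (E x) (sdm
    (- ((1/4) *\<^sub>R (\<Sum>k\<in>UNIV. c $ k *\<^sub>R (wmat x *v (\<chi> b. v \<bullet> (sdm (axis b 1) *v ax k)))))))"
proof -
  have "Wplus2 G x (E x *v c) (E x *v v)
     = in_frame (E x) (sdm ((1/2) *\<^sub>R (wmat x *v sdc ((\<chi> i j. c $ i * v $ j) - (\<chi> i j. v $ i * c $ j)))))"
    by (simp add: Wplus2_def tens_in_frame[OF frame_E[OF x]] in_frame_linear(2)[symmetric] Wplus_wmat[OF x]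
        in_frame_linear(4) sdm_linear)
  also have "sdc ((\<chi> i j. c $ i * v $ j) - (\<chi> i j. v $ i * c $ j))
      = - ((1/2) *\<^sub>R (\<Sum>k\<in>UNIV. c $ k *\<^sub>R (\<chi> b. v \<bullet> (sdm (axis b 1) *v ax k))))"
    unfolding sdc_wedge
    by (simp add: vec_eq_iff forall_3 sum_4 inner_vec_def matrix_vector_mult_def sdm_def ax_def axis_nth_if)
      (simp add: field_simps)
  finally show ?thesis
    by (simp add: mat_vec_distribs linear_sum[OF matrix_vector_mul_linear] linear_cmul[OF matrix_vector_mul_linear])
qed

end

section \<open>Trace-free symmetric matrices with a double eigenvalue\<close>

lemma outer_linear:
  "outer (a + b) c = outer a c + outer b c" "outer c (a + b) = outer c a + outer c b"
  "outer (a - b) c = outer a c - outer b c" "outer c (a - b) = outer c a - outer c b"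
  "outer (k *\<^sub>R a) c = k *\<^sub>R outer a c" "outer c (k *\<^sub>R a) = k *\<^sub>R outer c a"
  "outer (- a) c = - outer a c" "outer c (- a) = - outer c a" "outer 0 c = 0" "outer c 0 = 0"
  by (simp_all add: outer_def vec_eq_iff algebra_simps)

lemma bounded_bilinear_outer: "bounded_bilinear outer"
  unfolding bilinear_conv_bounded_bilinear[symmetric] bilinear_def
  by (auto intro!: linearI simp: outer_linear)

lemma outer_mul:
  "A ** outer a b = outer (A *v a) b" "outer a b ** A = outer a (transpose A *v b)"
  "outer a b ** outer c d = (b \<bullet> c) *\<^sub>R outer a d" "outer a b *v c = (b \<bullet> c) *\<^sub>R a"
  "trace (outer a b) = a \<bullet> b" "transpose (outer a b) = outer b a"
  by (simp_all add: outer_def vec_eq_iff forall_3 matrix_matrix_mult_def matrix_vector_mult_def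
      transpose_def inner_vec_def trace_def sum_3 del: transpose_matrix_vector)
    (simp_all add: algebra_simps)

lemma trace_linear:
  "trace (A + B) = trace A + trace B" "trace (A - B) = trace A - trace B" "trace (- A) = - trace A"
  "trace (c *\<^sub>R A) = c * trace A" "trace (0 :: real^3^3) = 0" "trace (mat 1 :: real^3^3) = 3"
  for A B :: "real^3^3"
  by (simp_all add: trace_def sum_3 mat_def algebra_simps)

lemma trace_square:
  fixes A :: "real^3^3"
  assumes "transpose A = A"
  shows "trace (A ** A) = (\<Sum>i\<in>UNIV. \<Sum>j\<in>UNIV. (A $ i $ j)\<^sup>2)"
proof -
  have "A $ j $ i = A $ i $ j" for i j
    by (metis (no_types, lifting) assms transpose_def vec_lambda_beta)
  then show ?thesis by (simp add: trace_def matrix_matrix_mult_def power2_eq_square)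
qed

lemma trace_square_nonneg: "transpose A = A \<Longrightarrow> trace (A ** A) \<ge> (0::real)" for A :: "real^3^3"
  by (simp add: trace_square sum_nonneg)

lemma trace_square_eq_0: "transpose A = A \<Longrightarrow> trace (A ** A) = (0::real) \<longleftrightarrow> A = 0" for A :: "real^3^3"
  by (simp add: trace_square sum_nonneg_eq_0_iff sum_nonneg vec_eq_iff)

lemma cayley_hamilton_tracefree:
  fixes m :: "real^3^3"
  assumes "trace m = 0"
  shows "m ** m ** m = (trace (m ** m) / 2) *\<^sub>R m + det m *\<^sub>R mat 1"
proof -
  have "m $ 3 $ 3 = - m $ 1 $ 1 - m $ 2 $ 2" using assms by (simp add: trace_def sum_3)
  then show ?thesis
    by (simp add: vec_eq_iff forall_3 matrix_matrix_mult_def sum_3 trace_def det_3 mat_def)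
      (simp add: field_simps)
qed

text \<open>If \<open>2s, -s, -s\<close> are the eigenvalues then \<open>(m - 2s)(m + s)\<^sup>2 = 0\<close> by Cayley-Hamilton;
  the symmetric matrix \<open>(m - 2s)(m + s)\<close> has square zero and therefore vanishes, so that
  \<open>(m + s)/3s\<close> is a projection of rank one.\<close>

lemma double_eigenvalue:
  fixes m :: "real^3^3"
  assumes sym: "transpose m = m" and tr: "trace m = 0" and nz: "m \<noteq> 0"
    and det: "(det m)\<^sup>2 = 1/54 * (trace (m ** m))^3"
  defines "s \<equiv> 3 * det m / trace (m ** m)"
  defines "q \<equiv> (1/(3 * s)) *\<^sub>R (m + s *\<^sub>R mat 1)"
  shows "s \<noteq> 0" "transpose q = q" "q ** q = q" "trace q = 1" "m = s *\<^sub>R (3 *\<^sub>R q - mat 1)"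
proof -
  define t where "t = trace (m ** m)"
  have t: "t > 0" using trace_square_nonneg[OF sym] trace_square_eq_0[OF sym] nz by (simp add: t_def less_le)
  have "s * t = 3 * det m" using t by (simp add: s_def t_def)
  then have "(s * t)\<^sup>2 = (3 * det m)\<^sup>2" by simp
  then have "s\<^sup>2 * t\<^sup>2 = 9 * (det m)\<^sup>2" by (simp add: power_mult_distrib)
  then have "s\<^sup>2 * t\<^sup>2 = t\<^sup>2 * (t / 6)" using det by (simp add: t_def[symmetric] power2_eq_square power3_eq_cube)
  then have ts: "t = 6 * s\<^sup>2" using t by simp
  then show s: "s \<noteq> 0" using t by auto
  have ds: "det m = 2 * s^3" using \<open>s * t = 3 * det m\<close> ts by (simp add: power2_eq_square power3_eq_cube)
  have ch: "m ** m ** m = (3 * s\<^sup>2) *\<^sub>R m + (2 * s^3) *\<^sub>R mat 1"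
    using cayley_hamilton_tracefree[OF tr] ts ds by (simp add: t_def[symmetric])
  define Y where "Y = m ** m - s *\<^sub>R m - (2 * s\<^sup>2) *\<^sub>R mat 1"
  have "transpose Y = Y" by (simp add: Y_def transpose_diff transpose_scalar matrix_transpose_mul sym)
  moreover have "Y ** Y = 0"
  proof -
    have "Y ** Y = m ** m ** m ** m - (2 * s) *\<^sub>R (m ** m ** m) - (3 * s\<^sup>2) *\<^sub>R (m ** m) + (4 * s^3) *\<^sub>R m
        + (4 * s^4) *\<^sub>R mat 1"
      unfolding Y_def
      by (simp add: mat_distribs matrix_mul_assoc scaleR_diff_right scaleR_add_right vec_eq_iff
          power2_eq_square power3_eq_cube power4_eq_xxxx algebra_simps)
    also have "m ** m ** m ** m = (3 * s\<^sup>2) *\<^sub>R (m ** m) + (2 * s^3) *\<^sub>R m"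
      by (simp add: ch mat_distribs)
    finally show ?thesis
      unfolding ch by (simp add: vec_eq_iff power2_eq_square power3_eq_cube power4_eq_xxxx algebra_simps)
  qed
  ultimately have "Y = 0" using trace_square_eq_0[of Y] by (simp add: trace_linear)
  then have mm: "m ** m = s *\<^sub>R m + (2 * s\<^sup>2) *\<^sub>R mat 1" by (simp add: Y_def algebra_simps)
  show "transpose q = q" by (simp add: q_def transpose_add transpose_scalar sym)
  show "q ** q = q"
    using s by (simp add: q_def mat_distribs mm vec_eq_iff field_simps power2_eq_square)
  show "trace q = 1" using s by (simp add: q_def trace_linear tr)
  show "m = s *\<^sub>R (3 *\<^sub>R q - mat 1)" using s by (simp add: q_def vec_eq_iff field_simps)
qed

text \<open>The matrix \<open>p = q - u\<otimes>u\<close> is again a symmetric projection, and its trace, which is the sum of the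
  squares of its entries, is zero.\<close>

lemma rank_one_projection:
  fixes q :: "real^3^3"
  assumes q: "transpose q = q" "q ** q = q" "trace q = 1" and e: "q *v e \<noteq> 0"
  defines "u \<equiv> inverse (norm (q *v e)) *\<^sub>R (q *v e)"
  shows "q = proj3 u" "u \<bullet> u = 1"
proof -
  show uu: "u \<bullet> u = 1" using e by (simp add: u_def dot_square_norm power2_eq_square)
  have qu: "q *v u = u"
    by (simp add: u_def mat_vec_distribs matrix_vector_mul_assoc q)
  define p where "p = q - proj3 u"
  have "transpose p = p" by (simp add: p_def transpose_diff q outer_mul)
  moreover have "p ** p = p"
    by (simp add: p_def mat_distribs mat_vec_distribs outer_mul q qu uu outer_linear
        del: transpose_matrix_vector)
  moreover have "trace p = 0" by (simp add: p_def trace_linear outer_mul q uu)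
  ultimately have "p = 0" using trace_square_eq_0[of p] by simp
  then show "q = proj3 u" by (simp add: p_def)
qed

lemma double_eigenvalue_invariants:
  fixes u :: "real^3" and s :: real
  assumes "u \<bullet> u = 1"
  defines "m \<equiv> s *\<^sub>R (3 *\<^sub>R proj3 u - mat 1)"
  shows "det m = 2 * s^3" "trace (m ** m) = 6 * s\<^sup>2"
proof -
  have "det m = s^3 * (3 * (u \<bullet> u) - 1)"
    by (simp add: m_def det_3 outer_def mat_def inner_vec_def sum_3 power3_eq_cube algebra_simps)
  then show "det m = 2 * s^3" by (simp add: assms)
  show "trace (m ** m) = 6 * s\<^sup>2"
    by (simp add: m_def mat_distribs mat_vec_distribs outer_mul trace_linear assms
        power2_eq_square algebra_simps)
qed

section \<open>The three conditions in a moving frame\<close>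

lemma dirD_sqrt:
  fixes f :: "'a::real_normed_vector \<Rightarrow> real"
  assumes f: "f differentiable (at x)" "f x > 0"
  shows "dirD (\<lambda>y. sqrt (f y)) x v = dirD f x v / (2 * sqrt (f x))"
proof -
  have d: "(sqrt has_derivative (\<lambda>w. inverse (sqrt (f x)) / 2 * w)) (at (f x))"
    by (rule DERIV_real_sqrt[OF f(2), unfolded has_field_derivative_def])
  then have "dirD (\<lambda>y. sqrt (f y)) x v = dirD sqrt (f x) (dirD f x v)"
    by (intro dirD_compose(1)[OF f(1)]) (auto simp: differentiable_def)
  then show ?thesis using f(2) by (simp add: dirD_eq[OF d] divide_simps mult.commute)
qed

lemma dirD_ln:
  fixes f :: "'a::real_normed_vector \<Rightarrow> real"
  assumes f: "f differentiable (at x)" "f x > 0"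
  shows "dirD (\<lambda>y. ln (f y)) x v = dirD f x v / f x" "(\<lambda>y. ln (f y)) differentiable (at x)"
proof -
  have d: "(ln has_derivative (\<lambda>w. inverse (f x) * w)) (at (f x))"
    using DERIV_ln[OF f(2)] by (simp add: has_field_derivative_def)
  then have dd: "ln differentiable (at (f x))" by (auto simp: differentiable_def)
  have "dirD (\<lambda>y. ln (f y)) x v = dirD ln (f x) (dirD f x v)"
    by (rule dirD_compose(1)[OF f(1) dd])
  then show "dirD (\<lambda>y. ln (f y)) x v = dirD f x v / f x" by (simp add: dirD_eq[OF d] divide_simps)
  show "(\<lambda>y. ln (f y)) differentiable (at x)" by (rule dirD_compose(2)[OF f(1) dd])
qed

lemma inner_sdm_axis: "c \<bullet> (\<chi> b. w \<bullet> (sdm (axis b 1) *v p)) = w \<bullet> (sdm c *v p)"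
  by (simp add: inner_vec_def sum_3 sum_4 matrix_vector_mult_def sdm_def axis_nth_if algebra_simps)

lemma sdm_orthogonal: "(sdm u *v v) \<bullet> (sdm u *v w) = (u \<bullet> u) * (v \<bullet> w)"
  by (simp add: inner_matrix_vector transpose_sdm mat_vec_distribs matrix_vector_mul_assoc
      mat_distribs sdm_square del: transpose_matrix_vector)

definition condition_ii :: "(real^4 \<Rightarrow> real^4^4) \<Rightarrow> real^4 \<Rightarrow> bool" where
  "condition_ii G x \<longleftrightarrow> norm_sq_nabla_Wplus G x =
      ip (G x) (grad G (norm_Wplus G) x) (grad G (norm_Wplus G) x)"

definition condition_iii :: "(real^4 \<Rightarrow> real^4^4) \<Rightarrow> real^4 \<Rightarrow> bool" where
  "condition_iii G x \<longleftrightarrow> (\<forall>v. delta_Wplus G x v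
      + Wplus2 G x (grad G (\<lambda>y. ln (norm_Wplus G y)) x) v = 0)"

definition condition_det :: "(real^4 \<Rightarrow> real^4^4) \<Rightarrow> real^4 \<Rightarrow> bool" where
  "condition_det G x \<longleftrightarrow> (det_Wplus G x)^2 = 1/54 * (norm_Wplus G x)^6"

context framed_chart
begin

text \<open>The covariant derivative of the self-dual endomorphism field with components \<open>u\<close>.\<close>

definition nabla_sd :: "(real^4 \<Rightarrow> real^3) \<Rightarrow> real^4 \<Rightarrow> real^4 \<Rightarrow> real^3" where
  "nabla_sd u x v = dirD u x v + sd_rotation (conn x v) *v u x"

lemma condition_det_wmat:
  assumes x: "x \<in> V"
  shows "condition_det G x \<longleftrightarrow> (det (wmat x))\<^sup>2 = 1/54 * (trace (wmat x ** wmat x))^3"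
proof -
  have t: "trace (wmat x ** wmat x) \<ge> 0" by (rule trace_square_nonneg[OF wmat_symmetric[OF x]])
  have "(norm_Wplus G x)^6 = ((norm_Wplus G x)\<^sup>2)^3" by simp
  also have "(norm_Wplus G x)\<^sup>2 = trace (wmat x ** wmat x)"
    using t by (simp add: norm_Wplus_frame[OF x])
  finally show ?thesis by (simp add: condition_det_def det_Wplus_frame[OF x])
qed

text \<open>From here on \<open>W\<^sub>+\<close> has the eigenvalues \<open>2s, -s, -s\<close>, and \<open>u\<close> spans the eigenspace for \<open>2s\<close>.\<close>

context
  fixes x :: "real^4" and s :: "real^4 \<Rightarrow> real" and u :: "real^4 \<Rightarrow> real^3"
  assumes x: "x \<in> V"
    and m: "\<And>y. y \<in> V \<Longrightarrow> wmat y = s y *\<^sub>R (3 *\<^sub>R proj3 (u y) - mat 1)"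
    and unit: "\<And>y. y \<in> V \<Longrightarrow> u y \<bullet> u y = 1" and nz: "\<And>y. y \<in> V \<Longrightarrow> s y \<noteq> 0"
    and ds: "s differentiable (at x)" and du: "u differentiable (at x)"
begin

abbreviation "D \<equiv> nabla_sd u x"

lemma condition_det_degenerate: "condition_det G x"
  unfolding condition_det_wmat[OF x] m[OF x] double_eigenvalue_invariants[OF unit[OF x]]
  by (simp add: power_mult_distrib power2_eq_square power3_eq_cube)

lemma D_linear: "D (v + w) = D v + D w" "D (c *\<^sub>R v) = c *\<^sub>R D v"
  using du by (simp_all add: nabla_sd_def dirD_add dirD_scaleR conn_linear[OF x] sd_rotation_linear
      mat_vec_distribs algebra_simps)

lemma D_frame: "(\<forall>v. D v = 0) \<longleftrightarrow> (\<forall>k. D (E x *v ax k) = 0)"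
proof
  assume a: "\<forall>k. D (E x *v ax k) = 0"
  have l: "linear D" by (auto intro!: linearI simp: D_linear)
  have "D v = (\<Sum>k\<in>UNIV. (matrix_inv (E x) *v v) $ k *\<^sub>R D (E x *v ax k))" for v
  proof -
    have "D v = D (E x *v (matrix_inv (E x) *v v))" by (simp add: frame_vector[OF frame_E[OF x]])
    then show ?thesis
      by (subst (asm) frame_expand) (simp add: linear_sum[OF l] D_linear)
  qed
  then show "\<forall>v. D v = 0" using a by simp
qed simp

text \<open>Differentiate \<open>|u|\<^sup>2 = 1\<close> and use that \<open>sd_rotation\<close> is skew-symmetric.\<close>

lemma D_orthogonal: "u x \<bullet> D v = 0"
proof -
  have "dirD (\<lambda>y. u y \<bullet> u y) x v = dirD (\<lambda>y. 1) x v"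
    by (rule dirD_cong[OF open_V x unit])
  then have "u x \<bullet> dirD u x v = 0"
    by (simp add: dirD_bounded_bilinear(1)[OF bounded_bilinear_inner du du] inner_commute)
  moreover have "u x \<bullet> (sd_rotation (conn x v) *v u x) = 0"
  proof -
    have "(sd_rotation (conn x v) *v u x) \<bullet> u x = u x \<bullet> (- sd_rotation (conn x v) *v u x)"
      by (simp only: inner_matrix_vector sd_rotation_skew)
    then show ?thesis by (simp add: mat_vec_distribs inner_commute)
  qed
  ultimately show ?thesis by (simp add: nabla_sd_def inner_add_right)
qed

lemma nabla_wmat_degenerate:
  "nabla_wmat x v = dirD s x v *\<^sub>R (3 *\<^sub>R proj3 (u x) - mat 1) + (3 * s x) *\<^sub>R (outer (u x) (D v) + outer (D v) (u x))"
proof -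
  have do: "(\<lambda>y. outer (u y) (u y)) differentiable (at x)"
    by (rule dirD_bounded_bilinear(2)[OF bounded_bilinear_outer du du])
  have d3: "(\<lambda>y. 3 *\<^sub>R outer (u y) (u y)) differentiable (at x)"
    by (rule dirD_bounded_linear(2)[OF bounded_linear_scaleR_right do])
  have "dirD wmat x v = dirD (\<lambda>y. s y *\<^sub>R (3 *\<^sub>R proj3 (u y) - mat 1)) x v"
    by (rule dirD_cong[OF open_V x m])
  also have "\<dots> = s x *\<^sub>R (3 *\<^sub>R (outer (u x) (dirD u x v) + outer (dirD u x v) (u x)))
      + dirD s x v *\<^sub>R (3 *\<^sub>R proj3 (u x) - mat 1)"
    by (subst dirD_bounded_bilinear(1)[OF bounded_bilinear_scaleR ds])
      (simp_all add: d3 dirD_minus dirD_bounded_linear(1)[OF bounded_linear_scaleR_right do]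
        dirD_bounded_bilinear(1)[OF bounded_bilinear_outer du du])
  finally have d: "dirD wmat x v = s x *\<^sub>R (3 *\<^sub>R (outer (u x) (dirD u x v) + outer (dirD u x v) (u x)))
      + dirD s x v *\<^sub>R (3 *\<^sub>R proj3 (u x) - mat 1)" .
  show ?thesis
    unfolding nabla_wmat_def d m[OF x]
    by (simp add: mat_distribs outer_mul sd_rotation_skew nabla_sd_def outer_linear mat_vec_distribs
        scaleR_add_right scaleR_diff_right algebra_simps del: transpose_matrix_vector)
qed

lemma trace_nabla_wmat_square: "trace (nabla_wmat x v ** nabla_wmat x v) = 6 * (dirD s x v)\<^sup>2 + 18 * (s x)\<^sup>2 * (D v \<bullet> D v)"
proof -
  have Du: "D v \<bullet> u x = 0" using D_orthogonal by (simp add: inner_commute)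
  show ?thesis
    unfolding nabla_wmat_degenerate
    by (simp add: mat_distribs mat_vec_distribs outer_mul trace_linear unit[OF x]
        D_orthogonal Du power2_eq_square algebra_simps)
qed

lemma norm_Wplus_degenerate: "y \<in> V \<Longrightarrow> norm_Wplus G y = sqrt (6 * (s y)\<^sup>2)"
  unfolding norm_Wplus_frame m double_eigenvalue_invariants[OF unit] ..

lemma norm_pos: "norm_Wplus G x > 0"
  using nz[OF x] by (simp add: norm_Wplus_degenerate[OF x])

lemma dirD_norm:
  "dirD (norm_Wplus G) x v = 6 * s x * dirD s x v / norm_Wplus G x" "norm_Wplus G differentiable (at x)"
proof -
  have d6: "((\<lambda>y. 6 * (s y)\<^sup>2) has_derivative (\<lambda>v. 12 * s x * dirD s x v)) (at x)"
    using has_derivative_dirD[OF ds] by (auto intro!: derivative_eq_intros)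
  then have d: "(\<lambda>y. 6 * (s y)\<^sup>2) differentiable (at x)" by (auto simp: differentiable_def)
  have p: "6 * (s x)\<^sup>2 > 0" using nz[OF x] by simp
  have "dirD (norm_Wplus G) x v = dirD (\<lambda>y. sqrt (6 * (s y)\<^sup>2)) x v"
    by (rule dirD_cong[OF open_V x norm_Wplus_degenerate])
  also have "\<dots> = 12 * s x * dirD s x v / (2 * sqrt (6 * (s x)\<^sup>2))"
    unfolding dirD_sqrt[OF d p] dirD_eq[OF d6] ..
  finally show "dirD (norm_Wplus G) x v = 6 * s x * dirD s x v / norm_Wplus G x"
    by (simp only: norm_Wplus_degenerate[OF x])
  show "norm_Wplus G differentiable (at x)"
    by (rule differentiable_transform[OF differentiable_sqrt[OF d p] open_V x norm_Wplus_degenerate])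
qed

lemma norm_square: "(norm_Wplus G x)\<^sup>2 = 6 * (s x)\<^sup>2"
  by (simp add: norm_Wplus_degenerate[OF x])

text \<open>\<open>|\<nabla>W\<^sub>+|\<^sup>2 - |\<nabla>|W\<^sub>+||\<^sup>2 = 18 s\<^sup>2 |\<nabla>u|\<^sup>2\<close>.\<close>

lemma condition_ii_degenerate: "condition_ii G x \<longleftrightarrow> (\<forall>v. D v = 0)"
proof -
  have "(dirD (norm_Wplus G) x v)\<^sup>2 = 6 * (dirD s x v)\<^sup>2" for v
  proof -
    have "(dirD (norm_Wplus G) x v)\<^sup>2 = 36 * (s x)\<^sup>2 * (dirD s x v)\<^sup>2 / (6 * (s x)\<^sup>2)"
      by (simp add: dirD_norm(1) power_divide norm_square power_mult_distrib)
    then show ?thesis using nz[OF x] by simp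
  qed
  then have "ip (G x) (grad G (norm_Wplus G) x) (grad G (norm_Wplus G) x)
      = (\<Sum>k\<in>UNIV. 6 * (dirD s x (E x *v ax k))\<^sup>2)"
    by (simp add: norm_sq_grad_frame(1)[OF x dirD_norm(2)])
  then have "condition_ii G x \<longleftrightarrow> (\<Sum>k\<in>UNIV. 18 * (s x)\<^sup>2 * (D (E x *v ax k) \<bullet> D (E x *v ax k))) = 0"
    unfolding condition_ii_def norm_sq_nabla_Wplus_frame[OF x] trace_nabla_wmat_square by (simp add: sum.distrib)
  also have "\<dots> \<longleftrightarrow> (\<forall>k. D (E x *v ax k) = 0)"
    using nz[OF x] by (subst sum_nonneg_eq_0_iff) auto
  finally show ?thesis by (simp add: D_frame)
qed

text \<open>After the derivatives of \<open>s\<close> have cancelled, the expression in (iii) is a multiple of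
  \<open>X w = \<Sum>\<^sub>k g(D\<^sub>k, z\<^sub>k w) u + g(u, z\<^sub>k w) D\<^sub>k\<close> with \<open>g(u, z\<^sub>k w) = g(w, J e\<^sub>k)\<close>. If it vanishes then so does
  the part \<open>\<Sum>\<^sub>k g(w, J e\<^sub>k) D\<^sub>k\<close> orthogonal to \<open>u\<close>, and \<open>w = J e\<^sub>l\<close> isolates \<open>D\<^sub>l\<close>.\<close>

lemma condition_iii_degenerate: "condition_iii G x \<longleftrightarrow> (\<forall>v. D v = 0)"
proof -
  let ?D = "\<lambda>k. D (E x *v ax k)"
  let ?z = "\<lambda>k w. \<chi> b. w \<bullet> (sdm (axis b 1) *v ax k)"
  define X where "X w = (\<Sum>k\<in>UNIV. (?D k \<bullet> ?z k w) *\<^sub>R u x + (u x \<bullet> ?z k w) *\<^sub>R ?D k)" for w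
  let ?lg = "\<lambda>y. ln (norm_Wplus G y)"
  have dl: "?lg differentiable (at x)" "\<And>v. dirD ?lg x v = dirD s x v / s x"
  proof -
    show "?lg differentiable (at x)" by (rule dirD_ln(2)[OF dirD_norm(2) norm_pos])
    have "dirD ?lg x v = 6 * s x * dirD s x v / (norm_Wplus G x)\<^sup>2" for v
      by (simp add: dirD_ln(1)[OF dirD_norm(2) norm_pos] dirD_norm(1) power2_eq_square)
    then show "dirD ?lg x v = dirD s x v / s x" for v
      using nz[OF x] unfolding norm_square by (simp add: power2_eq_square)
  qed
  have "delta_Wplus G x (E x *v w) + Wplus2 G x (grad G ?lg x) (E x *v w)
      = in_frame (E x) (sdm ((3/4 * s x) *\<^sub>R X w))" for w
  proof -
    have "(nabla_wmat x (E x *v ax k) - (dirD s x (E x *v ax k) / s x) *\<^sub>R wmat x) *v ?z k w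
        = (3 * s x) *\<^sub>R ((?D k \<bullet> ?z k w) *\<^sub>R u x + (u x \<bullet> ?z k w) *\<^sub>R ?D k)" for k
    proof -
      have "nabla_wmat x (E x *v ax k) - (dirD s x (E x *v ax k) / s x) *\<^sub>R wmat x
          = (3 * s x) *\<^sub>R (outer (u x) (?D k) + outer (?D k) (u x))"
        using nz[OF x] by (simp add: nabla_wmat_degenerate m[OF x])
      then show ?thesis by (simp add: mat_vec_distribs outer_mul)
    qed
    then have e: "(\<Sum>k\<in>UNIV. nabla_wmat x (E x *v ax k) *v ?z k w)
        - (\<Sum>k\<in>UNIV. (dirD s x (E x *v ax k) / s x) *\<^sub>R (wmat x *v ?z k w)) = (3 * s x) *\<^sub>R X w"
      by (simp add: sum_subtractf[symmetric] X_def scaleR_sum_right mat_vec_distribs)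
    have "delta_Wplus G x (E x *v w) + Wplus2 G x (grad G ?lg x) (E x *v w)
       = in_frame (E x) (sdm ((1/4) *\<^sub>R ((\<Sum>k\<in>UNIV. nabla_wmat x (E x *v ax k) *v ?z k w)
        - (\<Sum>k\<in>UNIV. (dirD s x (E x *v ax k) / s x) *\<^sub>R (wmat x *v ?z k w)))))"
      unfolding norm_sq_grad_frame(2)[OF x dl(1)] delta_Wplus_frame[OF x] Wplus2_frame[OF x]
      by (simp add: dl(2) in_frame_linear(1)[symmetric] sdm_linear(1)[symmetric] scaleR_diff_right)
    then show ?thesis unfolding e by simp
  qed
  then have "condition_iii G x \<longleftrightarrow> (\<forall>w. in_frame (E x) (sdm ((3/4 * s x) *\<^sub>R X w)) = 0)"
    unfolding condition_iii_def by (metis frame_vector[OF frame_E[OF x]])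
  also have "\<dots> \<longleftrightarrow> (\<forall>w. X w = 0)"
    using nz[OF x] in_frame_inject[OF frame_E[OF x], of _ 0] by (simp add: in_frame_linear(5))
  also have "\<dots> \<longleftrightarrow> (\<forall>k. ?D k = 0)"
  proof
    assume X: "\<forall>w. X w = 0"
    have X2: "(\<Sum>k\<in>UNIV. (u x \<bullet> ?z k w) *\<^sub>R ?D k) = 0" for w
    proof -
      have "u x \<bullet> X w = (\<Sum>k\<in>UNIV. ?D k \<bullet> ?z k w)"
        by (simp add: X_def inner_sum_right inner_add_right unit[OF x] D_orthogonal)
      then have "(\<Sum>k\<in>UNIV. (?D k \<bullet> ?z k w) *\<^sub>R u x) = 0"
        using X by (simp add: scaleR_left.sum[symmetric])
      moreover have "X w = (\<Sum>k\<in>UNIV. (?D k \<bullet> ?z k w) *\<^sub>R u x) + (\<Sum>k\<in>UNIV. (u x \<bullet> ?z k w) *\<^sub>R ?D k)"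
        by (simp add: X_def sum.distrib)
      ultimately show ?thesis using X by simp
    qed
    have "?D l = 0" for l
    proof -
      have "u x \<bullet> ?z k (sdm (u x) *v ax l) = (if k = l then 1 else 0)" for k
        by (simp add: inner_sdm_axis sdm_orthogonal unit[OF x] ax_def inner_axis_axis)
      then show ?thesis using X2[of "sdm (u x) *v ax l"]
        by (simp add: if_distrib[of "\<lambda>c. c *\<^sub>R _"] sum.delta cong: if_cong)
    qed
    then show "\<forall>k. ?D k = 0" by blast
  next
    assume "\<forall>k. ?D k = 0"
    then show "\<forall>w. X w = 0" by (simp add: X_def)
  qed
  finally show ?thesis by (simp add: D_frame)
qed

end

end

section \<open>Parallel complex structures in a chart\<close>

definition kaehler_at :: "(real^4 \<Rightarrow> real^4^4) \<Rightarrow> (real^4 \<Rightarrow> real^4^4) \<Rightarrow> real^4 \<Rightarrow> bool" where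
  "kaehler_at G J x \<longleftrightarrow> J x ** J x = - mat 1 \<and> adj (G x) (J x) = - J x \<and>
     (\<forall>v. nabla_endo G (\<lambda>_. v) J x = 0) \<and>
     (\<forall>v1 v2 v3 v4. 1/2 * wedge (form_of (G x) (J x)) (form_of (G x) (J x)) v1 v2 v3 v4
        = vol (G x) v1 v2 v3 v4)"

lemma wedge_frame:
  assumes "frame h E"
  shows "wedge (form_of h (in_frame E a)) (form_of h (in_frame E a)) (E *v v1) (E *v v2) (E *v v3) (E *v v4)
    = wedge (\<lambda>v w. (a *v v) \<bullet> w) (\<lambda>v w. (a *v v) \<bullet> w) v1 v2 v3 v4"
  by (simp add: wedge_def form_frame[OF assms])

text \<open>A compatible complex structure has Pfaffian \<open>1\<close>, and the squares of its entries above the diagonal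
  have the sum \<open>2\<close>. This sum minus twice the Pfaffian is a sum of squares that measures the failure of
  self-duality.\<close>

lemma selfdual_of_structure:
  assumes skew: "transpose j = - j" and sq: "j ** j = - mat 1"
    and pf: "wedge (\<lambda>v w. (j *v v) \<bullet> w) (\<lambda>v w. (j *v v) \<bullet> w) (ax 1) (ax 2) (ax 3) (ax 4) = 2"
  shows "j = sdm (sdc j)" "sdc j \<bullet> sdc j = 1"
proof -
  note sk = skew_entries[OF skew]
  have d: "(j ** j) $ i $ i = -1" for i by (simp add: sq mat_def)
  have s: "(j$1$2)\<^sup>2 + (j$1$3)\<^sup>2 + (j$1$4)\<^sup>2 + (j$2$3)\<^sup>2 + (j$2$4)\<^sup>2 + (j$3$4)\<^sup>2 = 2"
    using d[of 1] d[of 2] d[of 3] d[of 4]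
    by (simp add: matrix_matrix_mult_def sum_4 sk power2_eq_square)
  have p: "j$1$2 * j$3$4 - j$1$3 * j$2$4 + j$1$4 * j$2$3 = 1"
    using pf by (simp add: wedge_def ax_def inner_axis matrix_vector_axis sk algebra_simps)
  have "(j$1$2 - j$3$4)\<^sup>2 + (j$1$3 + j$2$4)\<^sup>2 + (j$1$4 - j$2$3)\<^sup>2 = 0"
    using s p by (simp add: power2_eq_square algebra_simps)
  then have e: "j$1$2 = j$3$4" "j$2$4 = - j$1$3" "j$1$4 = j$2$3"
    by (smt (verit) zero_le_power2 power2_eq_iff_nonneg zero_eq_power2)+
  show "j = sdm (sdc j)"
    by (simp add: sdm_def sdc_def vec_eq_iff forall_4 sk e)
  show "sdc j \<bullet> sdc j = 1"
    using p by (simp add: sdc_def inner_vec_def sum_3 sk e)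
qed

text \<open>The wedge product pairs the three basis forms orthogonally, each having square \<open>2 vol\<close>. Expanding
  in this basis first keeps the polynomial identities small.\<close>

lemma wedge_sdm:
  "wedge (\<lambda>v w. (sdm u *v v) \<bullet> w) (\<lambda>v w. (sdm u *v v) \<bullet> w) v1 v2 v3 v4
    = 2 * (u \<bullet> u) * det (vector [v1, v2, v3, v4] :: real^4^4)"
proof -
  define F1 F2 F3 :: "real^4 \<Rightarrow> real^4 \<Rightarrow> real"
    where "F1 v w = v$2 * w$1 - v$1 * w$2 + v$4 * w$3 - v$3 * w$4"
      and "F2 v w = v$3 * w$1 - v$4 * w$2 - v$1 * w$3 + v$2 * w$4"
      and "F3 v w = v$4 * w$1 + v$3 * w$2 - v$2 * w$3 - v$1 * w$4" for v w
  have F: "(sdm u *v v) \<bullet> w = u$1 * F1 v w + u$2 * F2 v w + u$3 * F3 v w" for v w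
    by (simp add: inner_vec_def sum_4 matrix_vector_mult_def sdm_def F1_def F2_def F3_def algebra_simps)
  let ?d = "det (vector [v1, v2, v3, v4] :: real^4^4)"
  have sq: "wedge F1 F1 v1 v2 v3 v4 = 2 * ?d" "wedge F2 F2 v1 v2 v3 v4 = 2 * ?d"
    "wedge F3 F3 v1 v2 v3 v4 = 2 * ?d"
    unfolding wedge_def F1_def F2_def F3_def det_4 vector_4 by algebra+
  have mixed: "wedge F1 F2 v1 v2 v3 v4 = 0" "wedge F1 F3 v1 v2 v3 v4 = 0" "wedge F2 F3 v1 v2 v3 v4 = 0"
    unfolding wedge_def F1_def F2_def F3_def by algebra+
  have "wedge (\<lambda>v w. (sdm u *v v) \<bullet> w) (\<lambda>v w. (sdm u *v v) \<bullet> w) v1 v2 v3 v4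
      = (u$1)\<^sup>2 * wedge F1 F1 v1 v2 v3 v4 + (u$2)\<^sup>2 * wedge F2 F2 v1 v2 v3 v4
        + (u$3)\<^sup>2 * wedge F3 F3 v1 v2 v3 v4 + 2 * u$1 * u$2 * wedge F1 F2 v1 v2 v3 v4
        + 2 * u$1 * u$3 * wedge F1 F3 v1 v2 v3 v4 + 2 * u$2 * u$3 * wedge F2 F3 v1 v2 v3 v4"
    unfolding F wedge_def by algebra
  also have "\<dots> = 2 * (u \<bullet> u) * ?d"
    unfolding sq mixed by (simp add: inner_vec_def sum_3 power2_eq_square algebra_simps)
  finally show ?thesis .
qed

lemma structure_of_selfdual:
  assumes E: "frame h E" "det E > 0" and u: "u \<bullet> u = 1"
  defines "J \<equiv> in_frame E (sdm u)"
  shows "J ** J = - mat 1" "adj h J = - J"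
    "1/2 * wedge (form_of h J) (form_of h J) v1 v2 v3 v4 = vol h v1 v2 v3 v4"
proof -
  show "J ** J = - mat 1"
    by (simp add: J_def in_frame_mul[OF E(1)] sdm_square u in_frame_linear)
  show "adj h J = - J"
    by (simp add: J_def adj_in_frame[OF E(1)] transpose_sdm in_frame_linear)
  have "1/2 * wedge (form_of h J) (form_of h J) (E *v w1) (E *v w2) (E *v w3) (E *v w4)
      = vol h (E *v w1) (E *v w2) (E *v w3) (E *v w4)" for w1 w2 w3 w4
    by (simp add: J_def wedge_frame[OF E(1)] wedge_sdm u vol_frame[OF E])
  then show "1/2 * wedge (form_of h J) (form_of h J) v1 v2 v3 v4 = vol h v1 v2 v3 v4"
    by (metis frame_vector[OF E(1)])
qed

context chart_metric
begin

text \<open>Differentiate \<open>dJ = [J, \<Gamma>]\<close> once more and antisymmetrize: the second derivatives of \<open>J\<close> cancel, and the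
  terms that remain are the commutator of \<open>J\<close> with the curvature.\<close>

lemma parallel_riem:
  assumes V: "open V" "V \<subseteq> S" and J: "smooth_on V J"
    and par: "\<And>y v. y \<in> V \<Longrightarrow> dirD J y v = J y ** gam G y v - gam G y v ** J y" and x: "x \<in> V"
  shows "riem G x u v ** J x = J x ** riem G x u v"
proof -
  have xS: "x \<in> S" using x V by blast
  note g = gam_differentiable[OF xS] and dJ = smooth_on_differentiable[OF J x]
  have dd: "dirD (\<lambda>y. dirD J y v) x u
      = J x ** dirD (\<lambda>y. gam G y v) x u + (J x ** gam G x u - gam G x u ** J x) ** gam G x v
      - (gam G x v ** (J x ** gam G x u - gam G x u ** J x) + dirD (\<lambda>y. gam G y v) x u ** J x)" for u v
  proof -
    have "dirD (\<lambda>y. dirD J y v) x u = dirD (\<lambda>y. J y ** gam G y v - gam G y v ** J y) x u"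
      by (rule dirD_cong[OF V(1) x par])
    then show ?thesis
      by (simp add: dirD_minus dirD_matrix_mul g dJ differentiable_mat par[OF x])
  qed
  have "dirD (\<lambda>y. dirD J y v) x u = dirD (\<lambda>y. dirD J y u) x v"
    by (rule dirD_commute[OF J V(1) x])
  then show ?thesis
    unfolding dd by (simp add: riem_def mat_distribs matrix_mul_assoc algebra_simps)
qed

text \<open>The equation \<open>dJ = [J, \<Gamma>]\<close> raises the order of differentiability.\<close>

lemma parallel_smooth:
  assumes V: "open V" "V \<subseteq> S" and J: "\<And>y. y \<in> V \<Longrightarrow> J differentiable (at y)"
    and par: "\<And>y v. y \<in> V \<Longrightarrow> nabla_endo G (\<lambda>_. v) J y = 0"
  shows "smooth_on V J"
proof -
  have d: "dirD J y v = J y ** gam G y v - gam G y v ** J y" if "y \<in> V" for y v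
    using par[OF that, of v] unfolding nabla_endo_gam[OF J[OF that]] by (simp add: algebra_simps)
  have g: "Ck_on k V (\<lambda>y. gam G y v)" for k v
    using smooth_gam V(2) Ck_on_subset unfolding smooth_on_def by blast
  have "Ck_on k V J" for k
  proof (induction k)
    case 0
    then show ?case
      using J by (auto intro!: continuous_at_imp_continuous_on differentiable_imp_continuous_within)
  next
    case (Suc k)
    have "Ck_on k V (\<lambda>y. J y ** gam G y v + - (gam G y v ** J y))" for v
      by (intro Ck_on_add V(1) Ck_on_bounded_linear[OF bounded_linear_minus[OF bounded_linear_ident]]
          Ck_on_bounded_bilinear[OF bilinear_mat] Suc g)
    then have "Ck_on k V (\<lambda>y. dirD J y v)" for v
      by (rule Ck_on_transform[OF _ V(1)]) (simp add: d)
    then show ?case using J by simp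
  qed
  then show ?thesis by (simp add: smooth_on_def)
qed

lemma framed_chart_subset:
  assumes x: "x \<in> S" "x \<in> V" and V: "open V"
  obtains V' E where "framed_chart S G V' E" "x \<in> V'" "V' \<subseteq> V"
proof -
  obtain V0 E where E: "open V0" "x \<in> V0" "V0 \<subseteq> S"
    "\<And>x. x \<in> V0 \<Longrightarrow> frame (G x) (E x)" "\<And>x. x \<in> V0 \<Longrightarrow> det (E x) > 0"
    "\<And>x. x \<in> V0 \<Longrightarrow> E differentiable (at x)" using local_frame[OF x(1)] by metis
  have "framed_chart S G (V0 \<inter> V) E"
    by unfold_locales (use E V in auto)
  then show ?thesis using that E x by blast
qed

lemma wmat_nonzero:
  assumes "framed_chart S G V E" "x \<in> V" "\<exists>A\<in>selfdual (G x). Wplus G x A \<noteq> 0"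
  shows "framed_chart.wmat G E x \<noteq> 0"
proof -
  interpret framed_chart S G V E by fact
  obtain u where "Wplus G x (in_frame (E x) (sdm u)) \<noteq> 0"
    using assms(3) selfdual_frame[OF frame_E det_E, OF assms(2) assms(2)] by auto
  then show ?thesis by (auto simp: Wplus_wmat[OF assms(2)] sdm_linear in_frame_linear)
qed

text \<open>In the frame, \<open>J\<close> is a unit vector field \<open>u\<close> with \<open>D u = 0\<close>. The double eigenvalue of the Weyl operator
  comes from \<open>weyl_sd_kaehler\<close>; the function \<open>s = g(u, w u)/2\<close> is differentiable because \<open>w\<close> and \<open>u\<close>
  are.\<close>

lemma kaehler_imp_conditions:
  assumes V: "open V" "x \<in> V" "V \<subseteq> S" and J: "smooth_on V J" and k: "\<And>y. y \<in> V \<Longrightarrow> kaehler_at G J y"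
    and W: "\<And>y. y \<in> S \<Longrightarrow> \<exists>A\<in>selfdual (G y). Wplus G y A \<noteq> 0"
  shows "condition_det G x \<and> condition_ii G x \<and> condition_iii G x"
proof -
  obtain V' E where fc: "framed_chart S G V' E" "x \<in> V'" "V' \<subseteq> V"
    using framed_chart_subset V by blast
  interpret framed_chart S G V' E by (rule fc(1))
  have dJ: "J differentiable (at y)" if "y \<in> V'" for y
    using smooth_on_differentiable[OF J] that fc(3) by blast
  define j where "j y = matrix_inv (E y) ** J y ** E y" for y
  define u where "u y = sdc (j y)" for y
  have Jj: "J y = in_frame (E y) (j y)" if "y \<in> V'" for y
    by (simp add: j_def in_frame_inverse[OF frame_E[OF that]])
  have ju: "j y = sdm (u y)" "u y \<bullet> u y = 1" if y: "y \<in> V'" for y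
  proof -
    have ka: "kaehler_at G J y" using k y fc(3) by blast
    note f = frame_E[OF y]
    have "in_frame (E y) (transpose (j y)) = in_frame (E y) (- j y)"
      using ka by (simp add: kaehler_at_def Jj[OF y] adj_in_frame[OF f] in_frame_linear)
    then have 1: "transpose (j y) = - j y" by (simp only: in_frame_inject[OF f])
    have "in_frame (E y) (j y ** j y) = in_frame (E y) (- mat 1)"
      using ka by (simp add: kaehler_at_def Jj[OF y] in_frame_mul[OF f] in_frame_linear)
    then have 2: "j y ** j y = - mat 1" by (simp only: in_frame_inject[OF f])
    have "1/2 * wedge (form_of (G y) (J y)) (form_of (G y) (J y)) (E y *v ax 1) (E y *v ax 2) (E y *v ax 3) (E y *v ax 4)
        = vol (G y) (E y *v ax 1) (E y *v ax 2) (E y *v ax 3) (E y *v ax 4)"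
      using ka unfolding kaehler_at_def by blast
    then have 3: "wedge (\<lambda>v w. (j y *v v) \<bullet> w) (\<lambda>v w. (j y *v v) \<bullet> w) (ax 1) (ax 2) (ax 3) (ax 4) = 2"
      by (simp add: Jj[OF y] wedge_frame[OF f] vol_frame[OF f det_E[OF y]]) (simp add: det_4 ax_def axis_nth_if)
    show "j y = sdm (u y)" "u y \<bullet> u y = 1"
      unfolding u_def using selfdual_of_structure[OF 1 2 3] by auto
  qed
  have du: "u differentiable (at y)" if "y \<in> V'" for y
    unfolding u_def[abs_def] j_def[abs_def]
    by (intro differentiable_sdc differentiable_mat diff_E diff_E_inv dJ that)
  have D0: "nabla_sd u x v = 0" for v
  proof -
    have "nabla_endo G (\<lambda>_. v) J x = in_frame (E x) (sdm (nabla_sd u x v))"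
      unfolding nabla_sd_def by (rule nabla_endo_selfdual[OF fc(2) du[OF fc(2)]]) (simp_all add: Jj ju(1))
    moreover have "nabla_endo G (\<lambda>_. v) J x = 0" using k[OF V(2)] by (simp add: kaehler_at_def)
    ultimately show ?thesis
      by (metis in_frame_inject[OF frame_E[OF fc(2)]] in_frame_linear(5) sdm_eq_0_iff)
  qed
  have par: "dirD J y v = J y ** gam G y v - gam G y v ** J y" if "y \<in> V'" for y v
  proof -
    have "nabla_endo G (\<lambda>_. v) J y = 0" using k fc(3) that by (auto simp: kaehler_at_def)
    then show ?thesis unfolding nabla_endo_gam[OF dJ[OF that]] by (simp add: algebra_simps)
  qed
  have ex: "\<exists>s. wmat y = s *\<^sub>R (3 *\<^sub>R proj3 (u y) - mat 1)" if y: "y \<in> V'" for y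
  proof -
    note f = frame_E[OF y]
    have "frame_riem G y (E y) i j' ** sdm (u y) = sdm (u y) ** frame_riem G y (E y) i j'" for i j'
    proof -
      have "riem G y (E y *v ax i) (E y *v ax j') ** J y = J y ** riem G y (E y *v ax i) (E y *v ax j')"
        by (rule parallel_riem[OF open_V V_S smooth_on_subset[OF J fc(3)] par y])
      then have "in_frame (E y) (frame_riem G y (E y) i j' ** sdm (u y)) = in_frame (E y) (sdm (u y) ** frame_riem G y (E y) i j')"
        by (simp add: riem_frame_ax[OF V_in_S[OF y] f] Jj[OF y] ju(1)[OF y] in_frame_mul[OF f])
      then show ?thesis by (simp only: in_frame_inject[OF f])
    qed
    then show ?thesis
      unfolding wmat_def using weyl_sd_kaehler[OF algebraic_curvature_frame[OF V_in_S[OF y] f] ju(2)[OF y]] by metis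
  qed
  \<comment> \<open>For \<open>w = t (3 u\<otimes>u - 1)\<close> this formula recovers \<open>t\<close>.\<close>
  define s where "s y = (u y \<bullet> (wmat y *v u y)) / 2" for y
  have ms: "wmat y = s y *\<^sub>R (3 *\<^sub>R proj3 (u y) - mat 1)" if y: "y \<in> V'" for y
  proof -
    obtain t where t: "wmat y = t *\<^sub>R (3 *\<^sub>R proj3 (u y) - mat 1)" using ex[OF y] by blast
    have "s y = t"
      by (simp add: s_def t mat_vec_distribs outer_mul inner_diff_right ju(2)[OF y])
    then show ?thesis using t by simp
  qed
  have nz: "s y \<noteq> 0" if "y \<in> V'" for y
    using wmat_nonzero[OF fc(1) that W[OF V_in_S[OF that]]] ms[OF that] by auto
  have ds: "s differentiable (at x)"
    unfolding s_def[abs_def]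
    by (intro differentiable_divide dirD_bounded_bilinear(2)[OF bounded_bilinear_inner]
        differentiable_mat_vec diff_wmat du fc(2)) auto
  note deg = fc(2) ms ju(2) nz ds du[OF fc(2)]
  show ?thesis
    using condition_det_degenerate[OF deg] condition_ii_degenerate[OF deg] condition_iii_degenerate[OF deg] D0
    by blast
qed

text \<open>The projection \<open>q = u\<otimes>u\<close> is differentiable because it is rational in the Weyl matrix. Normalizing
  \<open>q e\<close> for a constant vector \<open>e\<close> with \<open>q e \<noteq> 0\<close> at \<open>x0\<close> picks one of the two unit vectors \<open>u\<close>, \<open>-u\<close>
  consistently near \<open>x0\<close>, which removes the sign ambiguity of \<open>J\<close>.\<close>

lemma conditions_imp_kaehler:
  assumes x0: "x0 \<in> S" and W: "\<And>y. y \<in> S \<Longrightarrow> \<exists>A\<in>selfdual (G y). Wplus G y A \<noteq> 0"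
    and det: "\<And>y. y \<in> S \<Longrightarrow> condition_det G y"
    and c: "\<And>y. y \<in> S \<Longrightarrow> condition_ii G y \<or> condition_iii G y"
  obtains V J where "open V" "x0 \<in> V" "V \<subseteq> S"
    "\<And>y. y \<in> V \<Longrightarrow> J differentiable (at y)" "\<And>y. y \<in> V \<Longrightarrow> kaehler_at G J y"
proof -
  obtain V E where fc: "framed_chart S G V E" "x0 \<in> V"
    using framed_chart_subset[OF x0 x0 open_S] by metis
  interpret F: framed_chart S G V E by (rule fc(1))
  define s where "s y = 3 * det (F.wmat y) / trace (F.wmat y ** F.wmat y)" for y
  define q where "q y = (1/(3 * s y)) *\<^sub>R (F.wmat y + s y *\<^sub>R mat 1)" for y
  have dbl: "s y \<noteq> 0" "transpose (q y) = q y" "q y ** q y = q y" "trace (q y) = 1"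
    "F.wmat y = s y *\<^sub>R (3 *\<^sub>R q y - mat 1)" "trace (F.wmat y ** F.wmat y) \<noteq> 0" if y: "y \<in> V" for y
  proof -
    have nz: "F.wmat y \<noteq> 0" by (rule wmat_nonzero[OF fc(1) y W[OF F.V_in_S[OF y]]])
    have d: "(det (F.wmat y))\<^sup>2 = 1/54 * (trace (F.wmat y ** F.wmat y))^3"
      using det[OF F.V_in_S[OF y]] F.condition_det_wmat[OF y] by blast
    note D = double_eigenvalue[OF F.wmat_symmetric[OF y] F.wmat_tracefree[OF y] nz d,
        folded s_def, folded q_def]
    show "s y \<noteq> 0" "transpose (q y) = q y" "q y ** q y = q y" "trace (q y) = 1"
      "F.wmat y = s y *\<^sub>R (3 *\<^sub>R q y - mat 1)" by (rule D)+
    show "trace (F.wmat y ** F.wmat y) \<noteq> 0"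
      using nz trace_square_eq_0[OF F.wmat_symmetric[OF y]] by simp
  qed
  have dmn: "(\<lambda>y. F.wmat y $ i $ j) differentiable (at y)" if "y \<in> V" for y i j
    by (intro differentiable_nth F.diff_wmat that)
  have ds: "s differentiable (at y)" if y: "y \<in> V" for y
    unfolding s_def[abs_def] det_3 using dbl(6)[OF y]
    by (intro differentiable_divide)
      (auto intro!: differentiable_add differentiable_diff differentiable_mult dmn y differentiable_sum
        simp: trace_def matrix_matrix_mult_def)
  have dq: "q differentiable (at y)" if y: "y \<in> V" for y
    unfolding q_def[abs_def] using dbl(1)[OF y]
    by (intro differentiable_scaleR differentiable_divide differentiable_add differentiable_const
        differentiable_mult ds F.diff_wmat y) auto
  have "q x0 \<noteq> 0" using dbl(4)[OF fc(2)] by (auto simp: trace_linear)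
  then obtain e where e: "q x0 *v e \<noteq> 0" using matrix_eq[of "q x0" 0] by auto
  define V1 where "V1 = V \<inter> (\<lambda>y. q y *v e) -` (- {0})"
  have dqe: "(\<lambda>y. q y *v e) differentiable (at y)" if "y \<in> V" for y
    by (intro differentiable_mat_vec dq differentiable_const that)
  have "continuous_on V (\<lambda>y. q y *v e)"
    using dqe by (auto intro!: continuous_at_imp_continuous_on differentiable_imp_continuous_within)
  then have "open ((\<lambda>y. q y *v e) -` (- {0}) \<inter> V)"
    using continuous_on_open_vimage[OF F.open_V] open_Compl[OF closed_singleton] by blast
  then have V1: "open V1" "V1 \<subseteq> V" "x0 \<in> V1"
    using fc(2) e by (auto simp: V1_def Int_commute)
  define u where "u y = inverse (norm (q y *v e)) *\<^sub>R (q y *v e)" for y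
  have nqe: "q y *v e \<noteq> 0" "y \<in> V" if "y \<in> V1" for y using that by (auto simp: V1_def)
  have qu: "q y = proj3 (u y)" "u y \<bullet> u y = 1" if y: "y \<in> V1" for y
    using rank_one_projection[OF dbl(2-4)[OF nqe(2)[OF y]] nqe(1)[OF y]] by (auto simp: u_def)
  have du: "u differentiable (at y)" if y: "y \<in> V1" for y
  proof -
    have "norm differentiable (at (q y *v e))" using nqe(1)[OF y] by (rule differentiable_norm_at)
    then have "(\<lambda>y. norm (q y *v e)) differentiable (at y)"
      by (rule dirD_compose(2)[OF dqe[OF nqe(2)[OF y]]])
    then show ?thesis
      unfolding u_def[abs_def] using nqe[OF y]
      by (intro differentiable_scaleR differentiable_inverse dqe) auto
  qed
  have fc1: "framed_chart S G V1 E"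
    by unfold_locales (use V1 F.V_S F.frame_E F.det_E F.diff_E in auto)
  interpret F1: framed_chart S G V1 E by (rule fc1)
  have m: "F1.wmat y = s y *\<^sub>R (3 *\<^sub>R proj3 (u y) - mat 1)" if "y \<in> V1" for y
    using dbl(5)[OF nqe(2)[OF that]] qu(1)[OF that] by simp
  define J where "J y = in_frame (E y) (sdm (u y))" for y
  have dJ: "J differentiable (at y)" if "y \<in> V1" for y
    by (rule F1.nabla_endo_frame(1)[OF that differentiable_sdm[OF du[OF that]] J_def])
  have "kaehler_at G J y" if y: "y \<in> V1" for y
  proof -
    have nz: "\<And>y. y \<in> V1 \<Longrightarrow> s y \<noteq> 0" using dbl(1) nqe(2) by blast
    note deg = y m qu(2) nz ds[OF nqe(2)[OF y]] du[OF y]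
    have "F1.nabla_sd u y v = 0" for v
      using F1.condition_ii_degenerate[OF deg] F1.condition_iii_degenerate[OF deg] c[OF F1.V_in_S[OF y]] by blast
    then have "nabla_endo G (\<lambda>_. v) J y = 0" for v
      using F1.nabla_endo_selfdual[OF y du[OF y] J_def, of v]
      by (simp add: F1.nabla_sd_def sdm_linear in_frame_linear)
    then show ?thesis
      unfolding kaehler_at_def
      using structure_of_selfdual[OF F1.frame_E[OF y] F1.det_E[OF y] qu(2)[OF y]] by (simp add: J_def)
  qed
  then show ?thesis using that[of V1 J] V1 F.V_S dJ by blast
qed

end

section \<open>Change of charts\<close>

lemma jacobian_dirD: "f differentiable (at x) \<Longrightarrow> jacobian f (at x) *v v = dirD f x v" for f :: "real^4 \<Rightarrow> real^4"
  unfolding jacobian_def by (simp add: matrix_works linear_matrix_vector_mul_eq linear_frechet_derivative)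

lemma smooth_on_jacobian:
  fixes f :: "real^4 \<Rightarrow> real^4"
  assumes "open N" "smooth_on N f"
  shows "smooth_on N (\<lambda>x. jacobian f (at x))"
  unfolding jacobian_def matrix_def
  by (intro smooth_on_vec smooth_on_nth smooth_on_dirD assms)

text \<open>Two metrics related by an orientation-preserving smooth map \<open>\<phi>\<close>, as happens for the metric in two
  charts and their transition map.\<close>

locale chart_change = A: chart_metric S G + B: chart_metric S' G'
  for S G S' G' +
  fixes N :: "(real^4) set" and \<phi> :: "real^4 \<Rightarrow> real^4"
  assumes open_O: "open N" and O_S: "N \<subseteq> S'" and phi_S: "x \<in> N \<Longrightarrow> \<phi> x \<in> S"
    and smooth_phi: "smooth_on N \<phi>"
    and det_phi: "x \<in> N \<Longrightarrow> det (jacobian \<phi> (at x)) > 0"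
    and metric_phi: "x \<in> N \<Longrightarrow>
       G' x = transpose (jacobian \<phi> (at x)) ** G (\<phi> x) ** jacobian \<phi> (at x)"
begin

abbreviation "Dphi x \<equiv> jacobian \<phi> (at x)"

lemma phi_differentiable: "x \<in> N \<Longrightarrow> \<phi> differentiable (at x)"
  by (rule smooth_on_differentiable[OF smooth_phi])

lemma Dphi_differentiable: "x \<in> N \<Longrightarrow> (\<lambda>x. Dphi x) differentiable (at x)"
  by (rule smooth_on_differentiable[OF smooth_on_jacobian[OF open_O smooth_phi]])

lemma Dphi_inv: "x \<in> N \<Longrightarrow> Dphi x ** matrix_inv (Dphi x) = mat 1"
  "x \<in> N \<Longrightarrow> matrix_inv (Dphi x) ** Dphi x = mat 1"
  using matrix_inv_mul[of "Dphi x"] det_phi[of x] by auto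

lemma Dphi_inv_differentiable: "x \<in> N \<Longrightarrow> (\<lambda>x. matrix_inv (Dphi x)) differentiable (at x)"
  by (rule smooth_on_differentiable[OF smooth_on_matrix_inv[OF open_O smooth_on_jacobian[OF open_O smooth_phi]]])
    (use det_phi in fastforce)+

text \<open>The transformed connection is torsion-free and compatible with the transformed metric.\<close>

lemma gam_transform:
  assumes x: "x \<in> N"
  shows "Dphi x ** gam G' x v = dirD (\<lambda>x. Dphi x) x v + gam G (\<phi> x) (Dphi x *v v) ** Dphi x"
proof -
  let ?D = "Dphi x" and ?g = "\<lambda>v. gam G (\<phi> x) (Dphi x *v v)" and ?dD = "\<lambda>v. dirD (\<lambda>x. Dphi x) x v"
  define T where "T v = matrix_inv ?D ** (?dD v + ?g v ** ?D)" for v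
  have DT: "?D ** T v = ?dD v + ?g v ** ?D" for v
    by (simp add: T_def matrix_mul_assoc Dphi_inv[OF x])
  have sym: "?dD u *v v = ?dD v *v u" for u v
  proof -
    have "?dD u *v v = dirD (\<lambda>x. dirD \<phi> x v) x u" for u v
    proof -
      have "dirD (\<lambda>x. Dphi x *v v) x u = ?dD u *v v"
        by (simp add: dirD_matrix_vector_mul[OF Dphi_differentiable[OF x]])
      moreover have "dirD (\<lambda>x. Dphi x *v v) x u = dirD (\<lambda>x. dirD \<phi> x v) x u"
        by (rule dirD_cong[OF open_O x jacobian_dirD[OF phi_differentiable]])
      ultimately show ?thesis by simp
    qed
    then show ?thesis using dirD_commute[OF smooth_phi open_O x] by simp
  qed
  have "T v = gam G' x v"
  proof (rule B.levi_civita_unique)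
    show "x \<in> S'" using x O_S by blast
    show "T u *v v = T v *v u" for u v
    proof -
      have "T u *v v = matrix_inv ?D *v (?dD u *v v + ?g u *v (?D *v v))" for u v
        by (simp add: T_def mat_vec_distribs matrix_vector_mul_assoc mat_distribs matrix_mul_assoc)
      then show ?thesis using sym A.gam_symmetric[OF phi_S[OF x]] by simp
    qed
    show "dirD G' x v = transpose (T v) ** G' x + G' x ** T v" for v
    proof -
      have dG: "(\<lambda>x. G (\<phi> x)) differentiable (at x)"
        by (rule dirD_compose(2)[OF phi_differentiable[OF x] A.G_differentiable[OF phi_S[OF x]]])
      have dGv: "dirD (\<lambda>x. G (\<phi> x)) x v = transpose (?g v) ** G (\<phi> x) + G (\<phi> x) ** ?g v"
        by (simp add: dirD_compose(1)[OF phi_differentiable[OF x] A.G_differentiable[OF phi_S[OF x]]]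
            A.metric_compatible[OF phi_S[OF x]] jacobian_dirD[OF phi_differentiable[OF x]])
      have "dirD G' x v = dirD (\<lambda>x. transpose (Dphi x) ** G (\<phi> x) ** Dphi x) x v"
        by (rule dirD_cong[OF open_O x metric_phi])
      also have "\<dots> = transpose ?D ** G (\<phi> x) ** (?dD v + ?g v ** ?D)
          + transpose (?dD v + ?g v ** ?D) ** G (\<phi> x) ** ?D"
        by (simp add: dirD_matrix_mul dirD_transpose Dphi_differentiable[OF x] dG dGv differentiable_mat
            differentiable_transpose transpose_add matrix_transpose_mul mat_distribs matrix_mul_assoc
            algebra_simps)
      also have "\<dots> = transpose (T v) ** G' x + G' x ** T v"
        unfolding DT[symmetric] metric_phi[OF x]
        by (simp add: matrix_transpose_mul matrix_mul_assoc algebra_simps)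
      finally show ?thesis .
    qed
  qed
  then show ?thesis using DT[of v] by (simp only:)
qed

text \<open>The Jacobian of \<open>\<phi>\<close> intertwines \<open>J'\<close> with \<open>J\<close>, which transports the pointwise conditions. For the
  covariant derivative it is used as a moving frame: \<open>gam_transform\<close> is the hypothesis of \<open>gauge\<close>.\<close>

lemma kaehler_transform:
  assumes J: "\<And>x. x \<in> N \<Longrightarrow> J differentiable (at (\<phi> x))" "\<And>x. x \<in> N \<Longrightarrow> kaehler_at G J (\<phi> x)"
    and x: "x \<in> N"
  defines "J' \<equiv> \<lambda>x. matrix_inv (Dphi x) ** J (\<phi> x) ** Dphi x"
  shows "J' differentiable (at x)" "kaehler_at G' J' x"
proof -
  let ?D = "Dphi x"
  have dJ: "(\<lambda>x. J (\<phi> x)) differentiable (at x)"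
    by (rule dirD_compose(2)[OF phi_differentiable[OF x] J(1)[OF x]])
  show dJ': "J' differentiable (at x)"
    unfolding J'_def by (intro differentiable_mat Dphi_inv_differentiable Dphi_differentiable dJ x)
  have ka: "kaehler_at G J (\<phi> x)" by (rule J(2)[OF x])
  have DJ: "J (\<phi> y) ** Dphi y = Dphi y ** J' y" if "y \<in> N" for y
    by (simp add: J'_def matrix_mul_assoc Dphi_inv[OF that])
  have inj: "A = B" if "?D ** A = ?D ** B" for A B
  proof -
    have "matrix_inv ?D ** (?D ** A) = matrix_inv ?D ** (?D ** B)" using that by simp
    then show ?thesis by (simp add: matrix_mul_assoc Dphi_inv[OF x])
  qed
  have 1: "J' x ** J' x = - mat 1"
  proof (rule inj)
    have "?D ** (J' x ** J' x) = J (\<phi> x) ** (?D ** J' x)"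
      by (simp add: matrix_mul_assoc DJ[OF x])
    also have "\<dots> = (J (\<phi> x) ** J (\<phi> x)) ** ?D"
      by (simp add: matrix_mul_assoc DJ[OF x, symmetric])
    finally have "?D ** (J' x ** J' x) = (J (\<phi> x) ** J (\<phi> x)) ** ?D" .
    then show "?D ** (J' x ** J' x) = ?D ** (- mat 1)"
      using ka by (simp add: kaehler_at_def mat_distribs)
  qed
  have form: "form_of (G' x) (J' x) v w = form_of (G (\<phi> x)) (J (\<phi> x)) (?D *v v) (?D *v w)" for v w
  proof -
    have "form_of (G' x) (J' x) v w = (?D *v (J' x *v v)) \<bullet> (G (\<phi> x) *v (?D *v w))"
      by (simp add: form_of_def ip_def metric_phi[OF x] inner_matrix_vector matrix_vector_mul_assoc
          matrix_transpose_mul matrix_mul_assoc del: transpose_matrix_vector)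
    also have "?D *v (J' x *v v) = J (\<phi> x) *v (?D *v v)"
      by (simp add: matrix_vector_mul_assoc DJ[OF x])
    finally show ?thesis by (simp add: form_of_def ip_def)
  qed
  have 2: "adj (G' x) (J' x) = - J' x"
  proof -
    have nd: "det (G (\<phi> x)) \<noteq> 0" "det (G' x) \<noteq> 0"
      using A.det_G[OF phi_S[OF x]] B.det_G O_S x by auto
    have "adj (G (\<phi> x)) (J (\<phi> x)) = - J (\<phi> x)" using ka by (simp add: kaehler_at_def)
    then have "G (\<phi> x) ** (matrix_inv (G (\<phi> x)) ** transpose (J (\<phi> x)) ** G (\<phi> x)) = G (\<phi> x) ** (- J (\<phi> x))"
      unfolding adj_def by simp
    then have s: "transpose (J (\<phi> x)) ** G (\<phi> x) = - (G (\<phi> x) ** J (\<phi> x))"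
      by (simp add: matrix_mul_assoc matrix_inv_mul[OF nd(1)] mat_distribs)
    have "transpose (J' x) ** G' x = transpose (?D ** J' x) ** G (\<phi> x) ** ?D"
      by (simp add: metric_phi[OF x] matrix_transpose_mul matrix_mul_assoc)
    also have "\<dots> = transpose ?D ** (transpose (J (\<phi> x)) ** G (\<phi> x)) ** ?D"
      by (simp add: DJ[OF x, symmetric] matrix_transpose_mul matrix_mul_assoc)
    also have "\<dots> = - (transpose ?D ** G (\<phi> x) ** (J (\<phi> x) ** ?D))"
      unfolding s by (simp add: mat_distribs matrix_mul_assoc)
    also have "\<dots> = - (G' x ** J' x)"
      unfolding DJ[OF x] by (simp add: metric_phi[OF x] matrix_mul_assoc)
    finally have "adj (G' x) (J' x) = matrix_inv (G' x) ** (- (G' x ** J' x))"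
      unfolding adj_def by (simp add: matrix_mul_assoc[symmetric])
    then show ?thesis by (simp add: mat_distribs matrix_mul_assoc matrix_inv_mul[OF nd(2)])
  qed
  have 3: "nabla_endo G' (\<lambda>_. v) J' x = 0" for v
  proof (rule inj)
    have "nabla_endo G (\<lambda>_. ?D *v v) J (\<phi> x) = 0" using ka by (simp add: kaehler_at_def)
    then have z: "dirD (\<lambda>x. J (\<phi> x)) x v + gam G (\<phi> x) (?D *v v) ** J (\<phi> x) - J (\<phi> x) ** gam G (\<phi> x) (?D *v v) = 0"
      by (simp add: A.nabla_endo_gam[OF J(1)[OF x]] dirD_compose(1)[OF phi_differentiable[OF x] J(1)[OF x]]
          jacobian_dirD[OF phi_differentiable[OF x]])
    show "?D ** nabla_endo G' (\<lambda>_. v) J' x = ?D ** 0"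
      unfolding B.nabla_endo_gam[OF dJ']
      using gauge[OF open_O x DJ dJ Dphi_differentiable[OF x] dJ' gam_transform[OF x], of v] z
      by (simp add: mat_distribs)
  qed
  have 4: "vol (G' x) v1 v2 v3 v4 = vol (G (\<phi> x)) (?D *v v1) (?D *v v2) (?D *v v3) (?D *v v4)" for v1 v2 v3 v4
  proof -
    have "(vector [?D *v v1, ?D *v v2, ?D *v v3, ?D *v v4] :: real^4^4) = vector [v1, v2, v3, v4] ** transpose ?D"
      by (simp add: vec_eq_iff forall_4 matrix_matrix_mult_def matrix_vector_mult_def transpose_def sum_4 mult.commute)
    moreover have "sqrt (det (G' x)) = det ?D * sqrt (det (G (\<phi> x)))"
    proof -
      have "det (G' x) = (det ?D)\<^sup>2 * det (G (\<phi> x))"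
        by (simp add: metric_phi[OF x] det_mul power2_eq_square mult_ac)
      then show ?thesis using det_phi[OF x] by (simp add: real_sqrt_mult)
    qed
    ultimately show ?thesis by (simp add: vol_def det_mul mult_ac)
  qed
  show "kaehler_at G' J' x"
    using ka 1 2 3 unfolding kaehler_at_def 4 wedge_def form by blast
qed

end

section \<open>Locally Kaehler metrics on the manifold\<close>

lemma locally_kaehler_iff:
  "locally_kaehler M atlas g \<longleftrightarrow> (\<forall>p\<in>topspace M. \<exists>U J. openin M U \<and> p \<in> U \<and>
     endomorphism_field atlas U J \<and> (\<forall>c\<in>atlas. \<forall>x\<in>snd c ` (fst c \<inter> U). kaehler_at (g c) (J c) x))"
  unfolding locally_kaehler_def kaehler_at_def ..

context oriented_riemannian_4manifold
begin

lemma chart_subset: "c \<in> atlas \<Longrightarrow> fst c \<subseteq> topspace M"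
  by (simp add: chart_domain_open openin_subset)

lemma chart_metric: "c \<in> atlas \<Longrightarrow> chart_metric (chart_image c) (g c)"
  by unfold_locales (auto simp: chart_image_open metric_smooth metric_symmetric metric_positive)

lemma chart_inj:
  assumes "c \<in> atlas"
  shows "inj_on (snd c) (fst c)"
proof -
  have "topspace (subtopology M (fst c)) = fst c"
    using chart_subset[OF assms] by auto
  then show ?thesis
    using homeomorphic_imp_injective_map[OF chart_homeomorphic[OF assms]] by simp
qed

lemma chart_open:
  assumes "c \<in> atlas" "openin M U"
  shows "open (snd c ` (fst c \<inter> U))"
proof -
  have "openin (subtopology M (fst c)) (fst c \<inter> U)"
    using assms by (metis Int_commute openin_subtopology_Int)
  then have "openin (top_of_set (chart_image c)) (snd c ` (fst c \<inter> U))"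
    using homeomorphic_imp_open_map[OF chart_homeomorphic[OF assms(1)]] by (simp add: open_map_def)
  then show ?thesis using chart_image_open[OF assms(1)] openin_open_trans by blast
qed

lemma chart_preimage_open:
  assumes "c \<in> atlas" "open V"
  shows "openin M {q \<in> fst c. snd c q \<in> V}"
proof -
  have "continuous_map (subtopology M (fst c)) euclidean (snd c)"
    using homeomorphic_imp_continuous_map[OF chart_homeomorphic[OF assms(1)]]
    by (rule continuous_map_into_fulltopology)
  then have "openin (subtopology M (fst c)) {q \<in> topspace (subtopology M (fst c)). snd c q \<in> V}"
    by (rule openin_continuous_map_preimage) (use assms(2) in simp)
  then show ?thesis
    using chart_domain_open[OF assms(1)] chart_subset[OF assms(1)]
    by (simp add: openin_open_subtopology Int_absorb1)
qed

lemma transition_chart: "c \<in> atlas \<Longrightarrow> q \<in> fst c \<Longrightarrow> transition c c' (snd c q) = snd c' q"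
  by (simp add: transition_def chart_inj)

lemma locally_kaehler_imp:
  assumes lk: "locally_kaehler M atlas g"
    and W: "\<forall>c\<in>atlas. \<forall>x\<in>chart_image c. \<exists>A\<in>selfdual (g c x). Wplus (g c) x A \<noteq> 0"
    and c: "c \<in> atlas" and x: "x \<in> chart_image c"
  shows "condition_det (g c) x \<and> condition_ii (g c) x \<and> condition_iii (g c) x"
proof -
  obtain p where p: "p \<in> fst c" "x = snd c p" using x by (auto simp: chart_image_def)
  then have "p \<in> topspace M" using chart_subset c by blast
  then obtain U J where U: "openin M U" "p \<in> U" "endomorphism_field atlas U J"
    "\<And>y. y \<in> snd c ` (fst c \<inter> U) \<Longrightarrow> kaehler_at (g c) (J c) y"
    using lk c unfolding locally_kaehler_iff by metis
  interpret chart_metric "chart_image c" "g c" by (rule chart_metric[OF c])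
  show ?thesis
  proof (rule kaehler_imp_conditions[where V = "snd c ` (fst c \<inter> U)" and J = "J c"])
    show "open (snd c ` (fst c \<inter> U))" by (rule chart_open[OF c U(1)])
    show "x \<in> snd c ` (fst c \<inter> U)" using p U by blast
    show "snd c ` (fst c \<inter> U) \<subseteq> chart_image c" by (auto simp: chart_image_def)
    show "smooth_on (snd c ` (fst c \<inter> U)) (J c)" using U(3) c by (auto simp: endomorphism_field_def)
  qed (use U(4) W c in auto)
qed

text \<open>The structure \<open>J0\<close> found in one chart \<open>c\<close> near \<open>p\<close> is carried to every other chart by the Jacobian of
  the transition map to \<open>c\<close>; the chain rule gives the transformation law of an endomorphism field.\<close>

lemma locally_kaehlerI:
  assumes W: "\<forall>c\<in>atlas. \<forall>x\<in>chart_image c. \<exists>A\<in>selfdual (g c x). Wplus (g c) x A \<noteq> 0"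
    and cond: "\<And>c x. c \<in> atlas \<Longrightarrow> x \<in> chart_image c \<Longrightarrow>
      condition_det (g c) x \<and> (condition_ii (g c) x \<or> condition_iii (g c) x)"
  shows "locally_kaehler M atlas g"
  unfolding locally_kaehler_iff
proof
  fix p assume "p \<in> topspace M"
  then obtain c where c: "c \<in> atlas" "p \<in> fst c" using atlas_cover by blast
  interpret chart_metric "chart_image c" "g c" by (rule chart_metric[OF c(1)])
  have "snd c p \<in> chart_image c" using c by (simp add: chart_image_def)
  moreover have "\<exists>A\<in>selfdual (g c y). Wplus (g c) y A \<noteq> 0" "condition_det (g c) y"
    "condition_ii (g c) y \<or> condition_iii (g c) y" if "y \<in> chart_image c" for y
    using W cond[OF c(1) that] c(1) that by blast+
  ultimately obtain V J0 where V: "open V" "snd c p \<in> V" "V \<subseteq> chart_image c"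
    "\<And>y. y \<in> V \<Longrightarrow> J0 differentiable (at y)" "\<And>y. y \<in> V \<Longrightarrow> kaehler_at (g c) J0 y"
    using conditions_imp_kaehler[of "snd c p"] by blast
  define U where "U = {q \<in> fst c. snd c q \<in> V}"
  have U: "openin M U" "p \<in> U" using chart_preimage_open[OF c(1) V(1)] c V(2) by (auto simp: U_def)
  define D where "D c' x = jacobian (transition c' c) (at x)" for c' x
  define J where "J c' x = matrix_inv (D c' x) ** J0 (transition c' c x) ** D c' x" for c' x
  have inV: "transition c' c x \<in> V" if "c' \<in> atlas" "x \<in> snd c' ` (fst c' \<inter> U)" for c' x
    using that by (auto simp: U_def transition_chart)
  have cc: "chart_change (chart_image c) (g c) (chart_image c') (g c') (snd c' ` (fst c' \<inter> U)) (transition c' c)"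
    if c': "c' \<in> atlas" for c'
  proof -
    have sub: "snd c' ` (fst c' \<inter> U) \<subseteq> snd c' ` (fst c' \<inter> fst c)" by (auto simp: U_def)
    interpret B: chart_metric "chart_image c'" "g c'" by (rule chart_metric[OF c'])
    show ?thesis
    proof
      show "open (snd c' ` (fst c' \<inter> U))" by (rule chart_open[OF c' U(1)])
      show "snd c' ` (fst c' \<inter> U) \<subseteq> chart_image c'" by (auto simp: chart_image_def)
      show "smooth_on (snd c' ` (fst c' \<inter> U)) (transition c' c)"
        by (rule smooth_on_subset[OF transition_smooth[OF c' c(1)] sub])
      fix x assume x: "x \<in> snd c' ` (fst c' \<inter> U)"
      then show "transition c' c x \<in> chart_image c" using inV[OF c'] V(3) by blast
      show "det (jacobian (transition c' c) (at x)) > 0"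
        using transition_orientation[OF c' c(1)] x sub by blast
      show "g c' x = transpose (jacobian (transition c' c) (at x)) ** g c (transition c' c x)
          ** jacobian (transition c' c) (at x)"
        using metric_transform[OF c' c(1)] x sub by blast
    qed
  qed
  have J: "J c' differentiable (at x)" "kaehler_at (g c') (J c') x"
    if "c' \<in> atlas" "x \<in> snd c' ` (fst c' \<inter> U)" for c' x
    unfolding J_def[abs_def] D_def[abs_def]
    using chart_change.kaehler_transform[OF cc[OF that(1)], of J0 x] that inV V(4,5) by blast+
  have sm: "smooth_on (snd c' ` (fst c' \<inter> U)) (J c')" if c': "c' \<in> atlas" for c'
  proof (rule chart_metric.parallel_smooth[OF chart_metric[OF c']])
    show "open (snd c' ` (fst c' \<inter> U))" by (rule chart_open[OF c' U(1)])
    show "snd c' ` (fst c' \<inter> U) \<subseteq> chart_image c'" by (auto simp: chart_image_def)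
  qed (use J[OF c'] in \<open>auto simp: kaehler_at_def\<close>)
  have tr: "jacobian (transition c1 c2) (at x) ** J c1 x
      = J c2 (transition c1 c2 x) ** jacobian (transition c1 c2) (at x)"
    if c1: "c1 \<in> atlas" and c2: "c2 \<in> atlas" and x: "x \<in> snd c1 ` (fst c1 \<inter> fst c2 \<inter> U)" for c1 c2 x
  proof -
    let ?T = "jacobian (transition c1 c2) (at x)" and ?y = "transition c1 c2 x"
    obtain q where q: "q \<in> fst c1" "q \<in> fst c2" "q \<in> U" "x = snd c1 q" using x by blast
    have y: "?y = snd c2 q" using q by (simp add: transition_chart[OF c1])
    have x1: "x \<in> snd c1 ` (fst c1 \<inter> U)" and y1: "?y \<in> snd c2 ` (fst c2 \<inter> U)" using q y by auto
    have comp: "transition c1 c z = transition c2 c (transition c1 c2 z)"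
      if "z \<in> snd c1 ` (fst c1 \<inter> fst c2 \<inter> U)" for z
      using that by (auto simp: transition_chart[OF c1] transition_chart[OF c2])
    have op: "open (snd c1 ` (fst c1 \<inter> fst c2 \<inter> U))"
      using chart_open[OF c1 openin_Int[OF chart_domain_open[OF c2] U(1)]] by (simp add: Int_assoc)
    have dT: "transition c1 c2 differentiable (at x)"
      using smooth_on_differentiable[OF transition_smooth[OF c1 c2]] q by blast
    have d2: "transition c2 c differentiable (at ?y)"
      by (rule chart_change.phi_differentiable[OF cc[OF c2] y1])
    have d1: "transition c1 c differentiable (at x)"
      by (rule chart_change.phi_differentiable[OF cc[OF c1] x1])
    have DD: "D c1 x = D c2 ?y ** ?T"
    proof (rule matrix_eq_transform)
      fix v
      have "D c1 x *v v = dirD (\<lambda>z. transition c2 c (transition c1 c2 z)) x v"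
        unfolding D_def jacobian_dirD[OF d1] by (rule dirD_cong[OF op x comp])
      also have "\<dots> = (D c2 ?y ** ?T) *v v"
        by (simp add: dirD_compose(1)[OF dT d2] D_def matrix_vector_mul_assoc[symmetric] jacobian_dirD[OF d2]
            jacobian_dirD[OF dT])
      finally show "D c1 x *v v = (D c2 ?y ** ?T) *v v" .
    qed
    have i1: "D c1 x ** matrix_inv (D c1 x) = mat 1"
      unfolding D_def by (rule chart_change.Dphi_inv(1)[OF cc[OF c1] x1])
    have i2: "matrix_inv (D c2 ?y) ** D c2 ?y = mat 1"
      unfolding D_def by (rule chart_change.Dphi_inv(2)[OF cc[OF c2] y1])
    have "?T ** matrix_inv (D c1 x) = (matrix_inv (D c2 ?y) ** D c2 ?y) ** (?T ** matrix_inv (D c1 x))"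
      by (simp add: i2)
    also have "\<dots> = matrix_inv (D c2 ?y) ** (D c1 x ** matrix_inv (D c1 x))"
      by (simp add: DD matrix_mul_assoc)
    finally have "?T ** matrix_inv (D c1 x) = matrix_inv (D c2 ?y)" by (simp add: i1)
    then show ?thesis
      by (simp add: J_def matrix_mul_assoc comp[OF x, symmetric]) (simp add: DD matrix_mul_assoc)
  qed
  have "endomorphism_field atlas U J"
    unfolding endomorphism_field_def using sm tr by blast
  moreover have "\<forall>c\<in>atlas. \<forall>x\<in>snd c ` (fst c \<inter> U). kaehler_at (g c) (J c) x" using J(2) by blast
  ultimately show "\<exists>U J. openin M U \<and> p \<in> U \<and> endomorphism_field atlas U J \<and>
      (\<forall>c\<in>atlas. \<forall>x\<in>snd c ` (fst c \<inter> U). kaehler_at (g c) (J c) x)"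
    using U by blast
qed

end

theorem theorem3p4:
  fixes M :: "'a topology" and atlas :: "'a chart set"
    and g :: "'a chart \<Rightarrow> real^4 \<Rightarrow> real^4^4"
  assumes "oriented_riemannian_4manifold M atlas g"
    and "\<forall>c\<in>atlas. \<forall>x\<in>chart_image c. \<exists>A\<in>selfdual (g c x). Wplus (g c) x A \<noteq> 0"
  shows "(locally_kaehler M atlas g \<longleftrightarrow>
            (\<forall>c\<in>atlas. \<forall>x\<in>chart_image c.
               (det_Wplus (g c) x)^2 = 1/54 * (norm_Wplus (g c) x)^6 \<and>
               norm_sq_nabla_Wplus (g c) x =
                 ip (g c x) (grad (g c) (norm_Wplus (g c)) x) (grad (g c) (norm_Wplus (g c)) x)))
       \<and> (locally_kaehler M atlas g \<longleftrightarrow>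
            (\<forall>c\<in>atlas. \<forall>x\<in>chart_image c.
               (det_Wplus (g c) x)^2 = 1/54 * (norm_Wplus (g c) x)^6 \<and>
               (\<forall>v. delta_Wplus (g c) x v
                  + Wplus2 (g c) x (grad (g c) (\<lambda>y. ln (norm_Wplus (g c) y)) x) v = 0)))"
proof -
  interpret oriented_riemannian_4manifold M atlas g by fact
  show ?thesis
    unfolding condition_det_def[symmetric] condition_ii_def[symmetric] condition_iii_def[symmetric]
    using locally_kaehler_imp[OF _ assms(2)] locally_kaehlerI[OF assms(2)] by blast
qed

end
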